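(* Let $d\in\mathbb{N}$, $T>0$, $1\le i\le l$. Let $u\in C^4(\widetilde\Omega_i)$ and $v\in C^3(\widetilde\Omega_i)$, $\widetilde\Omega_i=D\times[0,t_i]$, be the classical solution of the wave problem, let $(u_{\theta_j},v_{\theta_j})$, $1\le j\le i$, be HLConcPINN approximations with parameters $\theta_j$, and let $\hat u_i=u_{\theta_i}-u$, $\hat v_i=v_{\theta_i}-v$. Then $$\int_{t_{i-1}}^{t_i}\int_D\big(|\hat u_i|^2+|\nabla\hat u_i|^2+|\hat v_i|^2\big)dx\,dt\le C_{T_i}\Delta t\exp(2\Delta t)=\mathcal{O}\Big(\mathcal{E}_{T_i}(\theta_i,\mathcal{S}_i)^2+M_{int_i}^{-\frac2{d+1}}+M_{tb_i}^{-\frac2d}+M_{sb_i}^{-\frac1d}\Big),$$ where $C_{T_0}=0$, $C_{T_i}=\widetilde C_{T_i}+2C_{T_{i-1}}\exp(2\Delta t)$ and $$\widetilde C_{T_i}=2\sum_{j=1}^i\Big(C_{(R_{tb1_i}^2(x,t_{j-1}))}M_{tb_i}^{-\frac2d}+\mathcal{Q}^D_{M_{tb_i}}(R_{tb1_i}^2(x,t_{j-1}))+C_{(R_{tb2_i}^2(x,t_{j-1}))}M_{tb_i}^{-\frac2d}+\mathcal{Q}^D_{M_{tb_i}}(R_{tb2_i}^2(x,t_{j-1}))\Big)$$ $$+2\sum_{j=1}^i\Big(C_{(|\nabla R_{tb1_i}(x,t_{j-1})|^2)}M_{tb_i}^{-\frac2d}+\mathcal{Q}^D_{M_{tb_i}}(|\nabla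 R_{tb1_i}(x,t_{j-1})|^2)\Big)+C_{(R_{int1_i}^2)}M_{int_i}^{-\frac2{d+1}}+\mathcal{Q}^{\Omega_i}_{M_{int_i}}(R_{int1_i}^2)$$ $$+C_{(R_{int2_i}^2)}M_{int_i}^{-\frac2{d+1}}+\mathcal{Q}^{\Omega_i}_{M_{int_i}}(R_{int2_i}^2)+C_{(|\nabla R_{int1_i}|^2)}M_{int_i}^{-\frac2{d+1}}+\mathcal{Q}^{\Omega_i}_{M_{int_i}}(|\nabla R_{int1_i}|^2)$$ $$+2|\Delta t|^{\frac12}\Big(C_{\partial D_{1i}}\big(C_{(R_{sb1_i}^2)}M_{sb_i}^{-\frac2d}+\mathcal{Q}^{\Omega_{*i}}_{M_{sb_i}}(R_{sb1_i}^2)\big)^{\frac12}+C_{\partial D_{2i}}\big(C_{(R_{sb2_i}^2)}M_{sb_i}^{-\frac2d}+\mathcal{Q}^{\Omega_{*i}}_{M_{sb_i}}(R_{sb2_i}^2)\big)^{\frac12}\Big).$$ Here, with $\widetilde\Omega_{*i}=\partial D\times[0,t_i]$, $C_{\partial D_{1i}}=|\partial D|^{\frac12}(\|u\|_{C^1(\widetilde\Omega_{*i})}+\|u_{\theta_i}\|_{C^1(\widetilde\Omega_{*i})})$ and $C_{\partial D_{2i}}=|\partial D|^{\frac12}(\|v\|_{C(\widetilde\Omega_{*i})}+\|v_{\theta_i}\|_{C(\widetilde\Omega_{*i})})$.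
   Context: Wave problem. $D=[0,1)^d$ is the torus, $T>0$, and $(u,v)$ solves $\partial_tu-v=0$ and $\partial_tv-\Delta u=f$ in $D\times[0,T]$, $u(x,0)=\psi_1(x)$, $v(x,0)=\psi_2(x)$ in $D$, with periodic boundary conditions $u(x,t)=u(x+1,t)$ and $\nabla u(x,t)=\nabla u(x+1,t)$ on $\partial D\times[0,T]$. Here $\partial D$ is the boundary of the unit cube, and for $x$ on a face of the cube $x+1$ denotes the corresponding point on the opposite face. $\nabla,\Delta$ act in the space variable. Time blocks. For an integer $l\ge1$ put $\Delta t=T/l$, $t_i=i\Delta t$ ($0\le i\le l$), $\Omega_i=D\times[t_{i-1},t_i]$, $\Omega_{*i}=\partial D\times[t_{i-1},t_i]$. HLConcPINN (hidden-layer concatenated neural network). With $L\ge 3$, input dimension $l_0$, output dimension $l_L$ and hidden widths $l_1,\dots,l_{L-1}$, it is a map $z\in\mathbb{R}^{l_0}\mapsto\sum_{m=1}^{L-1}M_m h_m(z)+b_L$, where $h_0(z)=z$ and $h_m(z)=\sigma_m(W_m h_{m-1}(z)+b_m)$, with $W_m\in\mathbb{R}^{l_m\times l_{m-1}}$, $b_m\in\mathbb{R}^{l_m}$, $M_m\in\mathbb{R}^{l_L\times l_m}$, $b_L\in\mathbb{R}^{l_L}$; activations act componentwise, $\sigma_1=\sigma_2=\tanh$, and $\sigma_m$ for $m\ge3$ are smooth activation functions. $\theta$ denotes the collection of all parameters. Here $l_0=d+1$ (input $(x,t)$), and $u_{\theta_i},v_{\theta_i}$ are real-valued and considered on $D\times[0,t_i]$.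 Residuals. $R_{int1_i}=\partial_tu_{\theta_i}-v_{\theta_i}$; $R_{int2_i}=\partial_tv_{\theta_i}-\Delta u_{\theta_i}-f$; $R_{tb1_i}(x,t_{j-1})=u_{\theta_i}(x,t_{j-1})-u_{\theta_{j-1}}(x,t_{j-1})$ and $R_{tb2_i}(x,t_{j-1})=v_{\theta_i}(x,t_{j-1})-v_{\theta_{j-1}}(x,t_{j-1})$ for $1\le j\le i$, with $u_{\theta_0}(x,t_0)=\psi_1(x)$, $v_{\theta_0}(x,t_0)=\psi_2(x)$; on $\partial D$: $R_{sb1_i}(x,t)=v_{\theta_i}(x,t)-v_{\theta_i}(x+1,t)$, $R_{sb2_i}(x,t)=\nabla u_{\theta_i}(x,t)-\nabla u_{\theta_i}(x+1,t)$ (and $R_{sb2_i}^2$ means $|R_{sb2_i}|^2$). Quadrature. For a set $\Lambda$ of dimension $m$, $\mathcal{Q}^{\Lambda}_M(g)=\sum_{n=1}^M\omega_n g(z_n)$ is the midpoint rule with nodes $z_n$ the midpoints of $M\sim N^m$ cubes of edge length $1/N$ partitioning $\Lambda$ and appropriate weights $\omega_n\ge0$. It satisfies, for $g\in C^2$, $|\int_\Lambda g-\mathcal{Q}^\Lambda_M(g)|\le C_{(g)}M^{-2/m}$, with $C_{(g)}\lesssim\|g\|_{C^2(\Lambda)}$. Here the dimensions are $d$ for $D$, $d+1$ for $\Omega_i$, $d$ for $\Omega_{*i}$, and $M_{tb_i},M_{int_i},M_{sb_i}$ are the numbers of nodes on $D,\Omega_i,\Omega_{*i}$; these nodes form the training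 set $\mathcal{S}_i$. Training error. $\mathcal{E}_{T_0}=0$ and $\mathcal{E}_{T_i}(\theta_i,\mathcal{S}_i)^2=\widetilde{\mathcal{E}}_{T_i}^2+\mathcal{E}_{T_{i-1}}(\theta_{i-1},\mathcal{S}_{i-1})^2$ with $\widetilde{\mathcal{E}}_{T_i}^2=\mathcal{Q}^{\Omega_i}_{M_{int_i}}(R_{int1_i}^2)+\mathcal{Q}^{\Omega_i}_{M_{int_i}}(R_{int2_i}^2)+\mathcal{Q}^{\Omega_i}_{M_{int_i}}(|\nabla R_{int1_i}|^2)+\sum_{j=1}^i\big[\mathcal{Q}^D_{M_{tb_i}}(R_{tb1_i}^2(x,t_{j-1}))+\mathcal{Q}^D_{M_{tb_i}}(R_{tb2_i}^2(x,t_{j-1}))+\mathcal{Q}^D_{M_{tb_i}}(|\nabla R_{tb1_i}(x,t_{j-1})|^2)\big]+\big(\mathcal{Q}^{\Omega_{*i}}_{M_{sb_i}}(R_{sb1_i}^2)\big)^{1/2}+\big(\mathcal{Q}^{\Omega_{*i}}_{M_{sb_i}}(R_{sb2_i}^2)\big)^{1/2}$. $|\partial D|$ is the surface measure of $\partial D$; $\|w\|_{C(S)}$ is the sup norm and $\|w\|_{C^1(S)}$ the usual $C^1$ norm on $S$ (sum of sup norms of $w$ and its first-order partial derivatives). In the $\mathcal{O}$-statement the numbers of quadrature nodes are of the same order on all blocks $j\le i$, and the implied constant does not depend on these numbers (it may depend on $i$, $d$, $\Delta t$, the constants $C_{\partial D_{1j}},C_{\partial D_{2j}}$ and the constants $C_{(\cdot)}$).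 *)

theory Defs
  imports "HOL-Analysis.Analysis"
begin

text \<open>
  All derivatives are taken within the closed box \<open>S\<close>, hence are one-sided on its boundary.
  \<open>S\<close> always has nonempty interior, so the derivative within \<open>S\<close> is unique, and
  \<^term>\<open>frechet_derivative\<close> selects it.
\<close>

definition partial :: "'a::euclidean_space set \<Rightarrow> 'a \<Rightarrow> ('a \<Rightarrow> real) \<Rightarrow> 'a \<Rightarrow> real" where
  "partial S b g z = frechet_derivative g (at z within S) b"

primrec Ck_on :: "nat \<Rightarrow> 'a::euclidean_space set \<Rightarrow> ('a \<Rightarrow> real) \<Rightarrow> bool" where
  "Ck_on 0 S g \<longleftrightarrow> continuous_on S g"
| "Ck_on (Suc k) S g \<longleftrightarrow> g differentiable_on S \<and> (\<forall>b\<in>Basis. Ck_on k S (partial S b g))"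

definition sup_norm :: "'a set \<Rightarrow> ('a \<Rightarrow> real) \<Rightarrow> real" where
  "sup_norm A g = (SUP z\<in>A. \<bar>g z\<bar>)"

text \<open>
  The sum of the sup norms over \<open>A\<close> of the partial derivatives of order at most \<open>k\<close>. The
  derivatives are those of a function on \<open>S\<close>, of which \<open>A\<close> may be a boundary piece; on such a
  piece the norm thus includes the normal derivative.
\<close>

primrec Ck_norm :: "nat \<Rightarrow> 'a::euclidean_space set \<Rightarrow> 'a set \<Rightarrow> ('a \<Rightarrow> real) \<Rightarrow> real" where
  "Ck_norm 0 S A g = sup_norm A g"
| "Ck_norm (Suc k) S A g = sup_norm A g + (\<Sum>b\<in>Basis. Ck_norm k S A (partial S b g))"

text \<open>
  The torus \<open>[0,1)^d\<close> is represented by the closed unit cube; periodicity is imposed by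
  explicit conditions on opposite faces.
\<close>

definition cube :: "(real ^ 'd) set" where
  "cube = cbox 0 1"

definition grad_space :: "(real ^ 'd) set \<Rightarrow> (real ^ 'd \<Rightarrow> real) \<Rightarrow> real ^ 'd \<Rightarrow> real ^ 'd" where
  "grad_space S g x = (\<chi> k. partial S (axis k 1) g x)"

definition dtime :: "((real ^ 'd) \<times> real) set \<Rightarrow> ((real ^ 'd) \<times> real \<Rightarrow> real) \<Rightarrow> (real ^ 'd) \<times> real \<Rightarrow> real"
  where "dtime S g z = partial S (0, 1) g z"

text \<open>Gradient and Laplacian of a space-time function, with respect to the space variable only.\<close>

definition grad :: "((real ^ 'd) \<times> real) set \<Rightarrow> ((real ^ 'd) \<times> real \<Rightarrow> real) \<Rightarrow> (real ^ 'd) \<times> real \<Rightarrow> real ^ 'd"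
  where "grad S g z = (\<chi> k. partial S (axis k 1, 0) g z)"

definition laplacian :: "((real ^ 'd) \<times> real) set \<Rightarrow> ((real ^ 'd) \<times> real \<Rightarrow> real) \<Rightarrow> (real ^ 'd) \<times> real \<Rightarrow> real"
  where "laplacian S g z = (\<Sum>k\<in>UNIV. partial S (axis k 1, 0) (partial S (axis k 1, 0) g) z)"

text \<open>
  The face \<open>(k, s)\<close> of the cube is the set of points with \<open>k\<close>-th coordinate 0 (if \<open>s\<close> is false)
  or 1 (if \<open>s\<close> is true). A point on an edge lies on several faces and has a different opposite
  point for each of them. A function on the boundary such as \<open>v(x,t) - v(x+1,t)\<close> is therefore
  given by one function per face.
\<close>

type_synonym 'd face = "'d \<times> bool"

definition face_value :: "'d face \<Rightarrow> real" where
  "face_value F = (if snd F then 1 else 0)"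

definition face_set :: "'d face \<Rightarrow> (real ^ 'd) set" where
  "face_set F = {x \<in> cube. x $ fst F = face_value F}"

definition to_face :: "'d face \<Rightarrow> real ^ 'd \<Rightarrow> real ^ 'd" where
  "to_face F x = (\<chi> m. if m = fst F then face_value F else x $ m)"

definition opposite :: "'d face \<Rightarrow> real ^ 'd \<Rightarrow> real ^ 'd" where
  "opposite F x = (\<chi> m. if m = fst F then 1 - face_value F else x $ m)"

definition pull_face :: "('d face \<Rightarrow> (real ^ 'd) \<times> real \<Rightarrow> real) \<Rightarrow> 'd face \<Rightarrow> (real ^ 'd) \<times> real \<Rightarrow> real"
  where "pull_face g F z = g F (to_face F (fst z), snd z)"

text \<open>
  The integral over the boundary times a time interval \<open>I\<close>, with respect to surface measure. The
  pulled back integrand does not depend on the coordinate normal to the face, and integrating it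
  over that coordinate in \<open>[0,1]\<close> contributes a factor 1. (For \<open>d = 1\<close> surface measure is counting
  measure on the two end points.)
\<close>

definition boundary_integral :: "real set \<Rightarrow> ('d face \<Rightarrow> (real ^ 'd) \<times> real \<Rightarrow> real) \<Rightarrow> real" where
  "boundary_integral I g = (\<Sum>F\<in>UNIV. integral (cube \<times> I) (pull_face g F))"

text \<open>The surface measure of the boundary: \<open>2d\<close> faces of measure 1.\<close>

definition boundary_area :: "'d::finite itself \<Rightarrow> real" where
  "boundary_area _ = 2 * real CARD('d)"

text \<open>
  Vectors and matrices are functions on natural number indices starting from 0, of which only the
  entries below \<open>width\<close> matter. Layer 0 is the input, layer \<open>depth\<close> the output; \<open>skip m\<close> is the
  matrix \<open>M_m\<close> connecting hidden layer \<open>m\<close> to the output.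
\<close>

record hlconc =
  depth :: nat
  width :: "nat \<Rightarrow> nat"
  activation :: "nat \<Rightarrow> real \<Rightarrow> real"
  weight :: "nat \<Rightarrow> nat \<Rightarrow> nat \<Rightarrow> real"
  bias :: "nat \<Rightarrow> nat \<Rightarrow> real"
  skip :: "nat \<Rightarrow> nat \<Rightarrow> nat \<Rightarrow> real"

primrec hidden :: "hlconc \<Rightarrow> (nat \<Rightarrow> real) \<Rightarrow> nat \<Rightarrow> nat \<Rightarrow> real" where
  "hidden n z 0 = z"
| "hidden n z (Suc m) = (\<lambda>r. activation n (Suc m)
      ((\<Sum>c<width n m. weight n (Suc m) r c * hidden n z m c) + bias n (Suc m) r))"

definition hlconc_map :: "hlconc \<Rightarrow> (nat \<Rightarrow> real) \<Rightarrow> nat \<Rightarrow> real" where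
  "hlconc_map n z r =
     (\<Sum>m=1..depth n - 1. \<Sum>c<width n m. skip n m r c * hidden n z m c) + bias n (depth n) r"

definition smooth_real :: "(real \<Rightarrow> real) \<Rightarrow> bool" where
  "smooth_real s \<longleftrightarrow> (\<forall>k. ((deriv ^^ k) s) differentiable_on UNIV)"

definition hlconc_pinn :: "nat \<Rightarrow> nat \<Rightarrow> hlconc \<Rightarrow> bool" where
  "hlconc_pinn d_in d_out n \<longleftrightarrow>
     depth n \<ge> 3 \<and> width n 0 = d_in \<and> width n (depth n) = d_out \<and>
     (\<forall>m\<le>depth n. width n m \<ge> 1) \<and>
     activation n 1 = tanh \<and> activation n 2 = tanh \<and>
     (\<forall>m. 3 \<le> m \<and> m < depth n \<longrightarrow> smooth_real (activation n m))"

text \<open>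
  The input \<open>(x,t)\<close> as a vector of length \<open>d + 1\<close>. The coordinates of \<open>x\<close> are numbered by the
  library's enumeration of the finite index type.
\<close>

definition net_input :: "(real ^ 'd) \<times> real \<Rightarrow> nat \<Rightarrow> real" where
  "net_input z k = (if k < CARD('d) then fst z $ from_nat_into (UNIV :: 'd set) k else snd z)"

definition net_fun :: "hlconc \<Rightarrow> (real ^ 'd) \<times> real \<Rightarrow> real" where
  "net_fun n z = hlconc_map n (net_input z) 0"

text \<open>
  The parameters of block \<open>j\<close> are the pair \<open>(theta_u j, theta_v j)\<close>; the case of one network with
  two outputs is obtained by giving both networks the same hidden layers. Index 0 is not used.
  \<open>N_int j\<close>, \<open>N_tb j\<close>, \<open>N_sb j\<close> are the reciprocal edge lengths of the midpoint rules of block \<open>j\<close>.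
  \<open>const_D g\<close>, \<open>const_int j g\<close>, \<open>const_sb j g\<close> are the constants \<open>C_(g)\<close> in the quadrature error
  estimates on \<open>D\<close>, on the space-time block \<open>j\<close>, and on its lateral boundary.
\<close>

record ('d::finite) pinn_data =
  final_time :: real
  blocks :: nat
  source :: "(real ^ 'd) \<times> real \<Rightarrow> real"
  psi1 :: "real ^ 'd \<Rightarrow> real"
  psi2 :: "real ^ 'd \<Rightarrow> real"
  sol_u :: "(real ^ 'd) \<times> real \<Rightarrow> real"
  sol_v :: "(real ^ 'd) \<times> real \<Rightarrow> real"
  theta_u :: "nat \<Rightarrow> hlconc"
  theta_v :: "nat \<Rightarrow> hlconc"
  N_int :: "nat \<Rightarrow> nat"
  N_tb :: "nat \<Rightarrow> nat"
  N_sb :: "nat \<Rightarrow> nat"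
  const_D :: "(real ^ 'd \<Rightarrow> real) \<Rightarrow> real"
  const_int :: "nat \<Rightarrow> ((real ^ 'd) \<times> real \<Rightarrow> real) \<Rightarrow> real"
  const_sb :: "nat \<Rightarrow> ('d face \<Rightarrow> (real ^ 'd) \<times> real \<Rightarrow> real) \<Rightarrow> real"

definition time_step :: "('d::finite) pinn_data \<Rightarrow> real" where
  "time_step P = final_time P / real (blocks P)"

definition time :: "('d::finite) pinn_data \<Rightarrow> nat \<Rightarrow> real" where
  "time P j = real j * time_step P"

definition slab :: "('d::finite) pinn_data \<Rightarrow> nat \<Rightarrow> ((real ^ 'd) \<times> real) set" where
  "slab P j = cube \<times> {0..time P j}"

definition time_block :: "('d::finite) pinn_data \<Rightarrow> nat \<Rightarrow> ((real ^ 'd) \<times> real) set" where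
  "time_block P j = cube \<times> {time P (j - 1)..time P j}"

definition lateral_slab :: "('d::finite) pinn_data \<Rightarrow> nat \<Rightarrow> ((real ^ 'd) \<times> real) set" where
  "lateral_slab P j = frontier cube \<times> {0..time P j}"

definition u_net :: "('d::finite) pinn_data \<Rightarrow> nat \<Rightarrow> (real ^ 'd) \<times> real \<Rightarrow> real" where
  "u_net P j = net_fun (theta_u P j)"

definition v_net :: "('d::finite) pinn_data \<Rightarrow> nat \<Rightarrow> (real ^ 'd) \<times> real \<Rightarrow> real" where
  "v_net P j = net_fun (theta_v P j)"

definition classical_solution :: "('d::finite) pinn_data \<Rightarrow> bool" where
  "classical_solution P \<longleftrightarrow>
    (let S = cube \<times> {0..final_time P}; u = sol_u P; v = sol_v P in
      Ck_on 2 S u \<and> Ck_on 1 S v \<and>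
      (\<forall>z\<in>S. dtime S u z - v z = 0) \<and>
      (\<forall>z\<in>S. dtime S v z - laplacian S u z = source P z) \<and>
      (\<forall>x\<in>cube. u (x, 0) = psi1 P x \<and> v (x, 0) = psi2 P x) \<and>
      (\<forall>F. \<forall>x\<in>face_set F. \<forall>t\<in>{0..final_time P}.
         u (x, t) = u (opposite F x, t) \<and> grad S u (x, t) = grad S u (opposite F x, t)))"

definition R_int1 :: "('d::finite) pinn_data \<Rightarrow> nat \<Rightarrow> (real ^ 'd) \<times> real \<Rightarrow> real" where
  "R_int1 P i z = dtime (slab P i) (u_net P i) z - v_net P i z"

definition R_int2 :: "('d::finite) pinn_data \<Rightarrow> nat \<Rightarrow> (real ^ 'd) \<times> real \<Rightarrow> real" where
  "R_int2 P i z =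
     dtime (slab P i) (v_net P i) z - laplacian (slab P i) (u_net P i) z - source P z"

text \<open>The values at time \<open>t_j\<close> of the approximation on block \<open>j\<close>, or the initial data if \<open>j = 0\<close>.\<close>

definition u_start :: "('d::finite) pinn_data \<Rightarrow> nat \<Rightarrow> real ^ 'd \<Rightarrow> real" where
  "u_start P j x = (if j = 0 then psi1 P x else u_net P j (x, time P j))"

definition v_start :: "('d::finite) pinn_data \<Rightarrow> nat \<Rightarrow> real ^ 'd \<Rightarrow> real" where
  "v_start P j x = (if j = 0 then psi2 P x else v_net P j (x, time P j))"

text \<open>\<open>R_tb1 P i j\<close> and \<open>R_tb2 P i j\<close> are the residuals of block \<open>i\<close> at time \<open>t_(j-1)\<close>.\<close>

definition R_tb1 :: "('d::finite) pinn_data \<Rightarrow> nat \<Rightarrow> nat \<Rightarrow> real ^ 'd \<Rightarrow> real" where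
  "R_tb1 P i j x = u_net P i (x, time P (j - 1)) - u_start P (j - 1) x"

definition R_tb2 :: "('d::finite) pinn_data \<Rightarrow> nat \<Rightarrow> nat \<Rightarrow> real ^ 'd \<Rightarrow> real" where
  "R_tb2 P i j x = v_net P i (x, time P (j - 1)) - v_start P (j - 1) x"

definition R_sb1 :: "('d::finite) pinn_data \<Rightarrow> nat \<Rightarrow> 'd face \<Rightarrow> (real ^ 'd) \<times> real \<Rightarrow> real" where
  "R_sb1 P i F z = v_net P i z - v_net P i (opposite F (fst z), snd z)"

definition R_sb2 :: "('d::finite) pinn_data \<Rightarrow> nat \<Rightarrow> 'd face \<Rightarrow> (real ^ 'd) \<times> real \<Rightarrow> real ^ 'd" where
  "R_sb2 P i F z =
     grad (slab P i) (u_net P i) z - grad (slab P i) (u_net P i) (opposite F (fst z), snd z)"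

definition sq_int1 :: "('d::finite) pinn_data \<Rightarrow> nat \<Rightarrow> (real ^ 'd) \<times> real \<Rightarrow> real" where
  "sq_int1 P i z = (R_int1 P i z)\<^sup>2"

definition sq_int2 :: "('d::finite) pinn_data \<Rightarrow> nat \<Rightarrow> (real ^ 'd) \<times> real \<Rightarrow> real" where
  "sq_int2 P i z = (R_int2 P i z)\<^sup>2"

definition sq_grad_int1 :: "('d::finite) pinn_data \<Rightarrow> nat \<Rightarrow> (real ^ 'd) \<times> real \<Rightarrow> real" where
  "sq_grad_int1 P i z = (norm (grad (slab P i) (R_int1 P i) z))\<^sup>2"

definition sq_tb1 :: "('d::finite) pinn_data \<Rightarrow> nat \<Rightarrow> nat \<Rightarrow> real ^ 'd \<Rightarrow> real" where
  "sq_tb1 P i j x = (R_tb1 P i j x)\<^sup>2"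

definition sq_tb2 :: "('d::finite) pinn_data \<Rightarrow> nat \<Rightarrow> nat \<Rightarrow> real ^ 'd \<Rightarrow> real" where
  "sq_tb2 P i j x = (R_tb2 P i j x)\<^sup>2"

definition sq_grad_tb1 :: "('d::finite) pinn_data \<Rightarrow> nat \<Rightarrow> nat \<Rightarrow> real ^ 'd \<Rightarrow> real" where
  "sq_grad_tb1 P i j x = (norm (grad_space cube (R_tb1 P i j) x))\<^sup>2"

definition sq_sb1 :: "('d::finite) pinn_data \<Rightarrow> nat \<Rightarrow> 'd face \<Rightarrow> (real ^ 'd) \<times> real \<Rightarrow> real" where
  "sq_sb1 P i F z = (R_sb1 P i F z)\<^sup>2"

definition sq_sb2 :: "('d::finite) pinn_data \<Rightarrow> nat \<Rightarrow> 'd face \<Rightarrow> (real ^ 'd) \<times> real \<Rightarrow> real" where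
  "sq_sb2 P i F z = (norm (R_sb2 P i F z))\<^sup>2"

text \<open>
  The spatial edges of all cells have length \<open>1/N\<close>. A time interval of length \<open>h\<close> is split into
  the least number of equal cells of length at most \<open>1/N\<close>; this length is \<open>1/N\<close>, and the cells are
  cubes, whenever \<open>N * h\<close> is an integer. The cells of a rule all have the same measure, which is
  the weight of each node.
\<close>

definition time_cells :: "real \<Rightarrow> nat \<Rightarrow> nat" where
  "time_cells h N = nat \<lceil>real N * h\<rceil>"

definition space_nodes :: "nat \<Rightarrow> (real ^ 'd) set" where
  "space_nodes N = {x. \<forall>k. \<exists>n<N. x $ k = (real n + 1/2) / real N}"

definition time_nodes :: "real \<Rightarrow> real \<Rightarrow> nat \<Rightarrow> real set" where
  "time_nodes a h N =
     (\<lambda>n. a + (real n + 1/2) * h / real (time_cells h N)) ` {..<time_cells h N}"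

definition block_nodes :: "('d::finite) pinn_data \<Rightarrow> nat \<Rightarrow> nat \<Rightarrow> ((real ^ 'd) \<times> real) set" where
  "block_nodes P j N = space_nodes N \<times> time_nodes (time P (j - 1)) (time_step P) N"

definition lateral_nodes :: "('d::finite) pinn_data \<Rightarrow> nat \<Rightarrow> nat \<Rightarrow> ('d face \<times> ((real ^ 'd) \<times> real)) set"
  where "lateral_nodes P j N =
    (SIGMA F:UNIV. to_face F ` space_nodes N \<times> time_nodes (time P (j - 1)) (time_step P) N)"

text \<open>\<open>vol\<close> is the measure of the domain with nodes \<open>Z\<close>.\<close>

definition quadrature :: "real \<Rightarrow> 'a set \<Rightarrow> ('a \<Rightarrow> real) \<Rightarrow> real" where
  "quadrature vol Z g = (\<Sum>z\<in>Z. vol / real (card Z) * g z)"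

definition Q_D :: "nat \<Rightarrow> (real ^ 'd \<Rightarrow> real) \<Rightarrow> real" where
  "Q_D N g = quadrature 1 (space_nodes N) g"

definition Q_int :: "('d::finite) pinn_data \<Rightarrow> nat \<Rightarrow> nat \<Rightarrow> ((real ^ 'd) \<times> real \<Rightarrow> real) \<Rightarrow> real" where
  "Q_int P j N g = quadrature (time_step P) (block_nodes P j N) g"

definition Q_sb :: "('d::finite) pinn_data \<Rightarrow> nat \<Rightarrow> nat \<Rightarrow> ('d face \<Rightarrow> (real ^ 'd) \<times> real \<Rightarrow> real) \<Rightarrow> real"
  where "Q_sb P j N g =
    quadrature (boundary_area TYPE('d) * time_step P) (lateral_nodes P j N) (\<lambda>(F, z). g F z)"

definition quad_const_D :: "('d::finite) pinn_data \<Rightarrow> bool" where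
  "quad_const_D P \<longleftrightarrow>
    (\<forall>g N. Ck_on 2 (cube :: (real ^ 'd) set) g \<and> N \<ge> 1 \<longrightarrow>
       \<bar>integral cube g - Q_D N g\<bar>
         \<le> const_D P g * real (card (space_nodes N :: (real ^ 'd) set)) powr (- 2 / real CARD('d))) \<and>
    (\<exists>K. \<forall>g. Ck_on 2 cube g \<longrightarrow> const_D P g \<le> K * Ck_norm 2 cube cube g)"

definition quad_const_int :: "('d::finite) pinn_data \<Rightarrow> nat \<Rightarrow> bool" where
  "quad_const_int P j \<longleftrightarrow>
    (\<forall>g N. Ck_on 2 (time_block P j) g \<and> N \<ge> 1 \<longrightarrow>
       \<bar>integral (time_block P j) g - Q_int P j N g\<bar>
         \<le> const_int P j g * real (card (block_nodes P j N)) powr (- 2 / (real CARD('d) + 1))) \<and>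
    (\<exists>K. \<forall>g. Ck_on 2 (time_block P j) g \<longrightarrow>
       const_int P j g \<le> K * Ck_norm 2 (time_block P j) (time_block P j) g)"

text \<open>
  On the lateral boundary \<open>C^2\<close> means \<open>C^2\<close> on each closed face times the time interval, in the
  variables tangential to the face and in time.
\<close>

definition quad_const_sb :: "('d::finite) pinn_data \<Rightarrow> nat \<Rightarrow> bool" where
  "quad_const_sb P j \<longleftrightarrow>
    (\<forall>g N. (\<forall>F. Ck_on 2 (time_block P j) (pull_face g F)) \<and> N \<ge> 1 \<longrightarrow>
       \<bar>boundary_integral {time P (j - 1)..time P j} g - Q_sb P j N g\<bar>
         \<le> const_sb P j g * real (card (lateral_nodes P j N)) powr (- 2 / real CARD('d))) \<and>
    (\<exists>K. \<forall>g. (\<forall>F. Ck_on 2 (time_block P j) (pull_face g F)) \<longrightarrow>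
       const_sb P j g
         \<le> K * (\<Sum>F\<in>UNIV. Ck_norm 2 (time_block P j) (time_block P j) (pull_face g F)))"

definition M_int :: "('d::finite) pinn_data \<Rightarrow> nat \<Rightarrow> real" where
  "M_int P j = real (card (block_nodes P j (N_int P j)))"

definition M_tb :: "('d::finite) pinn_data \<Rightarrow> nat \<Rightarrow> real" where
  "M_tb P j = real (card (space_nodes (N_tb P j) :: (real ^ 'd) set))"

definition M_sb :: "('d::finite) pinn_data \<Rightarrow> nat \<Rightarrow> real" where
  "M_sb P j = real (card (lateral_nodes P j (N_sb P j)))"

definition block_train_error_sq :: "('d::finite) pinn_data \<Rightarrow> nat \<Rightarrow> real" where
  "block_train_error_sq P i =
     Q_int P i (N_int P i) (sq_int1 P i) + Q_int P i (N_int P i) (sq_int2 P i)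
     + Q_int P i (N_int P i) (sq_grad_int1 P i)
     + (\<Sum>j=1..i. Q_D (N_tb P i) (sq_tb1 P i j) + Q_D (N_tb P i) (sq_tb2 P i j)
                 + Q_D (N_tb P i) (sq_grad_tb1 P i j))
     + sqrt (Q_sb P i (N_sb P i) (sq_sb1 P i)) + sqrt (Q_sb P i (N_sb P i) (sq_sb2 P i))"

primrec train_error :: "('d::finite) pinn_data \<Rightarrow> nat \<Rightarrow> real" where
  "train_error P 0 = 0"
| "train_error P (Suc i) = sqrt (block_train_error_sq P (Suc i) + (train_error P i)\<^sup>2)"

definition C_bd1 :: "('d::finite) pinn_data \<Rightarrow> nat \<Rightarrow> real" where
  "C_bd1 P i = sqrt (boundary_area TYPE('d)) *
     (Ck_norm 1 (slab P i) (lateral_slab P i) (sol_u P)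
      + Ck_norm 1 (slab P i) (lateral_slab P i) (u_net P i))"

definition C_bd2 :: "('d::finite) pinn_data \<Rightarrow> nat \<Rightarrow> real" where
  "C_bd2 P i = sqrt (boundary_area TYPE('d)) *
     (sup_norm (lateral_slab P i) (sol_v P) + sup_norm (lateral_slab P i) (v_net P i))"

definition C_block :: "('d::finite) pinn_data \<Rightarrow> nat \<Rightarrow> real" where
  "C_block P i = (let d = real CARD('d);
        mi = M_int P i powr (- 2 / (d + 1));
        mt = M_tb P i powr (- 2 / d);
        ms = M_sb P i powr (- 2 / d) in
     2 * (\<Sum>j=1..i.
         const_D P (sq_tb1 P i j) * mt + Q_D (N_tb P i) (sq_tb1 P i j)
         + const_D P (sq_tb2 P i j) * mt + Q_D (N_tb P i) (sq_tb2 P i j))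
     + 2 * (\<Sum>j=1..i.
         const_D P (sq_grad_tb1 P i j) * mt + Q_D (N_tb P i) (sq_grad_tb1 P i j))
     + const_int P i (sq_int1 P i) * mi + Q_int P i (N_int P i) (sq_int1 P i)
     + const_int P i (sq_int2 P i) * mi + Q_int P i (N_int P i) (sq_int2 P i)
     + const_int P i (sq_grad_int1 P i) * mi + Q_int P i (N_int P i) (sq_grad_int1 P i)
     + 2 * sqrt \<bar>time_step P\<bar> *
        (C_bd1 P i * sqrt (const_sb P i (sq_sb1 P i) * ms + Q_sb P i (N_sb P i) (sq_sb1 P i))
         + C_bd2 P i * sqrt (const_sb P i (sq_sb2 P i) * ms + Q_sb P i (N_sb P i) (sq_sb2 P i))))"

primrec C_T :: "('d::finite) pinn_data \<Rightarrow> nat \<Rightarrow> real" where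
  "C_T P 0 = 0"
| "C_T P (Suc i) = C_block P (Suc i) + 2 * C_T P i * exp (2 * time_step P)"

definition err_u :: "('d::finite) pinn_data \<Rightarrow> nat \<Rightarrow> (real ^ 'd) \<times> real \<Rightarrow> real" where
  "err_u P i z = u_net P i z - sol_u P z"

definition err_v :: "('d::finite) pinn_data \<Rightarrow> nat \<Rightarrow> (real ^ 'd) \<times> real \<Rightarrow> real" where
  "err_v P i z = v_net P i z - sol_v P z"

definition total_error :: "('d::finite) pinn_data \<Rightarrow> nat \<Rightarrow> real" where
  "total_error P i =
     integral {time P (i - 1)..time P i} (\<lambda>t. integral cube (\<lambda>x.
       \<bar>err_u P i (x, t)\<bar>\<^sup>2 + (norm (grad (slab P i) (err_u P i) (x, t)))\<^sup>2 + \<bar>err_v P i (x, t)\<bar>\<^sup>2))"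

text \<open>The numbers of nodes on the blocks up to \<open>i\<close> agree up to the factor \<open>\<kappa>\<close>.\<close>

definition same_order :: "real \<Rightarrow> (nat \<Rightarrow> real) \<Rightarrow> nat \<Rightarrow> bool" where
  "same_order \<kappa> M i \<longleftrightarrow> (\<forall>j\<in>{1..i}. M j \<le> \<kappa> * M i \<and> M i \<le> \<kappa> * M j)"

text \<open>The constants on which the implied constant may depend are at most \<open>B\<close>.\<close>

definition constants_le :: "real \<Rightarrow> ('d::finite) pinn_data \<Rightarrow> nat \<Rightarrow> bool" where
  "constants_le B P i \<longleftrightarrow> (\<forall>j\<in>{1..i}.
     C_bd1 P j \<le> B \<and> C_bd2 P j \<le> B \<and>
     const_int P j (sq_int1 P j) \<le> B \<and> const_int P j (sq_int2 P j) \<le> B \<and>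
     const_int P j (sq_grad_int1 P j) \<le> B \<and>
     const_sb P j (sq_sb1 P j) \<le> B \<and> const_sb P j (sq_sb2 P j) \<le> B \<and>
     (\<forall>k\<in>{1..j}. const_D P (sq_tb1 P j k) \<le> B \<and> const_D P (sq_tb2 P j k) \<le> B \<and>
        const_D P (sq_grad_tb1 P j k) \<le> B))"

end

theory Submission
  imports Defs
begin

text \<open>
  The proof is an energy estimate. On block \<open>j\<close> the errors \<open>w = u_net - u\<close> and \<open>q = v_net - v\<close> solve the wave
  system \<open>dtime w = q + R_int1\<close>, \<open>dtime q = laplacian w + R_int2\<close>. The energy \<open>E t\<close>, the integral over the
  cube of \<open>w\<^sup>2 + |grad w|\<^sup>2 + q\<^sup>2\<close>, therefore satisfies
  \<open>E' \<le> 2 E + \<integral> (R_int1\<^sup>2 + R_int2\<^sup>2 + |grad R_int1|\<^sup>2) + 2 \<integral> div (q grad w)\<close>. The divergence theorem turns the last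
  integral into the jumps of \<open>q grad w\<close> between opposite faces. By periodicity of the solution these
  are products of boundary residuals with values of the errors, which sup norms bound; the
  Cauchy-Schwarz inequality over the lateral boundary then gives the square roots in the bound
  (\<open>flux_integral_bound\<close>). Gronwall's inequality bounds \<open>E\<close> on the block by an exponential times the sum
  of these integrals and of the value of \<open>E\<close> at the start of the block (\<open>energy_estimate\<close>). That value is at most twice the squared initial residuals plus twice the
  final energy of the preceding block (\<open>err_energy_start\<close>), which is the recursion defining \<open>C_T\<close>.

  Quadrature replaces each integral of a squared residual, provided that the integrand is twice
  continuously differentiable. Networks are smooth because the class of \<open>C\<^sup>k\<close> functions is closed under the
  operations that build them (\<open>Ck_on_net_fun\<close>), and the source inherits its regularity from the solution.

  For the order of the bound, \<open>C_block j\<close> is at most a constant times the sum of the squared training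
  error and the three powers of the numbers of nodes (\<open>C_block_upper\<close>); the recursion for \<open>C_T\<close> then gives a
  geometric sum.

  The analysis takes place on closed boxes with one-sided derivatives at the boundary. This includes the
  symmetry of the second derivatives (\<open>partial_commute\<close>), which is needed for the time derivative
  of the gradient of \<open>w\<close>.
\<close>

section \<open>Functions of class \<open>C\<^sup>k\<close> on a closed set\<close>

text \<open>A set within which the derivative of a real function is determined at each point.\<close>

definition unique_derivatives :: "'a::euclidean_space set \<Rightarrow> bool" where
  "unique_derivatives S \<longleftrightarrow> (\<forall>z\<in>S. \<forall>(g :: 'a \<Rightarrow> real) D D'.
     (g has_derivative D) (at z within S) \<longrightarrow> (g has_derivative D') (at z within S) \<longrightarrow> D = D')"

lemma unique_derivatives_cbox:
  assumes "\<And>b. b \<in> Basis \<Longrightarrow> l \<bullet> b < r \<bullet> b"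
  shows "unique_derivatives (cbox l r)"
  unfolding unique_derivatives_def
  using frechet_derivative_unique_within_closed_interval[OF assms] by blast

lemma partial_eqI:
  assumes "unique_derivatives S" "z \<in> S" "(g has_derivative D) (at z within S)"
  shows "partial S b g z = D b"
proof -
  have "(g has_derivative frechet_derivative g (at z within S)) (at z within S)"
    using assms(3) by (auto simp: frechet_derivative_works[symmetric] differentiable_def)
  then have "frechet_derivative g (at z within S) = D"
    using assms unfolding unique_derivatives_def by blast
  then show ?thesis by (simp add: partial_def)
qed

lemma partial_cong:
  assumes "\<And>z. z \<in> S \<Longrightarrow> f z = g z" "z \<in> S"
  shows "partial S b f z = partial S b g z"
proof -
  have "(f has_derivative D) (at z within S) \<longleftrightarrow> (g has_derivative D) (at z within S)" for D
    using assms by (metis has_derivative_transform)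
  then show ?thesis by (simp add: partial_def frechet_derivative_def)
qed

lemma Ck_on_cong:
  assumes "\<And>z. z \<in> S \<Longrightarrow> f z = g z"
  shows "Ck_on k S f \<longleftrightarrow> Ck_on k S g"
  using assms
proof (induction k arbitrary: f g)
  case 0
  then show ?case by (simp cong: continuous_on_cong)
next
  case (Suc k)
  have "Ck_on k S (partial S b f) \<longleftrightarrow> Ck_on k S (partial S b g)" for b
    by (intro Suc.IH partial_cong Suc.prems)
  moreover have "f differentiable_on S \<longleftrightarrow> g differentiable_on S"
    unfolding differentiable_on_def differentiable_def
    using Suc.prems by (metis has_derivative_transform)
  ultimately show ?case by simp
qed

lemma Ck_on_imp_continuous: "Ck_on k S g \<Longrightarrow> continuous_on S g"
  by (cases k) (auto intro: differentiable_imp_continuous_on)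

lemma Ck_on_pred: "Ck_on (Suc k) S g \<Longrightarrow> Ck_on k S g"
  by (induction k arbitrary: g) (auto intro: differentiable_imp_continuous_on)

lemma Ck_on_mono: "Ck_on m S g \<Longrightarrow> k \<le> m \<Longrightarrow> Ck_on k S g"
  by (induction m) (auto simp: le_Suc_eq simp del: Ck_on.simps intro: Ck_on_pred)

lemma Ck_on_partial: "Ck_on (Suc k) S g \<Longrightarrow> b \<in> Basis \<Longrightarrow> Ck_on k S (partial S b g)"
  by simp

lemma Ck_on_SucI:
  assumes "unique_derivatives S" "\<And>z. z \<in> S \<Longrightarrow> (g has_derivative D z) (at z within S)"
    and "\<And>b. b \<in> Basis \<Longrightarrow> Ck_on k S (\<lambda>z. D z b)"
  shows "Ck_on (Suc k) S g"
proof -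
  have "Ck_on k S (partial S b g)" if "b \<in> Basis" for b
    using assms(3)[OF that] partial_eqI[OF assms(1) _ assms(2)]
    by (subst Ck_on_cong[where g = "\<lambda>z. D z b"]) auto
  then show ?thesis
    using assms(2) by (auto simp: differentiable_on_def differentiable_def)
qed

lemma Ck_on_has_derivative:
  assumes "Ck_on k S g" "0 < k" "z \<in> S"
  shows "(g has_derivative (\<lambda>h. partial S h g z)) (at z within S)"
  using assms by (cases k) (auto simp: differentiable_on_def partial_def[abs_def] frechet_derivative_works)

lemma partial_expand:
  assumes "Ck_on k S g" "0 < k" "z \<in> S"
  shows "partial S h g z = (\<Sum>b\<in>Basis. (h \<bullet> b) * partial S b g z)"
proof -
  interpret bounded_linear "\<lambda>h. partial S h g z"
    using Ck_on_has_derivative[OF assms] by (rule has_derivative_bounded_linear)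
  have "partial S h g z = partial S (\<Sum>b\<in>Basis. (h \<bullet> b) *\<^sub>R b) g z"
    by (simp add: euclidean_representation)
  then show ?thesis by (simp add: sum scaleR)
qed

lemma Ck_on_const: "unique_derivatives S \<Longrightarrow> Ck_on k S (\<lambda>z. c)"
proof (induction k arbitrary: c)
  case (Suc k)
  then show ?case by (intro Ck_on_SucI[where D = "\<lambda>z h. 0"]) auto
qed simp

lemma Ck_on_add:
  assumes "unique_derivatives S" "Ck_on k S f" "Ck_on k S g"
  shows "Ck_on k S (\<lambda>z. f z + g z)"
  using assms(2,3)
proof (induction k arbitrary: f g)
  case (Suc k)
  show ?case
    by (rule Ck_on_SucI[OF assms(1) has_derivative_add
          [OF Ck_on_has_derivative[OF Suc.prems(1)] Ck_on_has_derivative[OF Suc.prems(2)]]])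
      (use Suc in auto)
qed (auto intro: continuous_intros)

lemma Ck_on_mult:
  assumes "unique_derivatives S" "Ck_on k S f" "Ck_on k S g"
  shows "Ck_on k S (\<lambda>z. f z * g z)"
  using assms(2,3)
proof (induction k arbitrary: f g)
  case (Suc k)
  have "Ck_on k S f" "Ck_on k S g" using Suc.prems by (auto intro: Ck_on_pred simp del: Ck_on.simps)
  then show ?case
    by (intro Ck_on_SucI[OF assms(1) has_derivative_mult
          [OF Ck_on_has_derivative[OF Suc.prems(1)] Ck_on_has_derivative[OF Suc.prems(2)]]]
          Ck_on_add[OF assms(1)] Suc.IH)
      (use Suc.prems in auto)
qed (auto intro: continuous_intros)

lemma Ck_on_diff:
  assumes "unique_derivatives S" "Ck_on k S f" "Ck_on k S g"
  shows "Ck_on k S (\<lambda>z. f z - g z)"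
  using Ck_on_add[OF assms(1,2) Ck_on_mult[OF assms(1) Ck_on_const[OF assms(1), of _ "-1"] assms(3)]]
  by simp

lemma Ck_on_power2:
  assumes "unique_derivatives S" "Ck_on k S f"
  shows "Ck_on k S (\<lambda>z. (f z)\<^sup>2)"
  unfolding power2_eq_square by (intro Ck_on_mult assms)

lemma Ck_on_sum:
  assumes "unique_derivatives S" "\<And>a. a \<in> A \<Longrightarrow> Ck_on k S (f a)"
  shows "Ck_on k S (\<lambda>z. \<Sum>a\<in>A. f a z)"
  using assms(2) by (induction A rule: infinite_finite_induct) (auto intro: Ck_on_const Ck_on_add assms(1))

lemma Ck_on_bounded_linear:
  assumes "unique_derivatives S" "bounded_linear f"
  shows "Ck_on k S f"
proof (cases k)
  case 0
  then show ?thesis using assms(2) by (simp add: linear_continuous_on)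
next
  case (Suc m)
  have "Ck_on (Suc m) S f"
    by (rule Ck_on_SucI[where D = "\<lambda>z. f"])
      (auto intro: assms Ck_on_const bounded_linear_imp_has_derivative)
  then show ?thesis using Suc by simp
qed

lemma partial_diff:
  assumes "unique_derivatives S" "Ck_on k S f" "Ck_on k S g" "0 < k" "z \<in> S"
  shows "partial S b (\<lambda>z. f z - g z) z = partial S b f z - partial S b g z"
  by (rule partial_eqI[OF assms(1,5)])
    (intro has_derivative_diff Ck_on_has_derivative[OF _ assms(4,5)] assms(2,3))

lemma partial_mult:
  assumes "unique_derivatives S" "Ck_on k S f" "Ck_on k S g" "0 < k" "z \<in> S"
  shows "partial S b (\<lambda>z. f z * g z) z = f z * partial S b g z + partial S b f z * g z"
  by (rule partial_eqI[OF assms(1,5)])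
    (intro has_derivative_mult Ck_on_has_derivative[OF _ assms(4,5)] assms(2,3))

text \<open>
  Composition with an affine map. It covers the restriction to a smaller set, to a time slice and
  to a face.
\<close>

lemma has_derivative_affine_compose:
  fixes A :: "'a::euclidean_space \<Rightarrow> 'b::euclidean_space"
  assumes "Ck_on k S g" "0 < k" "bounded_linear A" "\<And>z. z \<in> T \<Longrightarrow> A z + c \<in> S" "z \<in> T"
  shows "((\<lambda>z. g (A z + c)) has_derivative (\<lambda>h. partial S (A h) g (A z + c))) (at z within T)"
proof (rule has_derivative_in_compose2[where t = S and g' = "\<lambda>y h. partial S h g y"])
  show "((\<lambda>z. A z + c) has_derivative A) (at z within T)"
    using has_derivative_add[OF bounded_linear_imp_has_derivative[OF assms(3)] has_derivative_const]
    by simp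
qed (use assms Ck_on_has_derivative[OF assms(1,2)] in auto)

lemma Ck_on_affine_compose:
  fixes A :: "'a::euclidean_space \<Rightarrow> 'b::euclidean_space"
  assumes "unique_derivatives T" "bounded_linear A" "\<And>z. z \<in> T \<Longrightarrow> A z + c \<in> S" "Ck_on k S g"
  shows "Ck_on k T (\<lambda>z. g (A z + c))"
  using assms(4)
proof (induction k arbitrary: g)
  case 0
  then show ?case
    using assms(3)
    by (auto intro!: continuous_on_compose2[of S g] continuous_on_add linear_continuous_on[OF assms(2)])
next
  case (Suc k)
  have "Ck_on k T (\<lambda>z. partial S (A b) g (A z + c))" for b
  proof -
    have "Ck_on k T (\<lambda>z. \<Sum>e\<in>Basis. (A b \<bullet> e) * partial S e g (A z + c))"
      by (intro Ck_on_sum Ck_on_mult Ck_on_const Suc.IH[OF Ck_on_partial[OF Suc.prems]] assms(1))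
    then show ?thesis
      using partial_expand[OF Suc.prems] assms(3) by (subst Ck_on_cong) auto
  qed
  then show ?case
    by (intro Ck_on_SucI[OF assms(1), where D = "\<lambda>z h. partial S (A h) g (A z + c)"]
        has_derivative_affine_compose[OF Suc.prems _ assms(2,3)]) auto
qed

lemma partial_affine_compose:
  fixes A :: "'a::euclidean_space \<Rightarrow> 'b::euclidean_space"
  assumes "unique_derivatives T" "bounded_linear A" "\<And>z. z \<in> T \<Longrightarrow> A z + c \<in> S"
    and "Ck_on k S g" "0 < k" "z \<in> T"
  shows "partial T b (\<lambda>z. g (A z + c)) z = partial S (A b) g (A z + c)"
  by (rule partial_eqI[OF assms(1,6) has_derivative_affine_compose[OF assms(4,5,2,3,6)]]) 

lemma Ck_on_subset:
  assumes "unique_derivatives T" "T \<subseteq> S" "Ck_on k S g"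
  shows "Ck_on k T g"
  using Ck_on_affine_compose[OF assms(1) bounded_linear_ident, of 0 S k g] assms(2,3) by auto

lemma partial_subset:
  assumes "unique_derivatives T" "T \<subseteq> S" "Ck_on k S g" "0 < k" "z \<in> T"
  shows "partial T b g z = partial S b g z"
  using partial_affine_compose[OF assms(1) bounded_linear_ident, of 0 S k g] assms(2-) by auto

section \<open>Smoothness of the networks\<close>

lemma Ck_on_tanh:
  assumes "unique_derivatives S" "Ck_on k S g"
  shows "Ck_on k S (\<lambda>z. tanh (g z))"
  using assms(2)
proof (induction k)
  case 0
  then show ?case by (auto intro!: continuous_intros simp: cosh_real_nonzero)
next
  case (Suc k)
  have *: "((\<lambda>z. tanh (g z)) has_derivative (\<lambda>h. (1 - (tanh (g z))\<^sup>2) * partial S h g z)) (at z within S)"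
    if "z \<in> S" for z
  proof -
    have "(tanh has_real_derivative 1 - (tanh (g z))\<^sup>2) (at (g z))"
      by (auto intro!: derivative_eq_intros simp: cosh_real_nonzero)
    then show ?thesis
      unfolding has_field_derivative_def
      using has_derivative_compose[OF Ck_on_has_derivative[OF Suc.prems _ that], of tanh] by simp
  qed
  have "Ck_on k S g" using Suc.prems by (rule Ck_on_pred)
  with Suc show ?case
    by (intro Ck_on_SucI[OF assms(1) *] Ck_on_mult Ck_on_diff Ck_on_const Ck_on_power2 assms(1)) auto
qed

lemma Ck_on_smooth_real_compose:
  assumes "unique_derivatives S" "smooth_real \<sigma>" "Ck_on k S g"
  shows "Ck_on k S (\<lambda>z. \<sigma> (g z))"
proof -
  have D: "((deriv ^^ j) \<sigma> has_real_derivative (deriv ^^ Suc j) \<sigma> y) (at y)" for j y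
    using assms(2) by (auto simp: smooth_real_def differentiable_on_def
        intro!: DERIV_deriv_iff_real_differentiable[THEN iffD2])
  \<comment> \<open>for all derivatives of \<open>\<sigma>\<close> at once, since the chain rule raises the order\<close>
  have "Ck_on k S (\<lambda>z. (deriv ^^ j) \<sigma> (g z))" for j
    using assms(3)
  proof (induction k arbitrary: j)
    case 0
    have "continuous_on UNIV ((deriv ^^ j) \<sigma>)"
      using assms(2) by (auto simp: smooth_real_def intro: differentiable_imp_continuous_on)
    with 0 show ?case by (auto intro: continuous_on_compose2)
  next
    case (Suc k)
    have *: "((\<lambda>z. (deriv ^^ j) \<sigma> (g z)) has_derivative
        (\<lambda>h. (deriv ^^ Suc j) \<sigma> (g z) * partial S h g z)) (at z within S)" if "z \<in> S" for z
      using has_derivative_compose[OF Ck_on_has_derivative[OF Suc.prems _ that] D[unfolded has_field_derivative_def, of j]]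
      by (simp add: mult.commute)
    have "Ck_on k S g" using Suc.prems by (rule Ck_on_pred)
    then show ?case
      by (intro Ck_on_SucI[OF assms(1) *] Ck_on_mult Suc.IH assms(1)) (use Suc.prems in auto)
  qed
  from this[of 0] show ?thesis by simp
qed

lemma Ck_on_net_fun:
  fixes S :: "((real ^ 'd) \<times> real) set"
  assumes "unique_derivatives S" "hlconc_pinn d_in d_out n"
  shows "Ck_on k S (net_fun n :: (real ^ 'd) \<times> real \<Rightarrow> real)"
proof -
  have input: "Ck_on k S (\<lambda>z. net_input z c)" for c
  proof (cases "c < CARD('d)")
    case True
    then have "(\<lambda>z. net_input z c) = (\<lambda>z :: (real ^ 'd) \<times> real. fst z $ from_nat_into UNIV c)"
      by (auto simp: net_input_def)
    then show ?thesis
      by (auto intro!: Ck_on_bounded_linear[OF assms(1)] bounded_linear_vec_nth[THEN bounded_linear_compose] bounded_linear_fst)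
  next
    case False
    then have "(\<lambda>z. net_input z c) = (\<lambda>z :: (real ^ 'd) \<times> real. snd z)"
      by (auto simp: net_input_def)
    then show ?thesis by (auto intro!: Ck_on_bounded_linear[OF assms(1)] bounded_linear_snd)
  qed
  \<comment> \<open>layers 1 and 2 have activation \<open>tanh\<close>, the later hidden layers a smooth one\<close>
  have act: "Ck_on k S (\<lambda>z. activation n m (g z))" if "1 \<le> m" "m < depth n" "Ck_on k S g" for m g
  proof -
    consider "m = 1" | "m = 2" | "3 \<le> m" using \<open>1 \<le> m\<close> by linarith
    then show ?thesis
      by cases (use assms(2) that in \<open>auto simp: hlconc_pinn_def
          intro: Ck_on_tanh[OF assms(1)] Ck_on_smooth_real_compose[OF assms(1)]\<close>)
  qed
  have hidden: "Ck_on k S (\<lambda>z. hidden n (net_input z) m r)" if "m < depth n" for m r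
    using that
  proof (induction m arbitrary: r)
    case 0
    then show ?case by (simp add: input)
  next
    case (Suc m)
    then show ?case
      unfolding hidden.simps
      by (intro act Ck_on_add[OF assms(1)] Ck_on_sum[OF assms(1)] Ck_on_mult[OF assms(1)]
          Ck_on_const[OF assms(1)]) auto
  qed
  have "depth n \<ge> 3" using assms(2) by (simp add: hlconc_pinn_def)
  then have "Ck_on k S (\<lambda>z. hlconc_map n (net_input z) 0)"
    unfolding hlconc_map_def
    by (intro Ck_on_add[OF assms(1)] Ck_on_sum[OF assms(1)] Ck_on_mult[OF assms(1)]
        Ck_on_const[OF assms(1)] hidden) auto
  then show ?thesis by (simp add: net_fun_def[abs_def])
qed

section \<open>Calculus on boxes\<close>

lemma has_real_derivative_along:
  assumes "Ck_on k S g" "0 < k" "\<And>s. s \<in> I \<Longrightarrow> s *\<^sub>R b + c \<in> S" "s \<in> I"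
  shows "((\<lambda>s. g (s *\<^sub>R b + c)) has_real_derivative partial S b g (s *\<^sub>R b + c)) (at s within I)"
proof -
  interpret bounded_linear "\<lambda>h. partial S h g (s *\<^sub>R b + c)"
    using Ck_on_has_derivative[OF assms(1,2) assms(3)[OF assms(4)]] by (rule has_derivative_bounded_linear)
  show ?thesis
    using has_derivative_affine_compose[OF assms(1,2) bounded_linear_scaleR_left assms(3,4)]
    by (simp add: has_field_derivative_def scaleR mult_commute_abs)
qed

text \<open>
  Gronwall's inequality in integral form: the right-hand side of the bound, times \<open>exp (- c t)\<close>, is
  nonincreasing.
\<close>

lemma gronwall:
  fixes E :: "real \<Rightarrow> real"
  assumes cont: "continuous_on {a..b} E" and "0 \<le> c"
    and bound: "\<And>t. t \<in> {a..b} \<Longrightarrow> E t \<le> A + c * integral {a..t} E" and t: "t \<in> {a..b}"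
  shows "E t \<le> A * exp (c * (t - a))"
proof -
  define Y where "Y s = A + c * integral {a..s} E" for s
  define F where "F s = Y s * exp (- c * s)" for s
  have Y: "(Y has_real_derivative c * E s) (at s within {a..b})" if "s \<in> {a..b}" for s
    unfolding Y_def using integral_has_real_derivative[OF cont that]
    by (auto intro!: derivative_eq_intros)
  have F: "(F has_real_derivative c * (E s - Y s) * exp (- c * s)) (at s within {a..b})"
    if "s \<in> {a..b}" for s
    unfolding F_def using Y[OF that] by (auto intro!: derivative_eq_intros simp: algebra_simps)
  have "F t \<le> F a"
  proof (rule DERIV_nonpos_imp_decreasing_open[where f = F])
    show "a \<le> t" using t by simp
    show "continuous_on {a..t} F"
      by (rule DERIV_continuous_on[OF DERIV_subset[OF F]]) (use t in auto)
    fix s assume s: "a < s" "s < t"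
    have "(F has_real_derivative c * (E s - Y s) * exp (- c * s)) (at s)"
      using F[of s] s t by (simp add: at_within_Icc_at)
    moreover have "c * (E s - Y s) * exp (- c * s) \<le> 0"
      using bound[of s] s t \<open>0 \<le> c\<close> by (auto simp: Y_def mult_le_0_iff)
    ultimately show "\<exists>y. (F has_real_derivative y) (at s) \<and> y \<le> 0" by blast
  qed
  then have "Y t * exp (- c * t) \<le> A * exp (- c * a)" by (simp add: F_def Y_def)
  then have "Y t * exp (- c * t) * exp (c * t) \<le> A * exp (- c * a) * exp (c * t)"
    by (rule mult_right_mono) simp
  then have "Y t \<le> A * exp (c * (t - a))"
    by (simp add: mult.assoc algebra_simps flip: exp_add)
  with bound[OF t] show ?thesis by (simp add: Y_def)
qed

text \<open>
  Equality of mixed derivatives, up to the boundary of the rectangle: differentiate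
  \<open>\<phi> s t = \<phi> a t + \<integral>\<^sub>a\<^sup>s \<phi>s \<sigma> t d\<sigma>\<close> with respect to \<open>t\<close> under the integral, then with respect to \<open>s\<close>.
\<close>

lemma mixed_derivatives_eq:
  fixes \<phi> \<phi>s \<phi>t \<phi>st :: "real \<Rightarrow> real \<Rightarrow> real"
  assumes "a < b" "c < d"
    and ds: "\<And>s t. s \<in> {a..b} \<Longrightarrow> t \<in> {c..d} \<Longrightarrow>
      ((\<lambda>s. \<phi> s t) has_real_derivative \<phi>s s t) (at s within {a..b})"
    and dt: "\<And>s t. s \<in> {a..b} \<Longrightarrow> t \<in> {c..d} \<Longrightarrow>
      ((\<lambda>t. \<phi> s t) has_real_derivative \<phi>t s t) (at t within {c..d})"
    and dst: "\<And>s t. s \<in> {a..b} \<Longrightarrow> t \<in> {c..d} \<Longrightarrow>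
      ((\<lambda>t. \<phi>s s t) has_real_derivative \<phi>st s t) (at t within {c..d})"
    and cont_s: "\<And>t. t \<in> {c..d} \<Longrightarrow> continuous_on {a..b} (\<lambda>s. \<phi>s s t)"
    and cont: "continuous_on ({c..d} \<times> {a..b}) (\<lambda>(t, s). \<phi>st s t)"
    and s: "s \<in> {a..b}" and t: "t \<in> {c..d}"
    and D: "((\<lambda>s. \<phi>t s t) has_real_derivative D) (at s within {a..b})"
  shows "D = \<phi>st s t"
proof -
  have unique: "x = y"
    if "(f has_real_derivative x) (at u within {l..r})" "(f has_real_derivative y) (at u within {l..r})"
      "u \<in> {l..r}" "l < r" for f x y u and l r :: real
    using vector_derivative_unique_within_closed_interval[of l r u f x y] that
    by (simp add: has_real_derivative_iff_has_vector_derivative)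
  have step: "\<phi>t q t = \<phi>t a t + integral {a..q} (\<lambda>p. \<phi>st p t)" if q: "q \<in> {a..b}" for q
  proof -
    have aq: "{a..q} \<subseteq> {a..b}" "a \<in> {a..b}" using q by auto
    have ftc: "\<phi> q r - \<phi> a r = integral {a..q} (\<lambda>p. \<phi>s p r)" if "r \<in> {c..d}" for r
      using fundamental_theorem_of_calculus[of a q "\<lambda>s. \<phi> s r" "\<lambda>s. \<phi>s s r"] q aq ds[OF _ that]
      by (force simp: has_real_derivative_iff_has_vector_derivative[symmetric]
          intro: DERIV_subset integral_unique[symmetric])
    have "((\<lambda>r. integral (cbox a q) (\<lambda>p. \<phi>s p r)) has_real_derivative
        integral (cbox a q) (\<lambda>p. \<phi>st p t)) (at t within {c..d})"
    proof (rule leibniz_rule_field_derivative)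
      show "(\<lambda>p. \<phi>s p r) integrable_on cbox a q" if "r \<in> {c..d}" for r
        using continuous_on_subset[OF cont_s[OF that] aq(1)] by (simp add: integrable_continuous_real)
      show "continuous_on ({c..d} \<times> cbox a q) (\<lambda>(r, p). \<phi>st p r)"
        using aq by (auto intro: continuous_on_subset[OF cont])
    qed (use dst aq t in auto)
    then have "((\<lambda>r. \<phi> q r - \<phi> a r) has_real_derivative integral {a..q} (\<lambda>p. \<phi>st p t)) (at t within {c..d})"
      unfolding box_real(2)
      by (rule has_field_derivative_transform_within[where d = 1]) (use ftc t in auto)
    moreover have "((\<lambda>r. \<phi> q r - \<phi> a r) has_real_derivative \<phi>t q t - \<phi>t a t) (at t within {c..d})"
      by (intro DERIV_diff dt q aq t)
    ultimately show ?thesis using unique[OF _ _ t \<open>c < d\<close>] by fastforce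
  qed
  have cont_t: "continuous_on {a..b} (\<lambda>p. \<phi>st p t)"
    using continuous_on_compose2[OF cont, of "{a..b}" "\<lambda>p. (t, p)"] t
    by (force intro!: continuous_intros)
  have "((\<lambda>q. \<phi>t a t + integral {a..q} (\<lambda>p. \<phi>st p t)) has_real_derivative \<phi>st s t) (at s within {a..b})"
    using DERIV_add[OF DERIV_const integral_has_real_derivative[OF cont_t s]] by simp
  then have "((\<lambda>s. \<phi>t s t) has_real_derivative \<phi>st s t) (at s within {a..b})"
    by (rule has_field_derivative_transform_within[where d = 1])
      (use s in \<open>simp_all only: step[symmetric] zero_less_one\<close>)
  then show ?thesis using unique[OF D _ s \<open>a < b\<close>] by blast
qed

lemma partial_commute:
  fixes l r :: "'a::euclidean_space"
  assumes lr: "\<And>b. b \<in> Basis \<Longrightarrow> l \<bullet> b < r \<bullet> b"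
    and g: "Ck_on 2 (cbox l r) g" and b: "b \<in> Basis" and e: "e \<in> Basis" and z: "z \<in> cbox l r"
  shows "partial (cbox l r) b (partial (cbox l r) e g) z = partial (cbox l r) e (partial (cbox l r) b g) z"
proof (cases "b = e")
  case False
  let ?S = "cbox l r"
  define p where "p = z + (l \<bullet> b - z \<bullet> b) *\<^sub>R b + (l \<bullet> e - z \<bullet> e) *\<^sub>R e"
  define h where "h s t = p + s *\<^sub>R b + t *\<^sub>R e" for s t
  let ?I = "{0..r \<bullet> b - l \<bullet> b}" and ?J = "{0..r \<bullet> e - l \<bullet> e}"
  have h_eq: "s *\<^sub>R b + (p + t *\<^sub>R e) = h s t" "t *\<^sub>R e + (p + s *\<^sub>R b) = h s t" for s t
    by (simp_all add: h_def ac_simps)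
  have h_in: "h s t \<in> ?S" if "s \<in> ?I" "t \<in> ?J" for s t
    unfolding mem_box
  proof (intro ballI)
    fix c :: 'a assume "c \<in> Basis"
    then show "l \<bullet> c \<le> h s t \<bullet> c \<and> h s t \<bullet> c \<le> r \<bullet> c"
      using that z b e False
      by (cases "c = b"; cases "c = e") (auto simp: h_def p_def inner_simps inner_Basis mem_box)
  qed
  have g1: "Ck_on 1 ?S g" "Ck_on 1 ?S (partial ?S b g)" "Ck_on 1 ?S (partial ?S e g)"
    using g b e Ck_on_mono[OF g, of 1] by (auto simp: numeral_2_eq_2)
  have s_dir: "((\<lambda>s. f (h s t)) has_real_derivative partial ?S b f (h s t)) (at s within ?I)"
    if "Ck_on 1 ?S f" "s \<in> ?I" "t \<in> ?J" for f s t
    using has_real_derivative_along[OF that(1), of ?I b "p + t *\<^sub>R e" s] h_in that(2,3)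
    by (simp add: h_eq)
  have t_dir: "((\<lambda>t. f (h s t)) has_real_derivative partial ?S e f (h s t)) (at t within ?J)"
    if "Ck_on 1 ?S f" "s \<in> ?I" "t \<in> ?J" for f s t
    using has_real_derivative_along[OF that(1), of ?J e "p + s *\<^sub>R b" t] h_in that(2,3)
    by (simp add: h_eq)
  have s: "z \<bullet> b - l \<bullet> b \<in> ?I" and t: "z \<bullet> e - l \<bullet> e \<in> ?J"
    using z b e by (auto simp: mem_box)
  have hz: "h (z \<bullet> b - l \<bullet> b) (z \<bullet> e - l \<bullet> e) = z"
    by (simp add: h_def p_def algebra_simps)
  have "partial ?S b (partial ?S e g) (h (z \<bullet> b - l \<bullet> b) (z \<bullet> e - l \<bullet> e))
      = partial ?S e (partial ?S b g) (h (z \<bullet> b - l \<bullet> b) (z \<bullet> e - l \<bullet> e))"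
  proof (rule mixed_derivatives_eq[where \<phi> = "\<lambda>s t. g (h s t)" and \<phi>t = "\<lambda>s t. partial ?S e g (h s t)"
        and \<phi>s = "\<lambda>s t. partial ?S b g (h s t)" and \<phi>st = "\<lambda>s t. partial ?S e (partial ?S b g) (h s t)",
        OF _ _ s_dir[OF g1(1)] t_dir[OF g1(1)] t_dir[OF g1(2)] _ _ s t s_dir[OF g1(3) s t]])
    show "continuous_on ?I (\<lambda>s. partial ?S b g (h s t))" if "t \<in> ?J" for t
      using h_in that by (intro continuous_on_compose2[OF Ck_on_imp_continuous[OF g1(2)]])
        (auto simp: h_def intro!: continuous_intros)
    have "continuous_on ?S (partial ?S e (partial ?S b g))" using g1(2) e by simp
    then show "continuous_on (?J \<times> ?I) (\<lambda>(t, s). partial ?S e (partial ?S b g) (h s t))"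
      unfolding case_prod_beta
      by (rule continuous_on_compose2) (use h_in in \<open>auto simp: h_def intro!: continuous_intros\<close>)
  qed (use lr b e in auto)
  then show ?thesis by (simp add: hz)
qed simp

text \<open>\<open>set_coord k s x\<close> is the point \<open>x\<close> moved parallel to the \<open>k\<close>-th axis to height \<open>s\<close>.\<close>

definition set_coord :: "'d \<Rightarrow> real \<Rightarrow> real ^ 'd \<Rightarrow> real ^ 'd" where
  "set_coord k s x = (\<chi> m. if m = k then s else x $ m)"

lemma set_coord_nth [simp]: "set_coord k s x $ m = (if m = k then s else x $ m)"
  by (simp add: set_coord_def)

lemma mem_cube: "x \<in> cube \<longleftrightarrow> (\<forall>m. 0 \<le> x $ m \<and> x $ m \<le> 1)"
  by (simp add: cube_def mem_box_cart)

lemma set_coord_in_cube: "x \<in> cube \<Longrightarrow> s \<in> {0..1} \<Longrightarrow> set_coord k s x \<in> cube"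
  by (auto simp: mem_cube)

lemma set_coord_eq: "set_coord k s x = s *\<^sub>R axis k 1 + set_coord k 0 x"
  by (auto simp: vec_eq_iff axis_def)

lemma continuous_on_set_coord [continuous_intros]:
  assumes "continuous_on A f" "continuous_on A g"
  shows "continuous_on A (\<lambda>y. set_coord k (f y) (g y))"
  unfolding set_coord_def
proof (rule continuous_on_vec_lambda)
  show "continuous_on A (\<lambda>y. if m = k then f y else g y $ m)" for m
    by (cases "m = k") (auto intro!: continuous_intros assms)
qed

text \<open>
  Averaging over a new value of the \<open>k\<close>-th coordinate does not change an integral over the cube:
  the exchange of the \<open>k\<close>-th space coordinate with an additional real variable preserves measure.
\<close>

lemma integral_set_coord:
  fixes h :: "real ^ 'd \<Rightarrow> real"
  assumes cont: "continuous_on cube h"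
  shows "integral cube (\<lambda>x. integral {0..1} (\<lambda>s. h (set_coord k s x))) = integral cube h"
proof -
  \<comment> \<open>the exchange of the \<open>k\<close>-th coordinate with the additional variable\<close>
  define X where "X = (\<lambda>(x, s). (set_coord k s x, x $ k :: real))"
  have XX: "X (X z) = z" for z
    by (auto simp: X_def vec_eq_iff split: prod.split)
  have img: "X ` cbox u v = cbox (X u) (X v)" for u v
  proof -
    have imp: "X z \<in> cbox (X u) (X v)" if "z \<in> cbox u v" for z u v
      using that by (cases z; cases u; cases v) (simp add: X_def cbox_Pair_iff mem_box_cart)
    then have "X ` cbox u v \<subseteq> cbox (X u) (X v)" by blast
    moreover have "z \<in> X ` cbox u v" if "z \<in> cbox (X u) (X v)" for z
      using imp[OF that] by (intro image_eqI[of z X "X z"]) (simp_all add: XX)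
    ultimately show ?thesis by blast
  qed
  have img_ex: "\<exists>w z. X ` cbox u v = cbox w z" for u v
    using img by blast
  have content: "measure lborel (X ` cbox u v) = 1 * measure lborel (cbox u v)" for u v
  proof (cases "cbox u v = {}")
    case False
    obtain a p b q where uv: "u = (a, p)" "v = (b, q)" by fastforce
    have "cbox (X u) (X v) \<noteq> {}" using False img by blast
    then have ne: "cbox (set_coord k p a) (set_coord k q b) \<noteq> {}" "cbox (a $ k) (b $ k) \<noteq> {}"
      by (auto simp: X_def uv cbox_Pair_eq)
    have ne': "cbox a b \<noteq> {}" "cbox p q \<noteq> {}" using False by (auto simp: uv cbox_Pair_eq)
    have split: "(\<Prod>m\<in>UNIV. f m) = f k * (\<Prod>m\<in>UNIV - {k}. f m)" for f :: "'d \<Rightarrow> real"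
      by (simp add: prod.remove)
    have "measure lborel (cbox (set_coord k p a) (set_coord k q b)) = (q - p) * (\<Prod>m\<in>UNIV - {k}. b $ m - a $ m)"
      by (simp add: content_cbox_cart[OF ne(1)] split)
    moreover have "measure lborel (cbox a b) = (b $ k - a $ k) * (\<Prod>m\<in>UNIV - {k}. b $ m - a $ m)"
      by (simp add: content_cbox_cart[OF ne'(1)] split)
    ultimately show ?thesis
      using ne(2) ne'(2) unfolding img by (simp add: X_def uv content_Pair content_real)
  qed simp
  have contX: "continuous_on A X" for A
    unfolding X_def case_prod_beta by (intro continuous_intros)
  have Q: "cube \<times> {0..1} = cbox (0 :: real ^ 'd, 0 :: real) (1, 1)"
    by (simp add: cube_def cbox_Pair_eq)
  have c1: "continuous_on (cube \<times> {0..1}) (\<lambda>z :: (real ^ 'd) \<times> real. h (fst z))"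
    by (intro continuous_on_compose2[OF cont]) (auto intro!: continuous_intros)
  have c2: "continuous_on (cube \<times> {0..1}) (\<lambda>z. h (set_coord k (snd z) (fst z)))"
    by (intro continuous_on_compose2[OF cont]) (auto intro!: continuous_intros set_coord_in_cube)
  have "((\<lambda>z. h (fst (X z))) has_integral (1 / 1) *\<^sub>R integral (cbox (0, 0) (1, 1)) (\<lambda>z :: (real ^ 'd) \<times> real. h (fst z)))
      (X ` cbox (0, 0) (1, 1))"
  proof (rule has_integral_twiddle[where g = X and h = X and r = 1])
    show "continuous (at z) X" for z
      using contX[of UNIV] by (simp add: continuous_on_eq_continuous_at del: split_paired_All)
    show "((\<lambda>z :: (real ^ 'd) \<times> real. h (fst z)) has_integral integral (cbox (0, 0) (1, 1)) (\<lambda>z :: (real ^ 'd) \<times> real. h (fst z)))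
        (cbox (0, 0) (1, 1))"
      using c1 unfolding Q by (intro integrable_integral integrable_continuous)
  qed (simp_all only: XX content img_ex zero_less_one)
  moreover have "X (0, 0) = (0, 0)" "X (1, 1) = (1, 1)"
    by (auto simp: X_def vec_eq_iff)
  ultimately have "integral (cbox (0, 0) (1, 1)) (\<lambda>z. h (set_coord k (snd z) (fst z)))
      = integral (cbox (0, 0) (1, 1)) (\<lambda>z :: (real ^ 'd) \<times> real. h (fst z))"
    by (simp add: img) (simp add: X_def case_prod_beta has_integral_iff)
  then show ?thesis
    using integral_prod_continuous[OF c2[unfolded Q]] integral_prod_continuous[OF c1[unfolded Q]]
    by (simp add: cube_def)
qed

text \<open>The divergence theorem on the cube, for one component of the field.\<close>

lemma integral_partial_cube:
  fixes w h :: "real ^ 'd \<Rightarrow> real"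
  assumes "continuous_on cube h"
    and "\<And>x s. x \<in> cube \<Longrightarrow> s \<in> {0..1} \<Longrightarrow>
      ((\<lambda>s. w (set_coord k s x)) has_real_derivative h (set_coord k s x)) (at s within {0..1})"
  shows "integral cube h = integral cube (\<lambda>x. w (set_coord k 1 x) - w (set_coord k 0 x))"
proof -
  have "integral {0..1} (\<lambda>s. h (set_coord k s x)) = w (set_coord k 1 x) - w (set_coord k 0 x)"
    if "x \<in> cube" for x
    using fundamental_theorem_of_calculus[of 0 1 "\<lambda>s. w (set_coord k s x)" "\<lambda>s. h (set_coord k s x)"]
      assms(2)[OF that]
    by (simp add: has_real_derivative_iff_has_vector_derivative integral_unique)
  then show ?thesis
    using integral_set_coord[OF assms(1), of k] by (simp cong: integral_cong)
qed

section \<open>Space-time cylinders over the cube\<close>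

lemma cylinder_eq_cbox: "cube \<times> {a..b} = cbox (0, a) (1, b :: real)"
  by (simp add: cube_def cbox_Pair_eq)

lemma axis_in_Basis_prod [simp]: "(axis k 1, 0) \<in> (Basis :: ((real ^ 'd) \<times> real) set)"
  by (auto simp: Basis_prod_def axis_in_Basis_iff)

lemma time_in_Basis_prod [simp]: "(0, 1) \<in> (Basis :: ((real ^ 'd) \<times> real) set)"
  by (auto simp: Basis_prod_def)

lemma axis_in_Basis_vec [simp]: "axis k 1 \<in> (Basis :: (real ^ 'd) set)"
  by (simp add: axis_in_Basis_iff)

lemma cylinder_sides: "a < b \<Longrightarrow> c \<in> Basis \<Longrightarrow> (0 :: real ^ 'd, a :: real) \<bullet> c < (1, b) \<bullet> c"
  by (auto simp: Basis_prod_def Basis_vec_def inner_axis)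

lemma unique_derivatives_cylinder:
  "a < b \<Longrightarrow> unique_derivatives (cube \<times> {a..b} :: ((real ^ 'd) \<times> real) set)"
  unfolding cylinder_eq_cbox by (intro unique_derivatives_cbox cylinder_sides)

lemma unique_derivatives_cube: "unique_derivatives (cube :: (real ^ 'd) set)"
  unfolding cube_def by (rule unique_derivatives_cbox) (auto simp: Basis_vec_def inner_axis)

lemma norm_grad_sq: "(norm (grad S g z))\<^sup>2 = (\<Sum>k\<in>UNIV. (partial S (axis k 1, 0) g z)\<^sup>2)"
  by (simp add: power2_norm_eq_inner inner_vec_def grad_def) (simp add: power2_eq_square)

lemma norm_grad_space_sq: "(norm (grad_space S g x))\<^sup>2 = (\<Sum>k\<in>UNIV. (partial S (axis k 1) g x)\<^sup>2)"
  by (simp add: power2_norm_eq_inner inner_vec_def grad_space_def) (simp add: power2_eq_square)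

lemma continuous_on_slice:
  assumes "continuous_on (cube \<times> I) f" "t \<in> I"
  shows "continuous_on cube (\<lambda>x. f (x, t))"
  by (intro continuous_on_compose2[OF assms(1)]) (auto intro!: continuous_intros simp: assms(2))

lemma integrable_slice:
  assumes "continuous_on (cube \<times> I) (f :: (real ^ 'd) \<times> real \<Rightarrow> real)" "t \<in> I"
  shows "(\<lambda>x. f (x, t)) integrable_on cube"
  using continuous_on_slice[OF assms] unfolding cube_def by (rule integrable_continuous)

lemma integrable_cylinder:
  "continuous_on (cube \<times> {a..b}) (f :: (real ^ 'd) \<times> real \<Rightarrow> real) \<Longrightarrow> f integrable_on cube \<times> {a..b}"
  unfolding cylinder_eq_cbox by (rule integrable_continuous)

lemma integral_cylinder:
  fixes f :: "(real ^ 'd) \<times> real \<Rightarrow> real"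
  assumes "continuous_on (cube \<times> {a..b}) f"
  shows "integral (cube \<times> {a..b}) f = integral {a..b} (\<lambda>t. integral cube (\<lambda>x. f (x, t)))"
    and "integral cube (\<lambda>x. integral {a..b} (\<lambda>t. f (x, t))) = integral {a..b} (\<lambda>t. integral cube (\<lambda>x. f (x, t)))"
proof -
  show *: "integral cube (\<lambda>x. integral {a..b} (\<lambda>t. f (x, t))) = integral {a..b} (\<lambda>t. integral cube (\<lambda>x. f (x, t)))"
    using integral_swap_continuous[of 0 a 1 b "\<lambda>x t. f (x, t)"] assms
    unfolding cylinder_eq_cbox by (simp add: cube_def)
  show "integral (cube \<times> {a..b}) f = integral {a..b} (\<lambda>t. integral cube (\<lambda>x. f (x, t)))"
    using integral_prod_continuous[OF assms[unfolded cylinder_eq_cbox]]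
    unfolding cylinder_eq_cbox *[symmetric] by (simp add: cube_def)
qed

lemma continuous_on_slice_integral:
  fixes f :: "(real ^ 'd) \<times> real \<Rightarrow> real"
  assumes "continuous_on (cube \<times> I) f"
  shows "continuous_on I (\<lambda>t. integral cube (\<lambda>x. f (x, t)))"
  unfolding cube_def
proof (rule integral_continuous_on_param)
  show "continuous_on (I \<times> cbox 0 1) (\<lambda>(t, x). f (x, t))"
    unfolding case_prod_beta
    by (intro continuous_on_compose2[OF assms]) (auto intro!: continuous_intros simp: cube_def)
qed

lemma has_real_derivative_dtime:
  assumes "Ck_on k (cube \<times> I) g" "0 < k" "x \<in> cube" "t \<in> I"
  shows "((\<lambda>t. g (x, t)) has_real_derivative dtime (cube \<times> I) g (x, t)) (at t within I)"
  using has_real_derivative_along[OF assms(1,2), of I "(0, 1)" "(x, 0)" t] assms(3,4)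
  by (simp add: dtime_def)

lemma bounded_linear_set_coord: "bounded_linear (\<lambda>z :: (real ^ 'd) \<times> real. (set_coord k 0 (fst z), snd z))"
  unfolding linear_conv_bounded_linear[symmetric]
  by (rule linearI) (auto simp: vec_eq_iff)

text \<open>Values on a face, extended constantly in the direction normal to the face.\<close>

lemma Ck_on_set_coord:
  fixes g :: "(real ^ 'd) \<times> real \<Rightarrow> real"
  assumes "unique_derivatives (cube \<times> J :: ((real ^ 'd) \<times> real) set)" "J \<subseteq> I" "Ck_on m (cube \<times> I) g" "s \<in> {0..1}"
  shows "Ck_on m (cube \<times> J) (\<lambda>z. g (set_coord k s (fst z), snd z))"
proof -
  have eq: "(set_coord k 0 (fst z), snd z) + (s *\<^sub>R axis k 1, 0) = (set_coord k s (fst z), snd z)"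
    for z :: "(real ^ 'd) \<times> real"
    using set_coord_eq[of k s "fst z"] by simp
  have "Ck_on m (cube \<times> J) (\<lambda>z. g ((set_coord k 0 (fst z), snd z) + (s *\<^sub>R axis k 1, 0)))"
  proof (rule Ck_on_affine_compose[OF assms(1) bounded_linear_set_coord _ assms(3)])
    show "(set_coord k 0 (fst z), snd z) + (s *\<^sub>R axis k 1, 0) \<in> cube \<times> I" if "z \<in> cube \<times> J" for z
      unfolding eq using that assms(2,4) by (auto intro: set_coord_in_cube)
  qed
  then show ?thesis by (simp only: eq)
qed

lemma bounded_linear_embed_time: "bounded_linear (\<lambda>x :: real ^ 'd. (x, 0 :: real))"
  unfolding linear_conv_bounded_linear[symmetric] by (rule linearI) auto

lemma Ck_on_slice:
  fixes g :: "(real ^ 'd) \<times> real \<Rightarrow> real"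
  assumes "Ck_on m (cube \<times> I) g" "t \<in> I"
  shows "Ck_on m cube (\<lambda>x. g (x, t))"
  using Ck_on_affine_compose[OF unique_derivatives_cube bounded_linear_embed_time, of "(0, t)" "cube \<times> I" m g] assms
  by simp

lemma partial_slice:
  fixes g :: "(real ^ 'd) \<times> real \<Rightarrow> real"
  assumes "Ck_on m (cube \<times> I) g" "0 < m" "t \<in> I" "x \<in> cube"
  shows "partial cube b (\<lambda>x. g (x, t)) x = partial (cube \<times> I) (b, 0) g (x, t)"
  using partial_affine_compose[OF unique_derivatives_cube bounded_linear_embed_time, of "(0, t)" "cube \<times> I" m g] assms
  by simp

text \<open>The Cauchy-Schwarz inequality for finitely many functions on a cylinder.\<close>

lemma sum_integral_le_sqrt:
  fixes f :: "'i \<Rightarrow> (real ^ 'd) \<times> real \<Rightarrow> real"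
  assumes "finite A" "A \<noteq> {}" "a < b" and cont: "\<And>i. i \<in> A \<Longrightarrow> continuous_on (cube \<times> {a..b}) (f i)"
  shows "(\<Sum>i\<in>A. integral (cube \<times> {a..b}) (f i))
    \<le> sqrt (real (card A) * (b - a)) * sqrt (\<Sum>i\<in>A. integral (cube \<times> {a..b}) (\<lambda>z. (f i z)\<^sup>2))"
proof -
  let ?B = "cube \<times> {a..b} :: ((real ^ 'd) \<times> real) set"
  define I where "I = (\<Sum>i\<in>A. integral ?B (f i))"
  define V where "V = real (card A) * (b - a)"
  have "0 < V" using assms by (simp add: V_def card_gt_0_iff)
  have int: "f i integrable_on ?B" "(\<lambda>z. (f i z)\<^sup>2) integrable_on ?B" if "i \<in> A" for i
    using cont[OF that] by (auto intro!: integrable_cylinder continuous_intros)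
  have vol: "((\<lambda>z. c) has_integral (b - a) * c) ?B" for c :: real
  proof -
    have "measure lborel (cbox 0 (1 :: real ^ 'd)) = 1"
      by (subst content_cbox_cart) (simp_all add: interval_ne_empty_cart)
    then show ?thesis
      using has_integral_const[of c "(0 :: real ^ 'd, a)" "(1, b)"] \<open>a < b\<close>
      unfolding cylinder_eq_cbox by (simp add: content_Pair)
  qed
  \<comment> \<open>the variance of the family with respect to its mean \<open>I / V\<close> is nonnegative\<close>
  have "0 \<le> (\<Sum>i\<in>A. integral ?B (\<lambda>z. (f i z - I / V)\<^sup>2))"
    using cont by (intro sum_nonneg integral_nonneg integrable_cylinder) (auto intro!: continuous_intros)
  also have "\<dots> = (\<Sum>i\<in>A. integral ?B (\<lambda>z. (f i z)\<^sup>2) - 2 * (I / V) * integral ?B (f i) + (b - a) * (I / V)\<^sup>2)"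
  proof (intro sum.cong refl integral_unique)
    fix i assume "i \<in> A"
    have "((\<lambda>z. (f i z)\<^sup>2 - 2 * (I / V) * f i z + (I / V)\<^sup>2) has_integral
        integral ?B (\<lambda>z. (f i z)\<^sup>2) - 2 * (I / V) * integral ?B (f i) + (b - a) * (I / V)\<^sup>2) ?B"
      by (intro has_integral_add has_integral_diff has_integral_mult_right integrable_integral int vol \<open>i \<in> A\<close>)
    then show "((\<lambda>z. (f i z - I / V)\<^sup>2) has_integral
        integral ?B (\<lambda>z. (f i z)\<^sup>2) - 2 * (I / V) * integral ?B (f i) + (b - a) * (I / V)\<^sup>2) ?B"
      by (simp add: power2_diff algebra_simps)
  qed
  also have "\<dots> = (\<Sum>i\<in>A. integral ?B (\<lambda>z. (f i z)\<^sup>2)) - 2 * (I / V) * I + V * (I / V)\<^sup>2"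
    unfolding sum.distrib sum_subtractf sum_distrib_left[symmetric] I_def[symmetric] by (simp add: V_def)
  also have "\<dots> = (\<Sum>i\<in>A. integral ?B (\<lambda>z. (f i z)\<^sup>2)) - I\<^sup>2 / V"
    using \<open>0 < V\<close> by (simp add: power2_eq_square field_simps)
  finally have "I\<^sup>2 \<le> V * (\<Sum>i\<in>A. integral ?B (\<lambda>z. (f i z)\<^sup>2))"
    using \<open>0 < V\<close> by (simp add: field_simps)
  then show ?thesis unfolding I_def[symmetric] V_def[symmetric] real_sqrt_mult[symmetric]
    by (rule real_le_rsqrt)
qed

section \<open>The energy estimate\<close>

text \<open>The energy of a pair of functions on \<open>S\<close> at time \<open>t\<close>.\<close>

definition energy ::
  "((real ^ 'd) \<times> real) set \<Rightarrow> ((real ^ 'd) \<times> real \<Rightarrow> real) \<Rightarrow> ((real ^ 'd) \<times> real \<Rightarrow> real) \<Rightarrow> real \<Rightarrow> real" where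
  "energy S w q t =
     integral cube (\<lambda>x. (w (x, t))\<^sup>2 + (norm (grad S w (x, t)))\<^sup>2 + (q (x, t))\<^sup>2)"

lemma continuous_on_energy:
  assumes "Ck_on 1 (cube \<times> I) w" "Ck_on 0 (cube \<times> I) q"
  shows "continuous_on I (energy (cube \<times> I) w q)"
proof -
  have "continuous_on (cube \<times> I) (\<lambda>z. (w z)\<^sup>2 + (norm (grad (cube \<times> I) w z))\<^sup>2 + (q z)\<^sup>2)"
    unfolding norm_grad_sq using assms Ck_on_imp_continuous[OF assms(1)]
    by (auto intro!: continuous_intros)
  from continuous_on_slice_integral[OF this] show ?thesis
    by (simp add: energy_def[abs_def])
qed

text \<open>
  The energy of a pair of functions of the space variable. The energy at time \<open>t\<close> depends only on the
  values at that time, so that the approximations of consecutive blocks, which live on different time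
  intervals, can be compared.
\<close>

definition slice_energy :: "(real ^ 'd \<Rightarrow> real) \<Rightarrow> (real ^ 'd \<Rightarrow> real) \<Rightarrow> real" where
  "slice_energy p r = integral cube (\<lambda>x. (p x)\<^sup>2 + (norm (grad_space cube p x))\<^sup>2 + (r x)\<^sup>2)"

lemma energy_eq_slice_energy:
  assumes "Ck_on 1 (cube \<times> I) w" "t \<in> I"
  shows "energy (cube \<times> I) w q t = slice_energy (\<lambda>x. w (x, t)) (\<lambda>x. q (x, t))"
  unfolding energy_def slice_energy_def norm_grad_sq norm_grad_space_sq
  by (rule integral_cong) (simp add: partial_slice[OF assms(1) _ assms(2)])

lemma slice_energy_cong:
  assumes "\<And>x. x \<in> cube \<Longrightarrow> p x = p' x" "\<And>x. x \<in> cube \<Longrightarrow> r x = r' x"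
  shows "slice_energy p r = slice_energy p' r'"
  unfolding slice_energy_def norm_grad_space_sq
  using assms by (intro integral_cong) (simp add: partial_cong[of cube p p'])

lemma slice_energy_zero: "slice_energy (\<lambda>x :: real ^ 'd. 0) (\<lambda>x. 0) = 0"
proof -
  have "partial cube b (\<lambda>x. 0) x = 0" if "x \<in> cube" for b x :: "real ^ 'd"
    by (rule partial_eqI[OF unique_derivatives_cube that has_derivative_const])
  then have "slice_energy (\<lambda>x :: real ^ 'd. 0) (\<lambda>x. 0) = integral cube (\<lambda>x :: real ^ 'd. 0)"
    unfolding slice_energy_def norm_grad_space_sq by (intro integral_cong) simp
  then show ?thesis by simp
qed

lemma integrable_slice_energy:
  assumes "Ck_on 1 cube p" "Ck_on 0 cube r"
  shows "(\<lambda>x. (p x)\<^sup>2) integrable_on cube" "(\<lambda>x. (norm (grad_space cube p x))\<^sup>2) integrable_on cube"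
    "(\<lambda>x. (r x)\<^sup>2) integrable_on cube"
  using assms Ck_on_imp_continuous[OF assms(1)] unfolding norm_grad_space_sq
  by (auto simp: cube_def intro!: integrable_continuous continuous_intros)

lemma slice_energy_eq:
  assumes "Ck_on 1 cube p" "Ck_on 0 cube r"
  shows "slice_energy p r = integral cube (\<lambda>x. (p x)\<^sup>2)
    + integral cube (\<lambda>x. (norm (grad_space cube p x))\<^sup>2) + integral cube (\<lambda>x. (r x)\<^sup>2)"
  unfolding slice_energy_def
  by (subst integral_add; (intro integrable_add integrable_slice_energy[OF assms] refl)?)+

lemma slice_energy_add_le:
  fixes p p' r r' :: "real ^ 'd \<Rightarrow> real"
  assumes p: "Ck_on 1 cube p" "Ck_on 1 cube p'" and r: "Ck_on 0 cube r" "Ck_on 0 cube r'"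
  shows "slice_energy (\<lambda>x. p x + p' x) (\<lambda>x. r x + r' x) \<le> 2 * slice_energy p r + 2 * slice_energy p' r'"
proof -
  have le: "(x + y)\<^sup>2 \<le> 2 * x\<^sup>2 + 2 * y\<^sup>2" for x y :: real
    using sum_squares_bound[of x y] by (simp add: power2_sum)
  have sum: "Ck_on 1 cube (\<lambda>x. p x + p' x)" "Ck_on 0 cube (\<lambda>x. r x + r' x)"
    by (intro Ck_on_add unique_derivatives_cube p r)+
  have grad: "(norm (grad_space cube (\<lambda>x. p x + p' x) x))\<^sup>2
      \<le> 2 * (norm (grad_space cube p x))\<^sup>2 + 2 * (norm (grad_space cube p' x))\<^sup>2" if x: "x \<in> cube" for x
  proof -
    have "partial cube b (\<lambda>x. p x + p' x) x = partial cube b p x + partial cube b p' x" for b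
      by (rule partial_eqI[OF unique_derivatives_cube x])
        (intro has_derivative_add Ck_on_has_derivative[OF p(1) _ x] Ck_on_has_derivative[OF p(2) _ x]; simp)
    then show ?thesis
      unfolding norm_grad_space_sq by (simp add: sum_distrib_left flip: sum.distrib) (intro sum_mono le)
  qed
  have "slice_energy (\<lambda>x. p x + p' x) (\<lambda>x. r x + r' x)
      \<le> integral cube (\<lambda>x. 2 * ((p x)\<^sup>2 + (norm (grad_space cube p x))\<^sup>2 + (r x)\<^sup>2)
          + 2 * ((p' x)\<^sup>2 + (norm (grad_space cube p' x))\<^sup>2 + (r' x)\<^sup>2))"
    unfolding slice_energy_def
  proof (intro integral_le integrable_add integrable_on_mult_right integrable_slice_energy[OF sum]
      integrable_slice_energy[OF p(1) r(1)] integrable_slice_energy[OF p(2) r(2)])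
    fix x :: "real ^ 'd" assume "x \<in> cube"
    from grad[OF this] le[of "p x" "p' x"] le[of "r x" "r' x"]
    show "(p x + p' x)\<^sup>2 + (norm (grad_space cube (\<lambda>x. p x + p' x) x))\<^sup>2 + (r x + r' x)\<^sup>2
      \<le> 2 * ((p x)\<^sup>2 + (norm (grad_space cube p x))\<^sup>2 + (r x)\<^sup>2)
          + 2 * ((p' x)\<^sup>2 + (norm (grad_space cube p' x))\<^sup>2 + (r' x)\<^sup>2)" by simp
  qed
  also have "\<dots> = 2 * slice_energy p r + 2 * slice_energy p' r'"
    unfolding slice_energy_def
    by (subst integral_add integral_mult_right; (intro integrable_add integrable_on_mult_right
          integrable_slice_energy[OF p(1) r(1)] integrable_slice_energy[OF p(2) r(2)] refl)?)+
  finally show ?thesis .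
qed

text \<open>
  The \<open>k\<close>-th component of the flux \<open>q \<nabla>w\<close>, and its jump between the faces where the
  \<open>k\<close>-th coordinate is 0 and 1.
\<close>

definition flux ::
  "((real ^ 'd) \<times> real) set \<Rightarrow> ((real ^ 'd) \<times> real \<Rightarrow> real) \<Rightarrow> ((real ^ 'd) \<times> real \<Rightarrow> real) \<Rightarrow> 'd
    \<Rightarrow> (real ^ 'd) \<times> real \<Rightarrow> real" where
  "flux S w q k z = q z * partial S (axis k 1, 0) w z"

definition flux_jump ::
  "((real ^ 'd) \<times> real) set \<Rightarrow> ((real ^ 'd) \<times> real \<Rightarrow> real) \<Rightarrow> ((real ^ 'd) \<times> real \<Rightarrow> real) \<Rightarrow> 'd
    \<Rightarrow> (real ^ 'd) \<times> real \<Rightarrow> real" where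
  "flux_jump S w q k z = flux S w q k (set_coord k 1 (fst z), snd z) - flux S w q k (set_coord k 0 (fst z), snd z)"

text \<open>
  The density of the energy has a time derivative of at most twice the density, plus the squares
  of the source terms, plus twice the divergence of the flux. Integration over the cube turns the
  divergence into the jumps of the flux, and Gronwall's inequality concludes.
\<close>

lemma energy_estimate:
  fixes w q r1 r2 :: "(real ^ 'd) \<times> real \<Rightarrow> real"
  assumes S: "S = cube \<times> {0..\<tau>}" and "0 < \<tau>" and ab: "0 \<le> a" "b \<le> \<tau>" and t: "t \<in> {a..b}"
    and w: "Ck_on 2 S w" and q: "Ck_on 1 S q"
    and r1: "\<And>z. z \<in> S \<Longrightarrow> r1 z = dtime S w z - q z"
    and r2: "\<And>z. z \<in> S \<Longrightarrow> r2 z = dtime S q z - laplacian S w z"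
  shows "energy S w q t \<le>
      (energy S w q a + integral (cube \<times> {a..b}) (\<lambda>z. (r1 z)\<^sup>2 + (r2 z)\<^sup>2 + (norm (grad S r1 z))\<^sup>2)
       + 2 * (\<Sum>k\<in>UNIV. integral (cube \<times> {a..b}) (\<lambda>z. \<bar>flux_jump S w q k z\<bar>))) * exp (2 * (t - a))"
proof -
  define D where "D k f z = partial S (axis k 1, 0) f z" for k :: 'd and f z
  define Dt where "Dt f z = partial S (0, 1) f z" for f z
  have uS: "unique_derivatives S" unfolding S using \<open>0 < \<tau>\<close> by (rule unique_derivatives_cylinder)
  have w1: "Ck_on 1 S w" and Dw: "Ck_on 1 S (D k w)" and Dtw: "Ck_on 1 S (Dt w)" for k
    using w Ck_on_mono[OF w, of 1] by (auto simp: D_def[abs_def] Dt_def[abs_def] numeral_2_eq_2)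
  have r1': "Ck_on 1 S r1"
    using Ck_on_diff[OF uS Dtw q] r1 by (subst Ck_on_cong[where g = "\<lambda>z. Dt w z - q z"]) (auto simp: dtime_def Dt_def)
  have cD: "continuous_on S (D k f)" "continuous_on S (Dt f)" "continuous_on S f" if "Ck_on 1 S f" for k f
    using that Ck_on_imp_continuous[OF that] by (auto simp: D_def[abs_def] Dt_def[abs_def])
  have cr2: "continuous_on S r2"
  proof -
    have "continuous_on S (\<lambda>z. Dt q z - (\<Sum>k\<in>UNIV. D k (D k w) z))"
      by (intro continuous_intros cD q Dw)
    moreover have "r2 z = Dt q z - (\<Sum>k\<in>UNIV. D k (D k w) z)" if "z \<in> S" for z
      using r2[OF that] by (simp add: dtime_def laplacian_def D_def[abs_def] Dt_def)
    ultimately show ?thesis by (simp cong: continuous_on_cong)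
  qed
  define e where "e z = (w z)\<^sup>2 + (\<Sum>k\<in>UNIV. (D k w z)\<^sup>2) + (q z)\<^sup>2" for z
  define e' where "e' z = 2 * w z * Dt w z + (\<Sum>k\<in>UNIV. 2 * D k w z * Dt (D k w) z) + 2 * q z * Dt q z" for z
  define R where "R z = (r1 z)\<^sup>2 + (r2 z)\<^sup>2 + (\<Sum>k\<in>UNIV. (D k r1 z)\<^sup>2)" for z
  define \<phi> where "\<phi> k = flux S w q k" for k
  define J where "J k = flux_jump S w q k" for k
  have ce: "continuous_on S e" and ce': "continuous_on S e'" and cR: "continuous_on S R"
    unfolding e_def e'_def R_def by (intro continuous_intros cD w1 Dw q r1' cr2)+
  have \<phi>1: "Ck_on 1 S (\<phi> k)" for k
    using Ck_on_mult[OF uS q Dw] by (simp add: \<phi>_def flux_def[abs_def] D_def[abs_def])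
  have cJ: "continuous_on S (J k)" for k
    unfolding J_def flux_jump_def \<phi>_def[symmetric]
    by (intro continuous_intros continuous_on_compose2[OF cD(3)[OF \<phi>1]])
      (auto simp: S set_coord_in_cube intro!: continuous_intros)
  have cJ_abs: "continuous_on S (\<lambda>z. \<bar>J k z\<bar>)" for k
    by (intro continuous_intros cJ)
  have pointwise: "e' z \<le> 2 * e z + R z + 2 * (\<Sum>k\<in>UNIV. D k (\<phi> k) z)" if z: "z \<in> S" for z
  proof -
    have 1: "Dt w z = q z + r1 z" using r1[OF z] by (simp add: dtime_def Dt_def)
    \<comment> \<open>the gradient of \<open>dtime w = q + r1\<close>, after exchanging the two derivatives of \<open>w\<close>\<close>
    have 2: "Dt (D k w) z = D k q z + D k r1 z" for k
    proof -
      have "Dt (D k w) z = D k (Dt w) z"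
        using partial_commute[OF cylinder_sides[OF \<open>0 < \<tau>\<close>] w[unfolded S cylinder_eq_cbox]] z
        unfolding Dt_def[abs_def] D_def[abs_def] S cylinder_eq_cbox by simp
      moreover have "D k r1 z = D k (\<lambda>z. Dt w z - q z) z"
        unfolding D_def by (rule partial_cong[OF _ z]) (simp add: r1 dtime_def Dt_def)
      moreover have "\<dots> = D k (Dt w) z - D k q z"
        unfolding D_def by (rule partial_diff[OF uS Dtw q _ z]) simp
      ultimately show ?thesis by simp
    qed
    have 3: "Dt q z = (\<Sum>k\<in>UNIV. D k (D k w) z) + r2 z"
      using r2[OF z] by (simp add: dtime_def laplacian_def D_def[abs_def] Dt_def)
    have 4: "D k (\<phi> k) z = q z * D k (D k w) z + D k q z * D k w z" for k
      using partial_mult[OF uS q Dw _ z] unfolding D_def \<phi>_def flux_def[abs_def] by simp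
    have am_gm: "2 * x * y \<le> x\<^sup>2 + y\<^sup>2" for x y :: real by (rule sum_squares_bound)
    have "e' z - 2 * (\<Sum>k\<in>UNIV. D k (\<phi> k) z)
        = 2 * w z * q z + 2 * w z * r1 z + (\<Sum>k\<in>UNIV. 2 * D k w z * D k r1 z) + 2 * q z * r2 z"
      unfolding e'_def 1 2 3 4 by (simp add: sum_distrib_left sum.distrib algebra_simps)
    also have "\<dots> \<le> ((w z)\<^sup>2 + (q z)\<^sup>2) + ((w z)\<^sup>2 + (r1 z)\<^sup>2)
        + (\<Sum>k\<in>UNIV. (D k w z)\<^sup>2 + (D k r1 z)\<^sup>2) + ((q z)\<^sup>2 + (r2 z)\<^sup>2)"
      by (intro add_mono sum_mono am_gm)
    also have "\<dots> \<le> 2 * e z + R z"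
      unfolding e_def R_def by (simp add: sum.distrib sum_nonneg)
    finally show ?thesis by simp
  qed
  have time_dir: "((\<lambda>s. f (x, s)) has_real_derivative Dt f (x, s)) (at s within {0..\<tau>})"
    if "Ck_on 1 S f" "x \<in> cube" "s \<in> {0..\<tau>}" for f x s
    using has_real_derivative_along[OF that(1), of "{0..\<tau>}" "(0, 1)" "(x, 0)" s] that(2,3)
    by (simp add: S Dt_def)
  have e_dir: "((\<lambda>s. e (x, s)) has_real_derivative e' (x, s)) (at s within {0..\<tau>})"
    if "x \<in> cube" "s \<in> {0..\<tau>}" for x s
    unfolding e_def e'_def
    by (rule derivative_eq_intros time_dir[OF w1 that] time_dir[OF Dw that] time_dir[OF q that] refl)+
      (simp add: ac_simps)
  define E where "E s = integral cube (\<lambda>x. e (x, s))" for s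
  have E: "energy S w q = E"
    by (simp add: fun_eq_iff energy_def E_def e_def norm_grad_sq D_def)
  define G where "G s = integral cube (\<lambda>x. R (x, s)) + 2 * (\<Sum>k\<in>UNIV. integral cube (\<lambda>x. \<bar>J k (x, s)\<bar>))" for s
  have cE: "continuous_on {0..\<tau>} E"
    unfolding E_def using ce S by (intro continuous_on_slice_integral) simp
  have cG: "continuous_on {0..\<tau>} G"
    unfolding G_def using cR cJ S by (intro continuous_intros continuous_on_slice_integral) simp_all
  have G_nonneg: "0 \<le> G s" if "s \<in> {0..\<tau>}" for s
    unfolding G_def using that cR cJ_abs
    by (intro add_nonneg_nonneg mult_nonneg_nonneg sum_nonneg integral_nonneg integrable_slice[of "{0..\<tau>}"])
      (auto simp: S R_def sum_nonneg)
  have slope: "integral cube (\<lambda>x. e' (x, s)) \<le> 2 * E s + G s" if s: "s \<in> {0..\<tau>}" for s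
  proof -
    have int: "continuous_on S f \<Longrightarrow> (\<lambda>x. f (x, s)) integrable_on cube" for f :: "(real ^ 'd) \<times> real \<Rightarrow> real"
      unfolding S by (rule integrable_slice[OF _ s])
    have div: "integral cube (\<lambda>x. D k (\<phi> k) (x, s)) = integral cube (\<lambda>x. J k (x, s))" for k
    proof -
      have "integral cube (\<lambda>x. D k (\<phi> k) (x, s))
          = integral cube (\<lambda>x. \<phi> k (set_coord k 1 x, s) - \<phi> k (set_coord k 0 x, s))"
      proof (rule integral_partial_cube[where w = "\<lambda>x. \<phi> k (x, s)"])
        show "continuous_on cube (\<lambda>x. D k (\<phi> k) (x, s))"
          using continuous_on_slice[OF cD(1)[OF \<phi>1, unfolded S]] s by (simp add: S)
        show "((\<lambda>y. \<phi> k (set_coord k y x, s)) has_real_derivative D k (\<phi> k) (set_coord k y x, s))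
            (at y within {0..1})" if "x \<in> cube" "y \<in> {0..1}" for x y
        proof -
          have eq: "y *\<^sub>R (axis k 1, 0) + (set_coord k 0 x, s) = (set_coord k y x, s)" for y
            using set_coord_eq[of k y x] by simp
          have "y \<in> {0..1} \<Longrightarrow> y *\<^sub>R (axis k 1, 0) + (set_coord k 0 x, s) \<in> S" for y
            unfolding eq using s that(1) by (auto simp: S intro: set_coord_in_cube)
          from has_real_derivative_along[OF \<phi>1 _ this that(2)] show ?thesis
            unfolding eq D_def by simp
        qed
      qed
      then show ?thesis by (simp add: J_def flux_jump_def \<phi>_def)
    qed
    have "integral cube (\<lambda>x. e' (x, s)) \<le> integral cube (\<lambda>x. 2 * e (x, s) + R (x, s) + 2 * (\<Sum>k\<in>UNIV. D k (\<phi> k) (x, s)))"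
      using s pointwise by (intro integral_le integrable_add integrable_on_mult_right integrable_sum
          int ce ce' cR cD \<phi>1) (auto simp: S)
    also have "\<dots> = 2 * E s + integral cube (\<lambda>x. R (x, s)) + 2 * (\<Sum>k\<in>UNIV. integral cube (\<lambda>x. D k (\<phi> k) (x, s)))"
      unfolding E_def
      by (subst integral_add integral_mult_right integral_sum;
          (intro integrable_add integrable_on_mult_right integrable_sum int ce cR cD \<phi>1 finite refl)?)+
    also have "\<dots> \<le> 2 * E s + G s"
    proof -
      have "integral cube (\<lambda>x. J k (x, s)) \<le> integral cube (\<lambda>x. \<bar>J k (x, s)\<bar>)" for k
        by (intro integral_le int cJ cJ_abs) simp
      then show ?thesis unfolding G_def div by (simp add: sum_mono)
    qed
    finally show ?thesis .
  qed
  have sub: "{a..r} \<subseteq> {0..\<tau>}" if "r \<le> b" for r using ab that by auto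
  have intE: "E integrable_on {a..r}" "G integrable_on {a..r}" if "r \<le> b" for r
    using continuous_on_subset[OF cE sub[OF that]] continuous_on_subset[OF cG sub[OF that]]
    by (auto intro: integrable_continuous_real)
  have growth: "E r \<le> (E a + integral {a..b} G) + 2 * integral {a..r} E" if r: "r \<in> {a..b}" for r
  proof -
    have rb: "r \<le> b" using r by simp
    have c: "continuous_on (cube \<times> {a..r}) e'"
      using sub[OF rb] by (intro continuous_on_subset[OF ce']) (auto simp: S)
    have "E r - E a = integral cube (\<lambda>x. e (x, r) - e (x, a))"
      unfolding E_def using ce r ab
      by (intro integral_diff[symmetric] integrable_slice[of "{0..\<tau>}"]) (auto simp: S)
    also have "\<dots> = integral cube (\<lambda>x. integral {a..r} (\<lambda>s. e' (x, s)))"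
    proof (rule integral_cong)
      fix x :: "real ^ 'd" assume x: "x \<in> cube"
      have "((\<lambda>s. e' (x, s)) has_integral (e (x, r) - e (x, a))) {a..r}"
      proof (rule fundamental_theorem_of_calculus)
        fix s assume s: "s \<in> {a..r}"
        have "((\<lambda>s. e (x, s)) has_real_derivative e' (x, s)) (at s within {a..r})"
          using s sub[OF rb] by (intro DERIV_subset[OF e_dir[OF x] sub[OF rb]]) auto
        then show "((\<lambda>s. e (x, s)) has_vector_derivative e' (x, s)) (at s within {a..r})"
          by (simp add: has_real_derivative_iff_has_vector_derivative)
      qed (use r in simp)
      then show "e (x, r) - e (x, a) = integral {a..r} (\<lambda>s. e' (x, s))"
        by (simp add: integral_unique)
    qed
    also have "\<dots> = integral {a..r} (\<lambda>s. integral cube (\<lambda>x. e' (x, s)))"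
      by (rule integral_cylinder(2)[OF c])
    also have "\<dots> \<le> integral {a..r} (\<lambda>s. 2 * E s + G s)"
      using slope sub[OF rb] continuous_on_slice_integral[OF c]
      by (intro integral_le integrable_add integrable_on_mult_right intE rb integrable_continuous_real) auto
    also have "\<dots> = 2 * integral {a..r} E + integral {a..r} G"
      by (subst integral_add) (auto intro: intE[OF rb] integrable_on_mult_right)
    also have "integral {a..r} G \<le> integral {a..b} G"
      using r ab by (intro integral_subset_le intE) (auto intro: G_nonneg)
    finally show ?thesis by simp
  qed
  have "E t \<le> (E a + integral {a..b} G) * exp (2 * (t - a))"
    using sub[of b] growth by (intro gronwall[OF continuous_on_subset[OF cE] _ _ t]) auto
  also have "integral {a..b} G = integral (cube \<times> {a..b}) R + 2 * (\<Sum>k\<in>UNIV. integral (cube \<times> {a..b}) (\<lambda>z. \<bar>J k z\<bar>))"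
  proof -
    have cR': "continuous_on (cube \<times> {a..b}) R" and cJ': "continuous_on (cube \<times> {a..b}) (\<lambda>z. \<bar>J k z\<bar>)" for k
      using sub[of b] by (auto intro!: continuous_on_subset[OF cR] continuous_on_subset[OF cJ_abs] simp: S)
    have "integral {a..b} G = integral {a..b} (\<lambda>s. integral cube (\<lambda>x. R (x, s)))
        + 2 * (\<Sum>k\<in>UNIV. integral {a..b} (\<lambda>s. integral cube (\<lambda>x. \<bar>J k (x, s)\<bar>)))"
      unfolding G_def
      by (subst integral_add integral_mult_right integral_sum;
          (intro integrable_on_mult_right integrable_sum integrable_continuous_real
            continuous_on_slice_integral cR' cJ' finite refl)?)+
    then show ?thesis by (simp only: integral_cylinder(1)[OF cR'] integral_cylinder(1)[OF cJ'])
  qed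
  finally show ?thesis
    unfolding E by (simp add: R_def[abs_def] J_def norm_grad_sq D_def add.assoc)
qed

section \<open>Quadrature sums, powers and sup norms\<close>

lemma finite_space_nodes: "finite (space_nodes N :: (real ^ 'd) set)"
proof -
  let ?A = "(\<lambda>m. (real m + 1/2) / real N) ` {..<N}"
  have "x \<in> vec_lambda ` (UNIV \<rightarrow>\<^sub>E ?A)" if "x \<in> space_nodes N" for x :: "real ^ 'd"
    using that by (intro image_eqI[of x vec_lambda "vec_nth x"]) (auto simp: space_nodes_def)
  moreover have "finite (vec_lambda ` ((UNIV :: 'd set) \<rightarrow>\<^sub>E ?A))"
    by (intro finite_imageI finite_PiE) auto
  ultimately show ?thesis by (meson finite_subset subsetI)
qed

lemma space_nodes_nonempty:
  assumes "1 \<le> N"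
  shows "space_nodes N \<noteq> ({} :: (real ^ 'd) set)"
proof -
  have "(\<chi> k. (real 0 + 1/2) / real N) \<in> space_nodes N"
    using assms by (auto simp: space_nodes_def intro!: exI[of _ 0])
  then show ?thesis by blast
qed

lemma finite_time_nodes: "finite (time_nodes a h N)"
  by (simp add: time_nodes_def)

lemma time_nodes_nonempty:
  assumes "1 \<le> N" "0 < h"
  shows "time_nodes a h N \<noteq> {}"
proof -
  have "0 < real N * h" using assms by simp
  then show ?thesis by (simp add: time_nodes_def time_cells_def lessThan_empty_iff not_le)
qed

lemma card_space_nodes_pos: "1 \<le> N \<Longrightarrow> 0 < card (space_nodes N :: (real ^ 'd) set)"
  by (simp add: card_gt_0_iff finite_space_nodes space_nodes_nonempty)

lemma card_block_nodes_pos: "1 \<le> N \<Longrightarrow> 0 < time_step P \<Longrightarrow> 0 < card (block_nodes P j N)"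
  by (simp add: card_gt_0_iff block_nodes_def finite_space_nodes space_nodes_nonempty
      finite_time_nodes time_nodes_nonempty)

lemma card_lateral_nodes_pos:
  assumes "1 \<le> N" "0 < time_step P"
  shows "0 < card (lateral_nodes P j N)"
  unfolding card_gt_0_iff
proof
  show "lateral_nodes P j N \<noteq> {}"
    using space_nodes_nonempty[OF assms(1)] time_nodes_nonempty[OF assms, of "time P (j - 1)"]
    by (auto simp: lateral_nodes_def)
  show "finite (lateral_nodes P j N)"
    unfolding lateral_nodes_def
    by (intro finite_SigmaI finite_cartesian_product finite_imageI finite_space_nodes finite_time_nodes finite)
qed

lemma quadrature_nonneg: "0 \<le> vol \<Longrightarrow> (\<And>z. z \<in> Z \<Longrightarrow> 0 \<le> g z) \<Longrightarrow> 0 \<le> quadrature vol Z g"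
  unfolding quadrature_def by (intro sum_nonneg mult_nonneg_nonneg) auto

lemma Q_D_nonneg: "(\<And>x. 0 \<le> g x) \<Longrightarrow> 0 \<le> Q_D N g"
  unfolding Q_D_def by (rule quadrature_nonneg) auto

lemma Q_int_nonneg: "0 \<le> time_step P \<Longrightarrow> (\<And>z. 0 \<le> g z) \<Longrightarrow> 0 \<le> Q_int P j N g"
  unfolding Q_int_def by (rule quadrature_nonneg) auto

lemma Q_sb_nonneg: "0 \<le> time_step P \<Longrightarrow> (\<And>F z. 0 \<le> g F z) \<Longrightarrow> 0 \<le> Q_sb P j N g"
  unfolding Q_sb_def by (rule quadrature_nonneg) (auto simp: boundary_area_def)

lemma powr_le_same_order:
  assumes "same_order \<kappa> M n" "j \<in> {1..n}" "0 < M j" "0 < M n" "0 \<le> a"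
  shows "M j powr (- a) \<le> \<kappa> powr a * M n powr (- a)"
proof -
  have le: "M n \<le> \<kappa> * M j" using assms(1,2) by (auto simp: same_order_def)
  with assms(3,4) have "0 < \<kappa> * M j" by linarith
  then have \<kappa>: "0 < \<kappa>" using assms(3) by (simp add: zero_less_mult_iff)
  have "(\<kappa> * M j) powr (- a) \<le> M n powr (- a)"
    using le assms(4,5) by (intro powr_mono2') auto
  then have "\<kappa> powr a * (\<kappa> powr (- a) * M j powr (- a)) \<le> \<kappa> powr a * M n powr (- a)"
    using \<kappa> assms(3) by (intro mult_left_mono) (simp_all add: powr_mult)
  moreover have "\<kappa> powr a * \<kappa> powr (- a) = 1"
    using \<kappa> by (simp flip: powr_add)
  ultimately show ?thesis by (simp add: mult.assoc[symmetric])
qed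

lemma sup_norm_upper:
  assumes "compact A" "continuous_on A g" "z \<in> A"
  shows "\<bar>g z\<bar> \<le> sup_norm A g"
proof -
  have "compact ((\<lambda>z. \<bar>g z\<bar>) ` A)"
    using assms by (intro compact_continuous_image continuous_intros)
  then show ?thesis
    unfolding sup_norm_def using assms(3)
    by (intro cSUP_upper) (auto intro: bounded_imp_bdd_above compact_imp_bounded)
qed

section \<open>The residuals of a network approximation\<close>

text \<open>The hypotheses of the error estimate, for the blocks up to \<open>n\<close>.\<close>

locale pinn_approximation =
  fixes P :: "('d::finite) pinn_data" and n :: nat
  assumes T_pos: "0 < final_time P" and blocks_pos: "1 \<le> blocks P" and n_le: "n \<le> blocks P"
    and sol: "classical_solution P"
    and reg_u: "Ck_on 4 (slab P n) (sol_u P)" and reg_v: "Ck_on 3 (slab P n) (sol_v P)"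
    and nets: "\<And>j. j \<in> {1..n} \<Longrightarrow> hlconc_pinn (CARD('d) + 1) 1 (theta_u P j)"
      "\<And>j. j \<in> {1..n} \<Longrightarrow> hlconc_pinn (CARD('d) + 1) 1 (theta_v P j)"
    and nodes: "\<And>j. j \<in> {1..n} \<Longrightarrow> 1 \<le> N_int P j" "\<And>j. j \<in> {1..n} \<Longrightarrow> 1 \<le> N_tb P j"
      "\<And>j. j \<in> {1..n} \<Longrightarrow> 1 \<le> N_sb P j"
    and quad_D: "quad_const_D P"
    and quad_int: "\<And>j. j \<in> {1..n} \<Longrightarrow> quad_const_int P j"
    and quad_sb: "\<And>j. j \<in> {1..n} \<Longrightarrow> quad_const_sb P j"
begin

abbreviation "h \<equiv> time_step P"

text \<open>The domain of the exact solution.\<close>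

abbreviation "full \<equiv> cube \<times> {0..final_time P}"

lemma h_pos: "0 < h"
  using T_pos blocks_pos by (simp add: time_step_def)

lemma time_mono: "j \<le> k \<Longrightarrow> time P j \<le> time P k"
  using h_pos by (simp add: time_def)

lemma time_nonneg: "0 \<le> time P j"
  using h_pos by (simp add: time_def)

lemma time_pos: "1 \<le> j \<Longrightarrow> 0 < time P j"
  using h_pos by (simp add: time_def)

lemma time_pred: "1 \<le> j \<Longrightarrow> time P j = time P (j - 1) + h"
  by (simp add: time_def of_nat_diff algebra_simps)

lemma time_le_final: "j \<le> n \<Longrightarrow> time P j \<le> final_time P"
proof -
  assume "j \<le> n"
  then have "time P j \<le> time P (blocks P)" using n_le by (intro time_mono) simp
  also have "\<dots> = final_time P" using blocks_pos by (simp add: time_def time_step_def)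
  finally show ?thesis .
qed

lemma slab_subset_full: "j \<le> n \<Longrightarrow> slab P j \<subseteq> full"
  using time_le_final[of j] by (auto simp: slab_def)

lemma block_subset_slab: "time_block P j \<subseteq> slab P j"
  using time_nonneg[of "j - 1"] by (auto simp: time_block_def slab_def)

lemma unique_slab: "1 \<le> j \<Longrightarrow> unique_derivatives (slab P j)"
  unfolding slab_def by (intro unique_derivatives_cylinder time_pos)

lemma unique_block: "1 \<le> j \<Longrightarrow> unique_derivatives (time_block P j)"
  unfolding time_block_def using h_pos by (intro unique_derivatives_cylinder) (simp add: time_pred[of j])

lemma Ck_on_block: "1 \<le> j \<Longrightarrow> Ck_on k (slab P j) g \<Longrightarrow> Ck_on k (time_block P j) g"
  by (rule Ck_on_subset[OF unique_block block_subset_slab])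

lemma Ck_on_u: "j \<in> {1..n} \<Longrightarrow> Ck_on 4 (slab P j) (sol_u P)"
  using time_mono[of j n] by (intro Ck_on_subset[OF unique_slab _ reg_u]) (auto simp: slab_def)

lemma Ck_on_v: "j \<in> {1..n} \<Longrightarrow> Ck_on 3 (slab P j) (sol_v P)"
  using time_mono[of j n] by (intro Ck_on_subset[OF unique_slab _ reg_v]) (auto simp: slab_def)

lemma Ck_on_u_net: "unique_derivatives S \<Longrightarrow> j \<in> {1..n} \<Longrightarrow> Ck_on k S (u_net P j)"
  unfolding u_net_def by (rule Ck_on_net_fun[OF _ nets(1)])

lemma Ck_on_v_net: "unique_derivatives S \<Longrightarrow> j \<in> {1..n} \<Longrightarrow> Ck_on k S (v_net P j)"
  unfolding v_net_def by (rule Ck_on_net_fun[OF _ nets(2)])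

lemma Ck_on_err_u: "j \<in> {1..n} \<Longrightarrow> Ck_on 4 (slab P j) (err_u P j)"
  unfolding err_u_def[abs_def] by (intro Ck_on_diff Ck_on_u Ck_on_u_net unique_slab) auto

lemma Ck_on_err_v: "j \<in> {1..n} \<Longrightarrow> Ck_on 3 (slab P j) (err_v P j)"
  unfolding err_v_def[abs_def] by (intro Ck_on_diff Ck_on_v Ck_on_v_net unique_slab) auto

lemma Ck_on_laplacian:
  assumes "unique_derivatives S" "Ck_on (Suc (Suc k)) S g"
  shows "Ck_on k S (laplacian S g)"
  unfolding laplacian_def[abs_def]
  by (intro Ck_on_sum assms(1) Ck_on_partial[OF Ck_on_partial[OF assms(2)]]) auto

lemma partial_full:
  assumes "j \<in> {1..n}" "Ck_on k full g" "0 < k" "z \<in> slab P j"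
  shows "partial (slab P j) b g z = partial full b g z"
  using assms by (intro partial_subset[OF unique_slab slab_subset_full]) auto

lemma Ck_on_full_u: "Ck_on 2 full (sol_u P)" and Ck_on_full_v: "Ck_on 1 full (sol_v P)"
  using sol by (auto simp: classical_solution_def Let_def)

text \<open>
  The solution satisfies its equations with derivatives within the full time interval, the residuals
  use derivatives within the slab. The two agree on the slab by uniqueness of the derivative.
\<close>

lemma first_equation:
  assumes "j \<in> {1..n}" "z \<in> slab P j"
  shows "dtime (slab P j) (sol_u P) z = sol_v P z"
  using sol slab_subset_full[of j] assms partial_full[OF assms(1) Ck_on_full_u _ assms(2)]
  by (auto simp: classical_solution_def Let_def dtime_def)

lemma second_equation:
  assumes j: "j \<in> {1..n}" and z: "z \<in> slab P j"
  shows "dtime (slab P j) (sol_v P) z - laplacian (slab P j) (sol_u P) z = source P z"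
proof -
  have "partial (slab P j) (axis k 1, 0) (partial (slab P j) (axis k 1, 0) (sol_u P)) z
      = partial full (axis k 1, 0) (partial full (axis k 1, 0) (sol_u P)) z" for k
  proof -
    have "partial (slab P j) (axis k 1, 0) (partial (slab P j) (axis k 1, 0) (sol_u P)) z
      = partial (slab P j) (axis k 1, 0) (partial full (axis k 1, 0) (sol_u P)) z"
      using partial_full[OF j Ck_on_full_u] by (intro partial_cong z) auto
    also have "\<dots> = partial full (axis k 1, 0) (partial full (axis k 1, 0) (sol_u P)) z"
      using Ck_on_full_u by (intro partial_full[OF j _ _ z, of 1]) (auto simp: numeral_2_eq_2)
    finally show ?thesis .
  qed
  then show ?thesis
    using sol slab_subset_full[of j] j z partial_full[OF j Ck_on_full_v _ z]
    by (auto simp: classical_solution_def Let_def dtime_def laplacian_def)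
qed

text \<open>
  The regularity of the source, which the quadrature of the second residual needs, is inherited from
  the solution.
\<close>

lemma Ck_on_source: "j \<in> {1..n} \<Longrightarrow> Ck_on 2 (slab P j) (source P)"
proof -
  assume j: "j \<in> {1..n}"
  then have uS: "unique_derivatives (slab P j)" by (intro unique_slab) auto
  have uv: "Ck_on (Suc (Suc 2)) (slab P j) (sol_u P)" "Ck_on (Suc 2) (slab P j) (sol_v P)"
    using Ck_on_u[OF j] Ck_on_v[OF j] by (simp_all del: Ck_on.simps)
  have "Ck_on 2 (slab P j) (\<lambda>z. dtime (slab P j) (sol_v P) z - laplacian (slab P j) (sol_u P) z)"
    unfolding dtime_def[abs_def]
    by (intro Ck_on_diff Ck_on_laplacian Ck_on_partial uS uv time_in_Basis_prod)
  then show ?thesis by (subst Ck_on_cong[OF second_equation[OF j, symmetric]])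
qed

lemma Ck_on_R_int1:
  assumes "j \<in> {1..n}"
  shows "Ck_on k (slab P j) (R_int1 P j)"
proof -
  have uS: "unique_derivatives (slab P j)" using assms by (intro unique_slab) auto
  show ?thesis
    unfolding R_int1_def[abs_def] dtime_def[abs_def]
    by (intro Ck_on_diff Ck_on_partial Ck_on_u_net Ck_on_v_net uS assms time_in_Basis_prod)
qed

lemma Ck_on_R_int2:
  assumes "j \<in> {1..n}"
  shows "Ck_on 2 (slab P j) (R_int2 P j)"
proof -
  have uS: "unique_derivatives (slab P j)" using assms by (intro unique_slab) auto
  show ?thesis
    unfolding R_int2_def[abs_def] dtime_def[abs_def]
    by (intro Ck_on_diff Ck_on_partial Ck_on_laplacian Ck_on_u_net Ck_on_v_net Ck_on_source uS assms
        time_in_Basis_prod)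
qed

text \<open>The errors solve the wave system with the interior residuals as source terms.\<close>

lemma R_int1_eq:
  assumes j: "j \<in> {1..n}" and z: "z \<in> slab P j"
  shows "R_int1 P j z = dtime (slab P j) (err_u P j) z - err_v P j z"
proof -
  have uS: "unique_derivatives (slab P j)" using j by (intro unique_slab) auto
  have "dtime (slab P j) (err_u P j) z = dtime (slab P j) (u_net P j) z - dtime (slab P j) (sol_u P) z"
    unfolding dtime_def err_u_def[abs_def] by (rule partial_diff[OF uS Ck_on_u_net[OF uS j] Ck_on_u[OF j] _ z]) simp
  then show ?thesis by (simp add: R_int1_def err_v_def first_equation[OF j z])
qed

lemma R_int2_eq:
  assumes j: "j \<in> {1..n}" and z: "z \<in> slab P j"
  shows "R_int2 P j z = dtime (slab P j) (err_v P j) z - laplacian (slab P j) (err_u P j) z"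
proof -
  let ?S = "slab P j"
  have uS: "unique_derivatives ?S" using j by (intro unique_slab) auto
  have "dtime ?S (err_v P j) z = dtime ?S (v_net P j) z - dtime ?S (sol_v P) z"
    unfolding dtime_def err_v_def[abs_def] by (rule partial_diff[OF uS Ck_on_v_net[OF uS j] Ck_on_v[OF j] _ z]) simp
  moreover have "laplacian ?S (err_u P j) z = laplacian ?S (u_net P j) z - laplacian ?S (sol_u P) z"
  proof -
    have "partial ?S (axis k 1, 0) (partial ?S (axis k 1, 0) (err_u P j)) z
        = partial ?S (axis k 1, 0) (partial ?S (axis k 1, 0) (u_net P j)) z
          - partial ?S (axis k 1, 0) (partial ?S (axis k 1, 0) (sol_u P)) z" for k
    proof -
      have C: "Ck_on 1 ?S (partial ?S (axis k 1, 0) (u_net P j))" "Ck_on 1 ?S (partial ?S (axis k 1, 0) (sol_u P))"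
        using Ck_on_mono[OF Ck_on_u[OF j], of 2] Ck_on_u_net[OF uS j, of 2]
        by (auto simp: numeral_2_eq_2)
      have "partial ?S (axis k 1, 0) (partial ?S (axis k 1, 0) (err_u P j)) z
        = partial ?S (axis k 1, 0) (\<lambda>z. partial ?S (axis k 1, 0) (u_net P j) z - partial ?S (axis k 1, 0) (sol_u P) z) z"
        unfolding err_u_def[abs_def]
        by (intro partial_cong z) (rule partial_diff[OF uS Ck_on_u_net[OF uS j] Ck_on_u[OF j]]; simp)
      also have "\<dots> = partial ?S (axis k 1, 0) (partial ?S (axis k 1, 0) (u_net P j)) z
          - partial ?S (axis k 1, 0) (partial ?S (axis k 1, 0) (sol_u P)) z"
        by (rule partial_diff[OF uS C _ z]) simp
      finally show ?thesis .
    qed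
    then show ?thesis by (simp add: laplacian_def sum_subtractf)
  qed
  ultimately show ?thesis
    using second_equation[OF j z] by (simp add: R_int2_def)
qed

section \<open>Regularity of the quadrature integrands\<close>

lemma Ck_on_sq_int:
  assumes j: "j \<in> {1..n}"
  shows "Ck_on 2 (time_block P j) (sq_int1 P j)" "Ck_on 2 (time_block P j) (sq_int2 P j)"
    "Ck_on 2 (time_block P j) (sq_grad_int1 P j)"
proof -
  have uS: "unique_derivatives (slab P j)" and j1: "1 \<le> j" using j by (auto intro: unique_slab)
  show "Ck_on 2 (time_block P j) (sq_int1 P j)"
    unfolding sq_int1_def[abs_def] by (intro Ck_on_block j1 Ck_on_power2 uS Ck_on_R_int1 j)
  show "Ck_on 2 (time_block P j) (sq_int2 P j)"
    unfolding sq_int2_def[abs_def] by (intro Ck_on_block j1 Ck_on_power2 uS Ck_on_R_int2 j)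
  show "Ck_on 2 (time_block P j) (sq_grad_int1 P j)"
    unfolding sq_grad_int1_def[abs_def] norm_grad_sq
    by (intro Ck_on_block j1 Ck_on_sum Ck_on_power2 uS Ck_on_partial Ck_on_R_int1 j axis_in_Basis_prod)
qed

lemma Ck_on_u_start:
  assumes "j < n"
  shows "Ck_on 3 cube (u_start P j)"
proof (cases "j = 0")
  case True
  have 1: "1 \<in> {1..n}" using assms by simp
  have "Ck_on 3 cube (\<lambda>x. sol_u P (x, 0))"
    using Ck_on_mono[OF Ck_on_u[OF 1], of 3] time_nonneg[of 1] unfolding slab_def
    by (intro Ck_on_slice) auto
  moreover have "sol_u P (x, 0) = u_start P j x" if "x \<in> cube" for x
    using sol that True by (auto simp: classical_solution_def Let_def u_start_def)
  ultimately show ?thesis by (simp cong: Ck_on_cong)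
next
  case False
  then have j: "j \<in> {1..n}" using assms by auto
  have "Ck_on 3 cube (\<lambda>x. u_net P j (x, time P j))"
    using Ck_on_u_net[OF unique_slab j, of j 3] j time_nonneg[of j] unfolding slab_def
    by (intro Ck_on_slice) auto
  with False show ?thesis by (simp add: u_start_def[abs_def])
qed

lemma Ck_on_v_start:
  assumes "j < n"
  shows "Ck_on 3 cube (v_start P j)"
proof (cases "j = 0")
  case True
  have 1: "1 \<in> {1..n}" using assms by simp
  have "Ck_on 3 cube (\<lambda>x. sol_v P (x, 0))"
    using Ck_on_v[OF 1] time_nonneg[of 1] unfolding slab_def
    by (intro Ck_on_slice) auto
  moreover have "sol_v P (x, 0) = v_start P j x" if "x \<in> cube" for x
    using sol that True by (auto simp: classical_solution_def Let_def v_start_def)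
  ultimately show ?thesis by (simp cong: Ck_on_cong)
next
  case False
  then have j: "j \<in> {1..n}" using assms by auto
  have "Ck_on 3 cube (\<lambda>x. v_net P j (x, time P j))"
    using Ck_on_v_net[OF unique_slab j, of j 3] j time_nonneg[of j] unfolding slab_def
    by (intro Ck_on_slice) auto
  with False show ?thesis by (simp add: v_start_def[abs_def])
qed

lemma Ck_on_R_tb:
  assumes j: "j \<in> {1..n}" and k: "k \<in> {1..j}"
  shows "Ck_on 3 cube (R_tb1 P j k)" "Ck_on 3 cube (R_tb2 P j k)"
proof -
  have uS: "unique_derivatives (slab P j)" using j by (auto intro: unique_slab)
  have t: "time P (k - 1) \<in> {0..time P j}"
    using time_nonneg time_mono[of "k - 1" j] k by auto
  have "Ck_on 3 cube (\<lambda>x. u_net P j (x, time P (k - 1)))" "Ck_on 3 cube (\<lambda>x. v_net P j (x, time P (k - 1)))"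
    using Ck_on_u_net[OF uS j, of 3] Ck_on_v_net[OF uS j, of 3] t unfolding slab_def
    by (auto intro: Ck_on_slice)
  then show "Ck_on 3 cube (R_tb1 P j k)" "Ck_on 3 cube (R_tb2 P j k)"
    unfolding R_tb1_def[abs_def] R_tb2_def[abs_def] using j k
    by (intro Ck_on_diff unique_derivatives_cube Ck_on_u_start Ck_on_v_start; auto)+
qed

lemma Ck_on_sq_tb:
  assumes j: "j \<in> {1..n}" and k: "k \<in> {1..j}"
  shows "Ck_on 2 cube (sq_tb1 P j k)" "Ck_on 2 cube (sq_tb2 P j k)" "Ck_on 2 cube (sq_grad_tb1 P j k)"
proof -
  note R = Ck_on_R_tb[OF assms]
  show "Ck_on 2 cube (sq_tb1 P j k)" "Ck_on 2 cube (sq_tb2 P j k)"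
    unfolding sq_tb1_def[abs_def] sq_tb2_def[abs_def]
    by (intro Ck_on_power2 unique_derivatives_cube Ck_on_mono[OF R(1)] Ck_on_mono[OF R(2)]; simp)+
  have "Ck_on (Suc 2) cube (R_tb1 P j k)" using R(1) by (simp del: Ck_on.simps)
  then show "Ck_on 2 cube (sq_grad_tb1 P j k)"
    unfolding sq_grad_tb1_def[abs_def] norm_grad_space_sq
    by (intro Ck_on_sum Ck_on_power2 Ck_on_partial unique_derivatives_cube axis_in_Basis_vec)
qed

lemma to_face_eq: "to_face F x = set_coord (fst F) (face_value F) x"
  by (simp add: to_face_def set_coord_def)

lemma opposite_eq: "opposite F (to_face F x) = set_coord (fst F) (1 - face_value F) x"
  by (auto simp: vec_eq_iff opposite_def to_face_def)

lemma face_value_range: "face_value F \<in> {0..1}" "1 - face_value F \<in> {0..1}"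
  by (auto simp: face_value_def)

text \<open>
  On a face the boundary residuals are differences of the values at coordinates 0 and 1, hence as
  smooth as the networks.
\<close>

lemma pull_face_R_sb:
  "pull_face (R_sb1 P j) F z
    = v_net P j (set_coord (fst F) (face_value F) (fst z), snd z)
      - v_net P j (set_coord (fst F) (1 - face_value F) (fst z), snd z)"
  "R_sb2 P j F (to_face F (fst z), snd z)
    = grad (slab P j) (u_net P j) (set_coord (fst F) (face_value F) (fst z), snd z)
      - grad (slab P j) (u_net P j) (set_coord (fst F) (1 - face_value F) (fst z), snd z)"
  by (simp_all add: pull_face_def R_sb1_def R_sb2_def opposite_eq) (simp_all add: to_face_eq)

lemma Ck_on_block_face:
  assumes "1 \<le> j" "Ck_on m (slab P j) g" "s \<in> {0..1}"
  shows "Ck_on m (time_block P j) (\<lambda>z. g (set_coord k s (fst z), snd z))"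
  using unique_block[OF assms(1)] assms(2) time_nonneg[of "j - 1"] unfolding time_block_def slab_def
  by (intro Ck_on_set_coord assms(3)) auto

lemma Ck_on_pull_face_R_sb1:
  assumes j: "j \<in> {1..n}"
  shows "Ck_on m (time_block P j) (pull_face (R_sb1 P j) F)"
proof -
  have "1 \<le> j" using j by simp
  then show ?thesis
    unfolding pull_face_R_sb
    by (intro Ck_on_diff Ck_on_block_face unique_block Ck_on_v_net unique_slab face_value_range j)
qed

lemma Ck_on_pull_face_R_sb2:
  assumes j: "j \<in> {1..n}"
  shows "Ck_on m (time_block P j) (\<lambda>z. R_sb2 P j F (to_face F (fst z), snd z) $ k)"
proof -
  have j1: "1 \<le> j" using j by simp
  have "Ck_on m (slab P j) (partial (slab P j) (axis k 1, 0) (u_net P j))"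
    by (intro Ck_on_partial Ck_on_u_net unique_slab j1 j axis_in_Basis_prod)
  then show ?thesis
    unfolding pull_face_R_sb
    by (simp add: grad_def) (intro Ck_on_diff unique_block Ck_on_block_face j1 face_value_range)
qed

lemma Ck_on_sq_sb:
  assumes j: "j \<in> {1..n}"
  shows "Ck_on 2 (time_block P j) (pull_face (sq_sb1 P j) F)"
    "Ck_on 2 (time_block P j) (pull_face (sq_sb2 P j) F)"
proof -
  have uB: "unique_derivatives (time_block P j)" using j by (auto intro: unique_block)
  have "pull_face (sq_sb1 P j) F = (\<lambda>z. (pull_face (R_sb1 P j) F z)\<^sup>2)"
    by (simp add: fun_eq_iff pull_face_def sq_sb1_def)
  then show "Ck_on 2 (time_block P j) (pull_face (sq_sb1 P j) F)"
    by (simp only: Ck_on_power2[OF uB Ck_on_pull_face_R_sb1[OF j]])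
  have "pull_face (sq_sb2 P j) F = (\<lambda>z. \<Sum>k\<in>UNIV. (R_sb2 P j F (to_face F (fst z), snd z) $ k)\<^sup>2)"
    by (simp add: fun_eq_iff pull_face_def sq_sb2_def power2_norm_eq_inner inner_vec_def)
      (simp add: power2_eq_square)
  then show "Ck_on 2 (time_block P j) (pull_face (sq_sb2 P j) F)"
    by (simp only: Ck_on_sum[OF uB Ck_on_power2[OF uB Ck_on_pull_face_R_sb2[OF j]]])
qed

section \<open>The error estimate on one block\<close>

text \<open>
  Each integral of a squared residual is at most the error bound of its quadrature plus the quadrature
  itself. The constants are nonnegative because the numbers of nodes are positive.
\<close>

lemma M_pos:
  assumes "j \<in> {1..n}"
  shows "0 < M_int P j" "0 < M_tb P j" "0 < M_sb P j"
  using assms nodes h_pos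
  by (simp_all add: M_int_def M_tb_def M_sb_def card_block_nodes_pos card_space_nodes_pos card_lateral_nodes_pos)

lemma quad_D_bound:
  assumes j: "j \<in> {1..n}" and g: "Ck_on 2 cube g"
  shows "0 \<le> const_D P g"
    and "integral cube g \<le> const_D P g * M_tb P j powr (- 2 / real CARD('d)) + Q_D (N_tb P j) g"
proof -
  have *: "\<bar>integral cube g - Q_D (N_tb P j) g\<bar> \<le> const_D P g * M_tb P j powr (- 2 / real CARD('d))"
    using quad_D g nodes(2)[OF j] unfolding quad_const_D_def M_tb_def by blast
  then show "integral cube g \<le> const_D P g * M_tb P j powr (- 2 / real CARD('d)) + Q_D (N_tb P j) g"
    by linarith
  have "0 \<le> const_D P g * M_tb P j powr (- 2 / real CARD('d))" using * by linarith
  moreover have "0 < M_tb P j powr (- 2 / real CARD('d))" using M_pos[OF j] by simp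
  ultimately show "0 \<le> const_D P g" by (simp add: zero_le_mult_iff)
qed

lemma quad_int_bound:
  assumes j: "j \<in> {1..n}" and g: "Ck_on 2 (time_block P j) g"
  shows "0 \<le> const_int P j g"
    and "integral (time_block P j) g
      \<le> const_int P j g * M_int P j powr (- 2 / (real CARD('d) + 1)) + Q_int P j (N_int P j) g"
proof -
  have *: "\<bar>integral (time_block P j) g - Q_int P j (N_int P j) g\<bar>
      \<le> const_int P j g * M_int P j powr (- 2 / (real CARD('d) + 1))"
    using quad_int[OF j] g nodes(1)[OF j] unfolding quad_const_int_def M_int_def by blast
  then show "integral (time_block P j) g
      \<le> const_int P j g * M_int P j powr (- 2 / (real CARD('d) + 1)) + Q_int P j (N_int P j) g"
    by linarith
  have "0 \<le> const_int P j g * M_int P j powr (- 2 / (real CARD('d) + 1))" using * by linarith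
  moreover have "0 < M_int P j powr (- 2 / (real CARD('d) + 1))" using M_pos[OF j] by simp
  ultimately show "0 \<le> const_int P j g" by (simp add: zero_le_mult_iff)
qed

lemma quad_sb_bound:
  assumes j: "j \<in> {1..n}" and g: "\<And>F. Ck_on 2 (time_block P j) (pull_face g F)"
  shows "0 \<le> const_sb P j g"
    and "boundary_integral {time P (j - 1)..time P j} g
      \<le> const_sb P j g * M_sb P j powr (- 2 / real CARD('d)) + Q_sb P j (N_sb P j) g"
proof -
  have *: "\<bar>boundary_integral {time P (j - 1)..time P j} g - Q_sb P j (N_sb P j) g\<bar>
      \<le> const_sb P j g * M_sb P j powr (- 2 / real CARD('d))"
    using quad_sb[OF j] g nodes(3)[OF j] unfolding quad_const_sb_def M_sb_def by blast
  then show "boundary_integral {time P (j - 1)..time P j} g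
      \<le> const_sb P j g * M_sb P j powr (- 2 / real CARD('d)) + Q_sb P j (N_sb P j) g"
    by linarith
  have "0 \<le> const_sb P j g * M_sb P j powr (- 2 / real CARD('d))" using * by linarith
  moreover have "0 < M_sb P j powr (- 2 / real CARD('d))" using M_pos[OF j] by simp
  ultimately show "0 \<le> const_sb P j g" by (simp add: zero_le_mult_iff)
qed

text \<open>
  The first equation transfers the periodicity of \<open>u\<close> to \<open>v\<close>.
\<close>

lemma sol_periodic:
  assumes "x \<in> face_set F" "t \<in> {0..final_time P}"
  shows "sol_v P (x, t) = sol_v P (opposite F x, t)"
    and "grad full (sol_u P) (x, t) = grad full (sol_u P) (opposite F x, t)"
proof -
  have x: "x \<in> cube" "opposite F x \<in> cube"
    using assms(1) by (auto simp: face_set_def mem_cube opposite_def face_value_def)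
  have per: "sol_u P (x, s) = sol_u P (opposite F x, s)" if "s \<in> {0..final_time P}" for s
    using sol assms(1) that by (simp add: classical_solution_def Let_def del: split_paired_All)
  show "grad full (sol_u P) (x, t) = grad full (sol_u P) (opposite F x, t)"
    using sol assms by (simp add: classical_solution_def Let_def del: split_paired_All)
  have v: "sol_v P (y, t) = dtime full (sol_u P) (y, t)" if "y \<in> cube" for y
    using sol that assms(2) by (auto simp: classical_solution_def Let_def)
  have u: "((\<lambda>s. sol_u P (y, s)) has_vector_derivative dtime full (sol_u P) (y, t)) (at t within {0..final_time P})"
    if "y \<in> cube" for y
    using has_real_derivative_dtime[OF Ck_on_full_u _ that assms(2)]
    by (simp add: has_real_derivative_iff_has_vector_derivative)
  have "((\<lambda>s. sol_u P (opposite F x, s)) has_vector_derivative dtime full (sol_u P) (x, t)) (at t within {0..final_time P})"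
    by (rule has_vector_derivative_transform_within[OF u[OF x(1)] zero_less_one assms(2)]) (rule per)
  then have "dtime full (sol_u P) (x, t) = dtime full (sol_u P) (opposite F x, t)"
    using u[OF x(2)] vector_derivative_unique_within_closed_interval[of 0 "final_time P" t] T_pos assms(2)
    by simp
  then show "sol_v P (x, t) = sol_v P (opposite F x, t)"
    by (simp only: v[OF x(1)] v[OF x(2)])
qed

text \<open>
  Since the solution is periodic, the jumps of the error between opposite faces are the boundary
  residuals.
\<close>

lemma err_jumps:
  fixes F :: "'d face"
  assumes j: "j \<in> {1..n}" and x: "x \<in> cube" and t: "t \<in> {0..time P j}"
  defines "y \<equiv> set_coord (fst F) (face_value F) x" and "y' \<equiv> set_coord (fst F) (1 - face_value F) x"
  shows "err_v P j (y, t) - err_v P j (y', t) = pull_face (R_sb1 P j) F (x, t)"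
    and "partial (slab P j) (axis k 1, 0) (err_u P j) (y, t) - partial (slab P j) (axis k 1, 0) (err_u P j) (y', t)
      = R_sb2 P j F (to_face F x, t) $ k"
proof -
  have uS: "unique_derivatives (slab P j)" using j by (auto intro: unique_slab)
  have tT: "t \<in> {0..final_time P}" using t time_le_final[of j] j by auto
  have yc: "y \<in> cube" "y' \<in> cube"
    unfolding y_def y'_def by (intro set_coord_in_cube x face_value_range)+
  have face: "y \<in> face_set F" using yc by (simp add: face_set_def y_def)
  have opp: "opposite F y = y'"
    using opposite_eq[of F x] by (simp add: y_def y'_def to_face_eq)
  show "err_v P j (y, t) - err_v P j (y', t) = pull_face (R_sb1 P j) F (x, t)"
    using sol_periodic(1)[OF face tT] by (simp add: opp err_v_def pull_face_R_sb flip: y_def y'_def)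
  have slab: "(y, t) \<in> slab P j" "(y', t) \<in> slab P j" using yc t by (auto simp: slab_def)
  have "grad full (sol_u P) (y, t) $ k = grad full (sol_u P) (y', t) $ k"
    using sol_periodic(2)[OF face tT] opp by simp
  then have "partial (slab P j) (axis k 1, 0) (sol_u P) (y, t) = partial (slab P j) (axis k 1, 0) (sol_u P) (y', t)"
    using partial_full[OF j Ck_on_full_u _ slab(1)] partial_full[OF j Ck_on_full_u _ slab(2)]
    by (simp add: grad_def)
  moreover have "partial (slab P j) (axis k 1, 0) (err_u P j) z
      = partial (slab P j) (axis k 1, 0) (u_net P j) z - partial (slab P j) (axis k 1, 0) (sol_u P) z"
    if "z \<in> slab P j" for z
    unfolding err_u_def[abs_def] by (rule partial_diff[OF uS Ck_on_u_net[OF uS j] Ck_on_u[OF j] _ that]) simp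
  ultimately show "partial (slab P j) (axis k 1, 0) (err_u P j) (y, t) - partial (slab P j) (axis k 1, 0) (err_u P j) (y', t)
      = R_sb2 P j F (to_face F x, t) $ k"
    using slab pull_face_R_sb(2)[of j F "(x, t)"] by (simp add: grad_def flip: y_def y'_def)
qed

text \<open>The constants \<open>C_bd1\<close> and \<open>C_bd2\<close> without the factor coming from the area of the boundary.\<close>

definition "sup_u j = Ck_norm 1 (slab P j) (lateral_slab P j) (sol_u P)
  + Ck_norm 1 (slab P j) (lateral_slab P j) (u_net P j)"

definition "sup_v j = sup_norm (lateral_slab P j) (sol_v P) + sup_norm (lateral_slab P j) (v_net P j)"

lemma compact_lateral_slab: "compact (lateral_slab P j)" and lateral_slab_subset: "lateral_slab P j \<subseteq> slab P j"
proof -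
  show "compact (lateral_slab P j)"
    unfolding lateral_slab_def cube_def by (intro compact_Times compact_frontier compact_cbox compact_Icc)
  have "closed (cube :: (real ^ 'd) set)" by (simp add: cube_def closed_cbox)
  then show "lateral_slab P j \<subseteq> slab P j"
    using frontier_subset_closed by (auto simp: lateral_slab_def slab_def)
qed

lemma face_in_lateral_slab:
  assumes "x \<in> cube" "t \<in> {0..time P j}" "s = 0 \<or> s = 1"
  shows "(set_coord k s x, t) \<in> lateral_slab P j"
proof -
  have "set_coord k s x \<in> cube" using assms by (intro set_coord_in_cube) auto
  moreover have "set_coord k s x \<notin> box 0 1"
    using assms(3) by (auto simp: mem_box_cart intro!: exI[of _ k])
  ultimately show ?thesis
    using assms(2) by (simp add: lateral_slab_def cube_def frontier_cbox)
qed

lemma sup_norm_lateral: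
  assumes "continuous_on (slab P j) g" "z \<in> lateral_slab P j"
  shows "\<bar>g z\<bar> \<le> sup_norm (lateral_slab P j) g"
  by (rule sup_norm_upper[OF compact_lateral_slab continuous_on_subset[OF assms(1) lateral_slab_subset] assms(2)])

lemma lateral_slab_nonempty: "lateral_slab P j \<noteq> {}"
proof -
  have "(0 :: real ^ 'd) \<in> cube" by (simp add: mem_cube)
  from face_in_lateral_slab[OF this, of 0 j 0] time_nonneg[of j] show ?thesis by auto
qed

lemma sup_norm_lateral_nonneg:
  assumes "continuous_on (slab P j) g"
  shows "0 \<le> sup_norm (lateral_slab P j) g"
  using lateral_slab_nonempty sup_norm_lateral[OF assms] by (meson abs_ge_zero ex_in_conv order_trans)

lemma partial_le_Ck_norm:
  assumes "Ck_on 1 (slab P j) g" "z \<in> lateral_slab P j" "b \<in> Basis"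
  shows "\<bar>partial (slab P j) b g z\<bar> \<le> Ck_norm 1 (slab P j) (lateral_slab P j) g"
proof -
  have c: "continuous_on (slab P j) (partial (slab P j) e g)" if "e \<in> Basis" for e
    using assms(1) that by simp
  have "\<bar>partial (slab P j) b g z\<bar> \<le> sup_norm (lateral_slab P j) (partial (slab P j) b g)"
    by (rule sup_norm_lateral[OF c assms(2)]) (rule assms(3))
  also have "\<dots> \<le> (\<Sum>e\<in>Basis. sup_norm (lateral_slab P j) (partial (slab P j) e g))"
    by (rule member_le_sum) (auto intro: assms(3) sup_norm_lateral_nonneg c)
  also have "\<dots> \<le> Ck_norm 1 (slab P j) (lateral_slab P j) g"
    using sup_norm_lateral_nonneg[OF Ck_on_imp_continuous[OF assms(1)]] by simp
  finally show ?thesis .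
qed

lemma sup_v_bound:
  assumes "j \<in> {1..n}" "z \<in> lateral_slab P j"
  shows "\<bar>err_v P j z\<bar> \<le> sup_v j"
proof -
  have "unique_derivatives (slab P j)" using assms by (auto intro: unique_slab)
  from sup_norm_lateral[OF Ck_on_imp_continuous[OF Ck_on_v_net[OF this assms(1), of 0]] assms(2)]
    sup_norm_lateral[OF Ck_on_imp_continuous[OF Ck_on_v[OF assms(1)]] assms(2)]
  show ?thesis by (simp add: err_v_def sup_v_def)
qed

lemma sup_u_bound:
  assumes j: "j \<in> {1..n}" and z: "z \<in> lateral_slab P j"
  shows "\<bar>partial (slab P j) (axis k 1, 0) (err_u P j) z\<bar> \<le> sup_u j"
proof -
  have uS: "unique_derivatives (slab P j)" using assms by (auto intro: unique_slab)
  have zS: "z \<in> slab P j" using z lateral_slab_subset by auto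
  have u: "Ck_on 1 (slab P j) (sol_u P)" "Ck_on 1 (slab P j) (u_net P j)"
    using Ck_on_mono[OF Ck_on_u[OF j], of 1] Ck_on_u_net[OF uS j] by auto
  have "partial (slab P j) (axis k 1, 0) (err_u P j) z
      = partial (slab P j) (axis k 1, 0) (u_net P j) z - partial (slab P j) (axis k 1, 0) (sol_u P) z"
    unfolding err_u_def[abs_def] by (rule partial_diff[OF uS u(2,1) _ zS]) simp
  with partial_le_Ck_norm[OF u(1) z axis_in_Basis_prod, of k] partial_le_Ck_norm[OF u(2) z axis_in_Basis_prod, of k]
  show ?thesis unfolding sup_u_def by linarith
qed

lemma sup_nonneg:
  assumes "j \<in> {1..n}"
  shows "0 \<le> sup_u j" "0 \<le> sup_v j"
  using lateral_slab_nonempty sup_u_bound[OF assms] sup_v_bound[OF assms]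
  by (meson abs_ge_zero ex_in_conv order_trans)+

lemma C_bd_eq:
  "C_bd1 P j = sqrt (boundary_area TYPE('d)) * sup_u j"
  "C_bd2 P j = sqrt (boundary_area TYPE('d)) * sup_v j"
  by (simp_all only: C_bd1_def C_bd2_def sup_u_def sup_v_def)

text \<open>
  With the product rule \<open>a g - a' g' = (a - a') g + a' (g - g')\<close> the jump of the flux of the error is
  bounded by the boundary residuals. It does not depend on which of the two faces of a pair is chosen.
\<close>

lemma flux_jump_bound:
  fixes F :: "'d face"
  assumes j: "j \<in> {1..n}" and z: "z \<in> time_block P j"
  shows "\<bar>flux_jump (slab P j) (err_u P j) (err_v P j) (fst F) z\<bar>
    \<le> sup_u j * \<bar>pull_face (R_sb1 P j) F z\<bar> + sup_v j * norm (R_sb2 P j F (to_face F (fst z), snd z))"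
proof -
  obtain x t where xt: "z = (x, t)" by fastforce
  have x: "x \<in> cube" and t: "t \<in> {0..time P j}"
    using z block_subset_slab[of j] by (auto simp: xt slab_def)
  define g where "g y = partial (slab P j) (axis (fst F) 1, 0) (err_u P j) (y, t)" for y
  define a where "a y = err_v P j (y, t)" for y
  define y where "y = set_coord (fst F) (face_value F) x"
  define y' where "y' = set_coord (fst F) (1 - face_value F) x"
  have lat: "(y, t) \<in> lateral_slab P j" "(y', t) \<in> lateral_slab P j"
    unfolding y_def y'_def using x t by (auto intro!: face_in_lateral_slab simp: face_value_def)
  have "\<bar>flux_jump (slab P j) (err_u P j) (err_v P j) (fst F) z\<bar> = \<bar>a y * g y - a y' * g y'\<bar>"
    by (auto simp: flux_jump_def flux_def a_def g_def y_def y'_def xt face_value_def)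
  also have "\<dots> = \<bar>(a y - a y') * g y + a y' * (g y - g y')\<bar>" by (simp add: algebra_simps)
  also have "\<dots> \<le> \<bar>g y\<bar> * \<bar>a y - a y'\<bar> + \<bar>a y'\<bar> * \<bar>g y - g y'\<bar>"
    by (metis abs_mult abs_triangle_ineq mult.commute)
  also have "\<dots> \<le> sup_u j * \<bar>pull_face (R_sb1 P j) F z\<bar> + sup_v j * norm (R_sb2 P j F (to_face F (fst z), snd z))"
  proof (intro add_mono mult_mono)
    show "\<bar>g y\<bar> \<le> sup_u j" "\<bar>a y'\<bar> \<le> sup_v j"
      unfolding g_def a_def by (intro sup_u_bound sup_v_bound lat j)+
    show "\<bar>a y - a y'\<bar> \<le> \<bar>pull_face (R_sb1 P j) F z\<bar>"
      using err_jumps(1)[OF j x t, of F] by (simp add: a_def xt y_def y'_def)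
    show "\<bar>g y - g y'\<bar> \<le> norm (R_sb2 P j F (to_face F (fst z), snd z))"
      using err_jumps(2)[OF j x t, of "fst F" F] component_le_norm_cart[of "R_sb2 P j F (to_face F x, t)" "fst F"]
      by (simp add: g_def xt y_def y'_def)
  qed (use sup_nonneg[OF j] in auto)
  finally show ?thesis .
qed

text \<open>
  Each pair of opposite faces contributes one jump but two residuals. Averaging over the two faces
  turns twice the sum over the pairs into a sum over all faces, to which the Cauchy-Schwarz inequality
  applies.
\<close>

lemma flux_integral_bound:
  assumes j: "j \<in> {1..n}"
  shows "2 * (\<Sum>k\<in>UNIV. integral (time_block P j) (\<lambda>z. \<bar>flux_jump (slab P j) (err_u P j) (err_v P j) k z\<bar>))
    \<le> sqrt h * (C_bd1 P j * sqrt (boundary_integral {time P (j - 1)..time P j} (sq_sb1 P j))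
              + C_bd2 P j * sqrt (boundary_integral {time P (j - 1)..time P j} (sq_sb2 P j)))"
proof -
  let ?B = "time_block P j" and ?I = "{time P (j - 1)..time P j}"
  define J where "J k z = \<bar>flux_jump (slab P j) (err_u P j) (err_v P j) k z\<bar>" for k z
  define r1 where "r1 F z = \<bar>pull_face (R_sb1 P j) F z\<bar>" for F z
  define r2 where "r2 F z = norm (R_sb2 P j F (to_face F (fst z), snd z))" for F z
  have B: "?B = cube \<times> ?I" by (simp add: time_block_def)
  have lt: "time P (j - 1) < time P j" using h_pos time_pred[of j] j by auto
  have j1: "1 \<le> j" and uS: "unique_derivatives (slab P j)" using j by (auto intro: unique_slab)
  have c1: "continuous_on ?B (r1 F)" for F
    unfolding r1_def by (intro continuous_intros Ck_on_imp_continuous[OF Ck_on_pull_face_R_sb1[OF j, of 0]])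
  have c2: "continuous_on ?B (r2 F)" for F
    unfolding r2_def
  proof (rule continuous_on_norm)
    have "continuous_on ?B (\<lambda>z. \<chi> k. R_sb2 P j F (to_face F (fst z), snd z) $ k)"
      by (intro continuous_on_vec_lambda Ck_on_imp_continuous[OF Ck_on_pull_face_R_sb2[OF j, of 0]])
    then show "continuous_on ?B (\<lambda>z. R_sb2 P j F (to_face F (fst z), snd z))" by simp
  qed
  have cJ: "continuous_on ?B (J k)" for k
  proof -
    have "Ck_on 1 (slab P j) (err_u P j)" by (rule Ck_on_mono[OF Ck_on_err_u[OF j]]) simp
    then have "Ck_on 0 (slab P j) (flux (slab P j) (err_u P j) (err_v P j) k)"
      unfolding flux_def[abs_def]
      by (intro Ck_on_mult uS Ck_on_mono[OF Ck_on_err_v[OF j]] Ck_on_partial) auto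
    note f = Ck_on_imp_continuous[OF Ck_on_block_face[OF j1 this]]
    show ?thesis
      unfolding J_def flux_jump_def by (intro continuous_intros f) auto
  qed
  have int: "f integrable_on ?B" if "continuous_on ?B f" for f :: "(real ^ 'd) \<times> real \<Rightarrow> real"
    using that unfolding B by (rule integrable_cylinder)
  have bd: "2 * J k z \<le> (\<Sum>b\<in>UNIV. sup_u j * r1 (k, b) z + sup_v j * r2 (k, b) z)" if "z \<in> ?B" for k z
    using flux_jump_bound[OF j that, of "(k, True)"] flux_jump_bound[OF j that, of "(k, False)"]
    by (simp add: J_def r1_def r2_def UNIV_bool)
  have "2 * (\<Sum>k\<in>UNIV. integral ?B (J k)) = (\<Sum>k\<in>UNIV. integral ?B (\<lambda>z. 2 * J k z))"
    by (simp add: sum_distrib_left)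
  also have "\<dots> \<le> (\<Sum>k\<in>UNIV. integral ?B (\<lambda>z. \<Sum>b\<in>UNIV. sup_u j * r1 (k, b) z + sup_v j * r2 (k, b) z))"
    by (intro sum_mono integral_le bd int continuous_intros c1 c2 cJ)
  also have "\<dots> = (\<Sum>k\<in>UNIV. \<Sum>b\<in>UNIV. sup_u j * integral ?B (r1 (k, b)) + sup_v j * integral ?B (r2 (k, b)))"
  proof -
    have "(\<lambda>z. sup_u j * r1 F z) integrable_on ?B" "(\<lambda>z. sup_v j * r2 F z) integrable_on ?B" for F
      by (intro int continuous_intros c1 c2)+
    then show ?thesis by (simp add: integral_sum integral_add integrable_add)
  qed
  also have "\<dots> = (\<Sum>F\<in>UNIV. sup_u j * integral ?B (r1 F) + sup_v j * integral ?B (r2 F))"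
    by (simp add: sum.cartesian_product UNIV_Times_UNIV case_prod_beta)
  also have "\<dots> = sup_u j * (\<Sum>F\<in>UNIV. integral ?B (r1 F)) + sup_v j * (\<Sum>F\<in>UNIV. integral ?B (r2 F))"
    by (simp add: sum.distrib sum_distrib_left)
  also have "\<dots> \<le> sup_u j * (sqrt (boundary_area TYPE('d) * h) * sqrt (\<Sum>F\<in>UNIV. integral ?B (\<lambda>z. (r1 F z)\<^sup>2)))
      + sup_v j * (sqrt (boundary_area TYPE('d) * h) * sqrt (\<Sum>F\<in>UNIV. integral ?B (\<lambda>z. (r2 F z)\<^sup>2)))"
  proof -
    have area: "real CARD('d \<times> bool) * (time P j - time P (j - 1)) = boundary_area TYPE('d) * h"
      using time_pred[OF j1] by (simp add: boundary_area_def)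
    show ?thesis
      using sum_integral_le_sqrt[OF finite _ lt, where A = UNIV and f = r1] sum_integral_le_sqrt[OF finite _ lt, where A = UNIV and f = r2]
        c1 c2 sup_nonneg[OF j]
      unfolding area B by (intro add_mono mult_left_mono) auto
  qed
  also have "(\<Sum>F\<in>UNIV. integral ?B (\<lambda>z. (r1 F z)\<^sup>2)) = boundary_integral ?I (sq_sb1 P j)"
    by (simp add: boundary_integral_def B r1_def pull_face_def[abs_def] sq_sb1_def)
  also have "(\<Sum>F\<in>UNIV. integral ?B (\<lambda>z. (r2 F z)\<^sup>2)) = boundary_integral ?I (sq_sb2 P j)"
    by (simp add: boundary_integral_def B r2_def pull_face_def[abs_def] sq_sb2_def)
  finally show ?thesis
    unfolding J_def C_bd_eq real_sqrt_mult by (simp add: algebra_simps)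
qed

text \<open>The energy of the error of block \<open>j\<close> at time \<open>t\<close>.\<close>

definition "err_energy j = energy (slab P j) (err_u P j) (err_v P j)"

lemma err_energy_eq_slice:
  assumes "j \<in> {1..n}" "t \<in> {0..time P j}"
  shows "err_energy j t = slice_energy (\<lambda>x. err_u P j (x, t)) (\<lambda>x. err_v P j (x, t))"
proof -
  have "Ck_on 1 (slab P j) (err_u P j)" by (rule Ck_on_mono[OF Ck_on_err_u[OF assms(1)]]) simp
  from energy_eq_slice_energy[OF this[unfolded slab_def] assms(2)] show ?thesis
    by (simp add: err_energy_def slab_def)
qed

lemma err_energy_nonneg: "0 \<le> err_energy j t"
proof -
  have "0 \<le> integral cube f" if "\<And>x. 0 \<le> f x" for f :: "real ^ 'd \<Rightarrow> real"
    using that by (cases "f integrable_on cube") (auto intro: integral_nonneg simp: not_integrable_integral)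
  then show ?thesis by (simp add: err_energy_def energy_def)
qed

text \<open>
  The error at the beginning of a block is the initial residual plus the error at the end of the
  previous block; the latter is zero on the first block.
\<close>

lemma err_energy_start:
  assumes j: "j \<in> {1..n}"
  shows "err_energy j (time P (j - 1))
    \<le> 2 * (integral cube (sq_tb1 P j j) + integral cube (sq_tb2 P j j) + integral cube (sq_grad_tb1 P j j))
      + 2 * (if j = 1 then 0 else err_energy (j - 1) (time P (j - 1)))"
proof -
  define t where "t = time P (j - 1)"
  define p where "p x = (if j = 1 then 0 else err_u P (j - 1) (x, t))" for x
  define r where "r x = (if j = 1 then 0 else err_v P (j - 1) (x, t))" for x
  have t: "t \<in> {0..time P j}" using time_nonneg time_mono[of "j - 1" j] by (auto simp: t_def)
  have jj: "j \<in> {1..j}" using j by auto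
  note R = Ck_on_mono[OF Ck_on_R_tb(1)[OF j jj], of 1] Ck_on_mono[OF Ck_on_R_tb(2)[OF j jj], of 0]
  have init: "sol_u P (x, 0) = psi1 P x" "sol_v P (x, 0) = psi2 P x" if "x \<in> cube" for x
    using sol that by (auto simp: classical_solution_def Let_def)
  have t0: "j = 1 \<Longrightarrow> t = 0" by (simp add: t_def time_def)
  have split: "err_u P j (x, t) = R_tb1 P j j x + p x" "err_v P j (x, t) = R_tb2 P j j x + r x"
    if "x \<in> cube" for x
    using init[OF that] j t0 by (auto simp: R_tb1_def R_tb2_def u_start_def v_start_def err_u_def err_v_def p_def r_def t_def)
  have pr: "Ck_on 1 cube p \<and> Ck_on 0 cube r \<and>
      slice_energy p r = (if j = 1 then 0 else err_energy (j - 1) t)"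
  proof (cases "j = 1")
    case True
    then have "p = (\<lambda>x. 0)" "r = (\<lambda>x. 0)" by (auto simp: p_def r_def)
    then show ?thesis
      using True slice_energy_zero by (simp add: Ck_on_const[OF unique_derivatives_cube] del: Ck_on.simps)
  next
    case False
    then have j': "j - 1 \<in> {1..n}" using j by auto
    have t': "t \<in> {0..time P (j - 1)}" using time_nonneg by (simp add: t_def)
    have "Ck_on 1 cube (\<lambda>x. err_u P (j - 1) (x, t))" "Ck_on 0 cube (\<lambda>x. err_v P (j - 1) (x, t))"
      using Ck_on_mono[OF Ck_on_err_u[OF j'], of 1] Ck_on_mono[OF Ck_on_err_v[OF j'], of 0] t'
      by (auto simp: slab_def simp del: Ck_on.simps intro: Ck_on_slice)
    then show ?thesis
      using False err_energy_eq_slice[OF j' t'] by (simp add: p_def[abs_def] r_def[abs_def] del: Ck_on.simps)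
  qed
  have "err_energy j t = slice_energy (\<lambda>x. R_tb1 P j j x + p x) (\<lambda>x. R_tb2 P j j x + r x)"
    unfolding err_energy_eq_slice[OF j t] by (intro slice_energy_cong split)
  also have "\<dots> \<le> 2 * slice_energy (R_tb1 P j j) (R_tb2 P j j) + 2 * slice_energy p r"
    using pr R by (intro slice_energy_add_le) (simp_all del: Ck_on.simps)
  also have "slice_energy (R_tb1 P j j) (R_tb2 P j j)
      = integral cube (sq_tb1 P j j) + integral cube (sq_tb2 P j j) + integral cube (sq_grad_tb1 P j j)"
    using slice_energy_eq[of "R_tb1 P j j" "R_tb2 P j j"] R
    by (simp add: sq_tb1_def[abs_def] sq_tb2_def[abs_def] sq_grad_tb1_def[abs_def] del: Ck_on.simps)
  also have "slice_energy p r = (if j = 1 then 0 else err_energy (j - 1) t)" using pr by blast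
  finally show ?thesis unfolding t_def .
qed

text \<open>
  Of the sums over the earlier initial times in \<open>C_block\<close>, only the last terms are needed.
\<close>

lemma C_block_lower:
  assumes j: "j \<in> {1..n}"
  shows "2 * (integral cube (sq_tb1 P j j) + integral cube (sq_tb2 P j j) + integral cube (sq_grad_tb1 P j j))
    + (integral (time_block P j) (sq_int1 P j) + integral (time_block P j) (sq_int2 P j)
       + integral (time_block P j) (sq_grad_int1 P j))
    + sqrt h * (C_bd1 P j * sqrt (boundary_integral {time P (j - 1)..time P j} (sq_sb1 P j))
              + C_bd2 P j * sqrt (boundary_integral {time P (j - 1)..time P j} (sq_sb2 P j)))
    \<le> C_block P j"
proof -
  define mi where "mi = M_int P j powr (- 2 / (real CARD('d) + 1))"
  define mt where "mt = M_tb P j powr (- 2 / real CARD('d))"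
  define ms where "ms = M_sb P j powr (- 2 / real CARD('d))"
  define D where "D g = const_D P g * mt + Q_D (N_tb P j) g" for g
  define I where "I g = const_int P j g * mi + Q_int P j (N_int P j) g" for g
  define W where "W g = const_sb P j g * ms + Q_sb P j (N_sb P j) g" for g
  have jj: "j \<in> {1..j}" using j by auto
  have D: "integral cube g \<le> D g" if "Ck_on 2 cube g" for g
    using quad_D_bound(2)[OF j that] by (simp add: D_def mt_def)
  have D_nonneg: "0 \<le> D g" if "Ck_on 2 cube g" "\<And>x. 0 \<le> g x" for g
    using quad_D_bound(1)[OF j that(1)] Q_D_nonneg[of g] that(2) by (simp add: D_def mt_def)
  have I: "integral (time_block P j) g \<le> I g" if "Ck_on 2 (time_block P j) g" for g
    using quad_int_bound(2)[OF j that] by (simp add: I_def mi_def)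
  have W: "boundary_integral {time P (j - 1)..time P j} g \<le> W g"
    if "\<And>F. Ck_on 2 (time_block P j) (pull_face g F)" for g
    using quad_sb_bound(2)[OF j that] by (simp add: W_def ms_def)
  have W_nonneg: "0 \<le> W g" if "\<And>F. Ck_on 2 (time_block P j) (pull_face g F)" "\<And>F z. 0 \<le> g F z" for g
    using quad_sb_bound(1)[OF j that(1)] Q_sb_nonneg[of P g] that(2) h_pos by (simp add: W_def ms_def)
  have C_bd: "0 \<le> C_bd1 P j" "0 \<le> C_bd2 P j"
    using sup_nonneg[OF j] by (simp_all add: C_bd_eq boundary_area_def)
  have block: "C_block P j = 2 * (\<Sum>k=1..j. D (sq_tb1 P j k) + D (sq_tb2 P j k)) + 2 * (\<Sum>k=1..j. D (sq_grad_tb1 P j k))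
      + (I (sq_int1 P j) + I (sq_int2 P j) + I (sq_grad_int1 P j))
      + 2 * sqrt h * (C_bd1 P j * sqrt (W (sq_sb1 P j)) + C_bd2 P j * sqrt (W (sq_sb2 P j)))"
    unfolding C_block_def Let_def D_def I_def W_def mi_def mt_def ms_def
    using h_pos by (simp add: add.assoc)
  have sq: "0 \<le> sq_tb1 P j k x" "0 \<le> sq_tb2 P j k x" "0 \<le> sq_grad_tb1 P j k x" "0 \<le> sq_sb1 P j F z" "0 \<le> sq_sb2 P j F z"
    for k x F z
    by (simp_all add: sq_tb1_def sq_tb2_def sq_grad_tb1_def sq_sb1_def sq_sb2_def)
  have tb12: "D (sq_tb1 P j j) + D (sq_tb2 P j j) \<le> (\<Sum>k=1..j. D (sq_tb1 P j k) + D (sq_tb2 P j k))"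
    using jj by (intro member_le_sum[where f = "\<lambda>k. D (sq_tb1 P j k) + D (sq_tb2 P j k)"] add_nonneg_nonneg D_nonneg Ck_on_sq_tb[OF j] sq) auto
  have tb3: "D (sq_grad_tb1 P j j) \<le> (\<Sum>k=1..j. D (sq_grad_tb1 P j k))"
    using jj by (intro member_le_sum[where f = "\<lambda>k. D (sq_grad_tb1 P j k)"] D_nonneg Ck_on_sq_tb[OF j] sq) auto
  have initial: "2 * (integral cube (sq_tb1 P j j) + integral cube (sq_tb2 P j j) + integral cube (sq_grad_tb1 P j j))
      \<le> 2 * (\<Sum>k=1..j. D (sq_tb1 P j k) + D (sq_tb2 P j k)) + 2 * (\<Sum>k=1..j. D (sq_grad_tb1 P j k))"
    unfolding distrib_left[symmetric]
    using tb12 tb3 D[OF Ck_on_sq_tb(1)[OF j jj]] D[OF Ck_on_sq_tb(2)[OF j jj]] D[OF Ck_on_sq_tb(3)[OF j jj]]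
    by (intro mult_left_mono) simp_all
  have interior: "integral (time_block P j) (sq_int1 P j) + integral (time_block P j) (sq_int2 P j)
       + integral (time_block P j) (sq_grad_int1 P j) \<le> I (sq_int1 P j) + I (sq_int2 P j) + I (sq_grad_int1 P j)"
    by (intro add_mono I Ck_on_sq_int[OF j])
  have boundary: "sqrt h * (C_bd1 P j * sqrt (boundary_integral {time P (j - 1)..time P j} (sq_sb1 P j))
              + C_bd2 P j * sqrt (boundary_integral {time P (j - 1)..time P j} (sq_sb2 P j)))
      \<le> 2 * sqrt h * (C_bd1 P j * sqrt (W (sq_sb1 P j)) + C_bd2 P j * sqrt (W (sq_sb2 P j)))"
  proof -
    let ?Y = "C_bd1 P j * sqrt (W (sq_sb1 P j)) + C_bd2 P j * sqrt (W (sq_sb2 P j))"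
    let ?X = "C_bd1 P j * sqrt (boundary_integral {time P (j - 1)..time P j} (sq_sb1 P j))
        + C_bd2 P j * sqrt (boundary_integral {time P (j - 1)..time P j} (sq_sb2 P j))"
    have "?X \<le> ?Y"
      by (intro add_mono mult_left_mono real_sqrt_le_mono W Ck_on_sq_sb[OF j] C_bd)
    then have "sqrt h * ?X \<le> sqrt h * ?Y" using h_pos by (intro mult_left_mono) auto
    moreover have "0 \<le> ?Y"
      by (intro add_nonneg_nonneg mult_nonneg_nonneg real_sqrt_ge_zero W_nonneg Ck_on_sq_sb[OF j] sq C_bd)
    then have "0 \<le> sqrt h * ?Y" using h_pos by (intro mult_nonneg_nonneg) auto
    ultimately show ?thesis by linarith
  qed
  show ?thesis
    unfolding block by (rule add_mono[OF add_mono[OF initial interior] boundary])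
qed

lemma err_energy_block:
  assumes j: "j \<in> {1..n}" and t: "t \<in> {time P (j - 1)..time P j}"
  shows "err_energy j t
    \<le> (C_block P j + 2 * (if j = 1 then 0 else err_energy (j - 1) (time P (j - 1)))) * exp (2 * h)"
proof -
  let ?S = "slab P j" and ?B = "time_block P j"
  have j1: "1 \<le> j" using j by simp
  define A where "A = err_energy j (time P (j - 1))
    + integral ?B (\<lambda>z. (R_int1 P j z)\<^sup>2 + (R_int2 P j z)\<^sup>2 + (norm (grad ?S (R_int1 P j) z))\<^sup>2)
    + 2 * (\<Sum>k\<in>UNIV. integral ?B (\<lambda>z. \<bar>flux_jump ?S (err_u P j) (err_v P j) k z\<bar>))"
  have est: "err_energy j s \<le> A * exp (2 * (s - time P (j - 1)))" if "s \<in> {time P (j - 1)..time P j}" for s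
    unfolding A_def err_energy_def time_block_def
  proof (rule energy_estimate[OF slab_def time_pos[OF j1] time_nonneg order_refl that])
    show "Ck_on 2 ?S (err_u P j)" "Ck_on 1 ?S (err_v P j)"
      by (rule Ck_on_mono[OF Ck_on_err_u[OF j]], simp, rule Ck_on_mono[OF Ck_on_err_v[OF j]], simp)
  qed (use R_int1_eq[OF j] R_int2_eq[OF j] in auto)
  have "0 \<le> A"
    using est[of "time P (j - 1)"] err_energy_nonneg[of j "time P (j - 1)"] time_mono[of "j - 1" j] by auto
  have ints: "integral ?B (\<lambda>z. (R_int1 P j z)\<^sup>2 + (R_int2 P j z)\<^sup>2 + (norm (grad ?S (R_int1 P j) z))\<^sup>2)
      = integral ?B (sq_int1 P j) + integral ?B (sq_int2 P j) + integral ?B (sq_grad_int1 P j)"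
  proof -
    have "sq_int1 P j integrable_on ?B" "sq_int2 P j integrable_on ?B" "sq_grad_int1 P j integrable_on ?B"
      using Ck_on_imp_continuous[OF Ck_on_sq_int(1)[OF j]] Ck_on_imp_continuous[OF Ck_on_sq_int(2)[OF j]]
        Ck_on_imp_continuous[OF Ck_on_sq_int(3)[OF j]]
      unfolding time_block_def by (auto intro: integrable_cylinder)
    then show ?thesis
      by (simp add: integral_add integrable_add sq_int1_def[abs_def] sq_int2_def[abs_def] sq_grad_int1_def[abs_def])
  qed
  have "A \<le> C_block P j + 2 * (if j = 1 then 0 else err_energy (j - 1) (time P (j - 1)))"
    using C_block_lower[OF j] flux_integral_bound[OF j] err_energy_start[OF j]
    unfolding A_def ints by linarith
  moreover have "exp (2 * (t - time P (j - 1))) \<le> exp (2 * h)"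
    using t time_pred[OF j1] by simp
  ultimately show ?thesis
    using est[OF t] \<open>0 \<le> A\<close> by (meson exp_ge_zero mult_mono order_trans)
qed

lemma err_energy_le:
  assumes "j \<in> {1..n}" "t \<in> {time P (j - 1)..time P j}"
  shows "err_energy j t \<le> C_T P j * exp (2 * h)"
  using assms
proof (induction j arbitrary: t)
  case (Suc j)
  have "(if Suc j = 1 then 0 else err_energy j (time P j)) \<le> C_T P j * exp (2 * h)"
    using Suc.IH[of "time P j"] Suc.prems(1) time_mono[of "j - 1" j] by (cases "j = 0") auto
  then have "C_block P (Suc j) + 2 * (if Suc j = 1 then 0 else err_energy j (time P j)) \<le> C_T P (Suc j)"
    by simp
  then show ?case
    using err_energy_block[OF Suc.prems] by (simp only: diff_Suc_1) (meson exp_ge_zero mult_right_mono order_trans)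
qed simp

lemma total_error_le:
  assumes "1 \<le> n"
  shows "total_error P n \<le> C_T P n * h * exp (2 * h)"
proof -
  let ?I = "{time P (n - 1)..time P n}"
  have n: "n \<in> {1..n}" using assms by simp
  have "continuous_on {0..time P n} (err_energy n)"
    unfolding err_energy_def slab_def
    by (intro continuous_on_energy Ck_on_mono[OF Ck_on_err_u[OF n, unfolded slab_def]]
        Ck_on_mono[OF Ck_on_err_v[OF n, unfolded slab_def]]) auto
  then have "continuous_on ?I (err_energy n)"
    by (rule continuous_on_subset) (use time_nonneg in auto)
  then have int: "err_energy n integrable_on ?I" by (rule integrable_continuous_real)
  have "total_error P n = integral ?I (err_energy n)"
    by (simp add: total_error_def err_energy_def energy_def[abs_def])
  also have "\<dots> \<le> integral ?I (\<lambda>t. C_T P n * exp (2 * h))"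
    by (intro integral_le int integrable_const_ivl err_energy_le n)
  also have "\<dots> = C_T P n * h * exp (2 * h)"
    using time_pred[OF assms] h_pos by simp
  finally show ?thesis .
qed

section \<open>The order of the error bound\<close>

lemma block_train_error_sq_nonneg: "0 \<le> block_train_error_sq P j"
  unfolding block_train_error_sq_def using h_pos
  by (intro add_nonneg_nonneg sum_nonneg real_sqrt_ge_zero Q_int_nonneg Q_D_nonneg Q_sb_nonneg)
    (auto simp: sq_int1_def sq_int2_def sq_grad_int1_def sq_tb1_def sq_tb2_def sq_grad_tb1_def sq_sb1_def sq_sb2_def)

lemma train_error_sq_Suc: "(train_error P (Suc j))\<^sup>2 = block_train_error_sq P (Suc j) + (train_error P j)\<^sup>2"
  using block_train_error_sq_nonneg[of "Suc j"] by simp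

lemma block_train_error_sq_le:
  "j \<in> {1..k} \<Longrightarrow> block_train_error_sq P j \<le> (train_error P k)\<^sup>2"
proof (induction k)
  case (Suc k)
  then show ?case
    using block_train_error_sq_nonneg[of "Suc k"] unfolding train_error_sq_Suc
    by (cases "j = Suc k") auto
qed simp

text \<open>
  Only the quadrature constants of the boundary terms appear under a square root, which turns the
  exponent \<open>-2/d\<close> into \<open>-1/d\<close>. The square roots of the boundary quadratures are themselves summands of
  the squared training error.
\<close>

lemma C_block_upper:
  assumes j: "j \<in> {1..n}"
    and orders: "same_order \<kappa> (M_int P) n" "same_order \<kappa> (M_tb P) n" "same_order \<kappa> (M_sb P) n"
    and B: "constants_le B P n"
  defines "H \<equiv> (train_error P n)\<^sup>2 + M_int P n powr (- 2 / (real CARD('d) + 1))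
    + M_tb P n powr (- 2 / real CARD('d)) + M_sb P n powr (- 1 / real CARD('d))"
  shows "C_block P j \<le> (6 * real n * B * \<kappa> powr (2 / real CARD('d)) + 3 * B * \<kappa> powr (2 / (real CARD('d) + 1))
    + 4 * sqrt h * B * sqrt B * \<kappa> powr (1 / real CARD('d)) + 3 + 2 * sqrt h * B) * H"
proof -
  define d where "d = real CARD('d)"
  define mi where "mi = M_int P j powr (- 2 / (d + 1))"
  define mt where "mt = M_tb P j powr (- 2 / d)"
  define ms where "ms = M_sb P j powr (- 2 / d)"
  define zs where "zs = M_sb P j powr (- 1 / d)"
  define q where "q = block_train_error_sq P j"
  have d: "0 < d" by (simp add: d_def)
  have nn: "n \<in> {1..n}" using j by auto
  have Bd: "C_bd1 P j \<le> B" "C_bd2 P j \<le> B" "const_int P j (sq_int1 P j) \<le> B" "const_int P j (sq_int2 P j) \<le> B"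
      "const_int P j (sq_grad_int1 P j) \<le> B" "const_sb P j (sq_sb1 P j) \<le> B" "const_sb P j (sq_sb2 P j) \<le> B"
    and BD: "\<And>k. k \<in> {1..j} \<Longrightarrow> const_D P (sq_tb1 P j k) \<le> B \<and> const_D P (sq_tb2 P j k) \<le> B
        \<and> const_D P (sq_grad_tb1 P j k) \<le> B"
    using B j by (auto simp: constants_le_def)
  have C_bd: "0 \<le> C_bd1 P j" "0 \<le> C_bd2 P j"
    using sup_nonneg[OF j] by (simp_all add: C_bd_eq boundary_area_def)
  then have "0 \<le> B" using Bd(1) by linarith
  have m: "0 \<le> mi" "0 \<le> mt" "0 \<le> ms" "0 \<le> zs" by (simp_all add: mi_def mt_def ms_def zs_def)
  have zs: "sqrt ms = zs"
    using M_pos(3)[OF j] d by (simp add: ms_def zs_def powr_powr flip: powr_half_sqrt)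
  have H: "mi \<le> \<kappa> powr (2 / (d + 1)) * H" "mt \<le> \<kappa> powr (2 / d) * H" "zs \<le> \<kappa> powr (1 / d) * H" "q \<le> H"
  proof -
    have "M_int P n powr (- 2 / (d + 1)) \<le> H" "M_tb P n powr (- 2 / d) \<le> H" "M_sb P n powr (- 1 / d) \<le> H"
      by (simp_all add: H_def d_def)
    then have "\<kappa> powr (2 / (d + 1)) * M_int P n powr (- (2 / (d + 1))) \<le> \<kappa> powr (2 / (d + 1)) * H"
      "\<kappa> powr (2 / d) * M_tb P n powr (- (2 / d)) \<le> \<kappa> powr (2 / d) * H"
      "\<kappa> powr (1 / d) * M_sb P n powr (- (1 / d)) \<le> \<kappa> powr (1 / d) * H"
      by (simp_all add: mult_left_mono)
    then show "mi \<le> \<kappa> powr (2 / (d + 1)) * H" "mt \<le> \<kappa> powr (2 / d) * H" "zs \<le> \<kappa> powr (1 / d) * H"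
      using powr_le_same_order[OF orders(1) j M_pos(1)[OF j] M_pos(1)[OF nn], of "2 / (d + 1)"]
        powr_le_same_order[OF orders(2) j M_pos(2)[OF j] M_pos(2)[OF nn], of "2 / d"]
        powr_le_same_order[OF orders(3) j M_pos(3)[OF j] M_pos(3)[OF nn], of "1 / d"] d
      by (simp_all add: mi_def mt_def zs_def)
    show "q \<le> H" using block_train_error_sq_le[OF j] by (simp add: q_def H_def add_increasing2)
  qed
  define QD where "QD k = Q_D (N_tb P j) (sq_tb1 P j k) + Q_D (N_tb P j) (sq_tb2 P j k) + Q_D (N_tb P j) (sq_grad_tb1 P j k)" for k
  define QI where "QI = Q_int P j (N_int P j) (sq_int1 P j) + Q_int P j (N_int P j) (sq_int2 P j)
     + Q_int P j (N_int P j) (sq_grad_int1 P j)"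
  define s1 where "s1 = Q_sb P j (N_sb P j) (sq_sb1 P j)"
  define s2 where "s2 = Q_sb P j (N_sb P j) (sq_sb2 P j)"
  have q: "q = QI + (\<Sum>k=1..j. QD k) + sqrt s1 + sqrt s2"
    by (simp add: q_def block_train_error_sq_def QI_def QD_def s1_def s2_def)
  have nonneg: "0 \<le> QI" "0 \<le> (\<Sum>k=1..j. QD k)" "0 \<le> s1" "0 \<le> s2"
    unfolding QI_def QD_def s1_def s2_def using h_pos
    by (intro add_nonneg_nonneg sum_nonneg Q_int_nonneg Q_D_nonneg Q_sb_nonneg;
      auto simp: sq_int1_def sq_int2_def sq_grad_int1_def sq_tb1_def sq_tb2_def sq_grad_tb1_def sq_sb1_def sq_sb2_def)+
  have q_parts: "(\<Sum>k=1..j. QD k) \<le> q" "QI \<le> q" "sqrt s1 + sqrt s2 \<le> q"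
    unfolding q using nonneg by (auto intro: add_increasing)
  have initial: "2 * (\<Sum>k=1..j. const_D P (sq_tb1 P j k) * mt + Q_D (N_tb P j) (sq_tb1 P j k)
         + const_D P (sq_tb2 P j k) * mt + Q_D (N_tb P j) (sq_tb2 P j k))
     + 2 * (\<Sum>k=1..j. const_D P (sq_grad_tb1 P j k) * mt + Q_D (N_tb P j) (sq_grad_tb1 P j k))
     \<le> 6 * real n * B * mt + 2 * q"
  proof -
    have "(\<Sum>k=1..j. const_D P (sq_tb1 P j k) * mt + Q_D (N_tb P j) (sq_tb1 P j k)
         + const_D P (sq_tb2 P j k) * mt + Q_D (N_tb P j) (sq_tb2 P j k))
      + (\<Sum>k=1..j. const_D P (sq_grad_tb1 P j k) * mt + Q_D (N_tb P j) (sq_grad_tb1 P j k))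
      = (\<Sum>k=1..j. (const_D P (sq_tb1 P j k) * mt + const_D P (sq_tb2 P j k) * mt + const_D P (sq_grad_tb1 P j k) * mt) + QD k)"
      by (simp add: QD_def sum.distrib)
    also have "\<dots> \<le> (\<Sum>k=1..j. (B * mt + B * mt + B * mt) + QD k)"
      using BD m by (intro sum_mono add_mono mult_right_mono) auto
    also have "\<dots> = real j * (3 * B * mt) + (\<Sum>k=1..j. QD k)" by (simp add: sum.distrib)
    also have "\<dots> \<le> real n * (3 * B * mt) + q"
      using j m \<open>0 \<le> B\<close> q_parts(1) by (intro add_mono mult_right_mono) auto
    finally show ?thesis by simp
  qed
  have interior: "const_int P j (sq_int1 P j) * mi + Q_int P j (N_int P j) (sq_int1 P j)
     + const_int P j (sq_int2 P j) * mi + Q_int P j (N_int P j) (sq_int2 P j)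
     + const_int P j (sq_grad_int1 P j) * mi + Q_int P j (N_int P j) (sq_grad_int1 P j) \<le> 3 * B * mi + q"
  proof -
    have "const_int P j (sq_int1 P j) * mi \<le> B * mi" "const_int P j (sq_int2 P j) * mi \<le> B * mi"
      "const_int P j (sq_grad_int1 P j) * mi \<le> B * mi"
      using Bd m by (auto intro: mult_right_mono)
    with q_parts(2) show ?thesis by (simp add: QI_def)
  qed
  have root: "c * sqrt (const_sb P j g * ms + s) \<le> B * (sqrt B * zs + sqrt s)"
    if "0 \<le> c" "c \<le> B" "const_sb P j g \<le> B" "0 \<le> s" for c g s
  proof -
    have "const_sb P j g * ms + s \<le> B * ms + s" using that m by (simp add: mult_right_mono)
    then have "sqrt (const_sb P j g * ms + s) \<le> sqrt (B * ms + s)" by simp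
    also have "\<dots> \<le> sqrt (B * ms) + sqrt s"
      using m that \<open>0 \<le> B\<close> by (intro sqrt_add_le_add_sqrt) auto
    also have "\<dots> = sqrt B * zs + sqrt s" by (simp add: real_sqrt_mult zs)
    finally have "c * sqrt (const_sb P j g * ms + s) \<le> c * (sqrt B * zs + sqrt s)"
      using that(1) by (rule mult_left_mono)
    also have "\<dots> \<le> B * (sqrt B * zs + sqrt s)"
      using that m \<open>0 \<le> B\<close> by (intro mult_right_mono) auto
    finally show ?thesis .
  qed
  have boundary: "2 * sqrt h * (C_bd1 P j * sqrt (const_sb P j (sq_sb1 P j) * ms + s1)
         + C_bd2 P j * sqrt (const_sb P j (sq_sb2 P j) * ms + s2))
     \<le> 4 * sqrt h * B * sqrt B * zs + 2 * sqrt h * B * q"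
  proof -
    have "2 * sqrt h * (C_bd1 P j * sqrt (const_sb P j (sq_sb1 P j) * ms + s1)
         + C_bd2 P j * sqrt (const_sb P j (sq_sb2 P j) * ms + s2))
      \<le> 2 * sqrt h * (B * (sqrt B * zs + sqrt s1) + B * (sqrt B * zs + sqrt s2))"
      using h_pos by (intro mult_left_mono add_mono root C_bd Bd nonneg) auto
    also have "\<dots> = 4 * sqrt h * B * sqrt B * zs + 2 * sqrt h * B * (sqrt s1 + sqrt s2)"
      by (simp add: algebra_simps)
    also have "\<dots> \<le> 4 * sqrt h * B * sqrt B * zs + 2 * sqrt h * B * q"
      using h_pos \<open>0 \<le> B\<close> q_parts(3) by (intro add_left_mono mult_left_mono) auto
    finally show ?thesis .
  qed
  have "C_block P j \<le> 6 * real n * B * mt + 3 * B * mi + 4 * sqrt h * B * sqrt B * zs + (3 + 2 * sqrt h * B) * q"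
    using initial interior boundary h_pos
    unfolding C_block_def Let_def mi_def mt_def ms_def d_def s1_def s2_def
    by (simp add: algebra_simps)
  also have "\<dots> \<le> 6 * real n * B * (\<kappa> powr (2 / d) * H) + 3 * B * (\<kappa> powr (2 / (d + 1)) * H)
      + 4 * sqrt h * B * sqrt B * (\<kappa> powr (1 / d) * H) + (3 + 2 * sqrt h * B) * H"
    using h_pos \<open>0 \<le> B\<close> by (intro add_mono mult_left_mono H) auto
  finally show ?thesis by (simp add: d_def algebra_simps)
qed

end

theorem theorem5p3:
  fixes i :: nat and dt B \<kappa> :: real
  assumes "1 \<le> i"
  shows "\<exists>K. \<forall>P :: ('d::finite) pinn_data.
     final_time P > 0 \<and> 1 \<le> blocks P \<and> i \<le> blocks P \<and> time_step P = dt \<and>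
     classical_solution P \<and> Ck_on 4 (slab P i) (sol_u P) \<and> Ck_on 3 (slab P i) (sol_v P) \<and>
     (\<forall>j\<in>{1..i}. hlconc_pinn (CARD('d) + 1) 1 (theta_u P j) \<and>
                 hlconc_pinn (CARD('d) + 1) 1 (theta_v P j)) \<and>
     (\<forall>j\<in>{1..i}. N_int P j \<ge> 1 \<and> N_tb P j \<ge> 1 \<and> N_sb P j \<ge> 1) \<and>
     quad_const_D P \<and> (\<forall>j\<in>{1..i}. quad_const_int P j \<and> quad_const_sb P j)
     \<longrightarrow>
     total_error P i \<le> C_T P i * dt * exp (2 * dt) \<and>
     (same_order \<kappa> (M_int P) i \<and> same_order \<kappa> (M_tb P) i \<and> same_order \<kappa> (M_sb P) i \<and>
      constants_le B P i
      \<longrightarrow>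
      C_T P i * dt * exp (2 * dt) \<le>
        K * ((train_error P i)\<^sup>2 + M_int P i powr (- 2 / (real CARD('d) + 1))
             + M_tb P i powr (- 2 / real CARD('d)) + M_sb P i powr (- 1 / real CARD('d))))"
proof -
  define L where "L = 6 * real i * B * \<kappa> powr (2 / real CARD('d)) + 3 * B * \<kappa> powr (2 / (real CARD('d) + 1))
    + 4 * sqrt dt * B * sqrt B * \<kappa> powr (1 / real CARD('d)) + 3 + 2 * sqrt dt * B"
  define r where "r = 2 * exp (2 * dt)"
  show ?thesis
  proof (intro exI[of _ "L * (\<Sum>m<i. r ^ m) * dt * exp (2 * dt)"] allI impI conjI; elim conjE)
    fix P :: "'d pinn_data"
    assume dt: "time_step P = dt" and *: "0 < final_time P" "1 \<le> blocks P" "i \<le> blocks P" "classical_solution P"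
      "Ck_on 4 (slab P i) (sol_u P)" "Ck_on 3 (slab P i) (sol_v P)"
      "\<forall>j\<in>{1..i}. hlconc_pinn (CARD('d) + 1) 1 (theta_u P j) \<and> hlconc_pinn (CARD('d) + 1) 1 (theta_v P j)"
      "\<forall>j\<in>{1..i}. N_int P j \<ge> 1 \<and> N_tb P j \<ge> 1 \<and> N_sb P j \<ge> 1"
      "quad_const_D P" "\<forall>j\<in>{1..i}. quad_const_int P j \<and> quad_const_sb P j"
    interpret pinn_approximation P i
      by unfold_locales (use * in auto)
    show "total_error P i \<le> C_T P i * dt * exp (2 * dt)"
      using total_error_le[OF assms] by (simp add: dt)
    assume hyps: "same_order \<kappa> (M_int P) i" "same_order \<kappa> (M_tb P) i" "same_order \<kappa> (M_sb P) i" "constants_le B P i"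
    define H where "H = (train_error P i)\<^sup>2 + M_int P i powr (- 2 / (real CARD('d) + 1))
      + M_tb P i powr (- 2 / real CARD('d)) + M_sb P i powr (- 1 / real CARD('d))"
    have block: "C_block P j \<le> L * H" if "j \<in> {1..i}" for j
      using C_block_upper[OF that hyps] by (simp add: L_def H_def dt)
    have "j \<le> i \<Longrightarrow> C_T P j \<le> L * H * (\<Sum>m<j. r ^ m)" for j
    proof (induction j)
      case (Suc j)
      have "C_T P (Suc j) \<le> L * H + r * C_T P j"
        using block[of "Suc j"] Suc.prems by (simp add: r_def dt)
      also have "\<dots> \<le> L * H + r * (L * H * (\<Sum>m<j. r ^ m))"
        using Suc by (intro add_left_mono mult_left_mono) (auto simp: r_def)
      also have "\<dots> = L * H * (\<Sum>m<Suc j. r ^ m)"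
        unfolding sum.lessThan_Suc_shift by (simp add: algebra_simps sum_distrib_left)
      finally show ?case .
    qed simp
    then have "C_T P i * (dt * exp (2 * dt)) \<le> L * H * (\<Sum>m<i. r ^ m) * (dt * exp (2 * dt))"
      using h_pos by (intro mult_right_mono) (auto simp: dt)
    then show "C_T P i * dt * exp (2 * dt) \<le> L * (\<Sum>m<i. r ^ m) * dt * exp (2 * dt) *
        ((train_error P i)\<^sup>2 + M_int P i powr (- 2 / (real CARD('d) + 1))
             + M_tb P i powr (- 2 / real CARD('d)) + M_sb P i powr (- 1 / real CARD('d)))"
      unfolding H_def[symmetric] by (simp add: ac_simps)
  qed
qed

end
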